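(* Let $c\ge1$ and let $G$ be a finite nilpotent group of class $t\ge1$. For $2\le j\le t$ put $Q_j=G/\gamma_j(G)$. Then (i) $|\gamma_{c+1}(G)|\,|M^{(c)}(G)|$ divides $|M^{(c)}(G/G')|\prod_{k=1}^{t-1}|\otimes^{c+1}(\gamma_{k+1}(G),Q_{k+1})|$; (ii) $\exp(M^{(c)}(G))$ divides $\exp(M^{(c)}(G/G'))\prod_{k=1}^{t-1}\exp(\otimes^{c+1}(\gamma_{k+1}(G),Q_{k+1}))$; (iii) $d(M^{(c)}(G))\le d(M^{(c)}(G/G'))+\sum_{k=1}^{t-1}d(\otimes^{c+1}(\gamma_{k+1}(G),Q_{k+1}))$.
   Context: $\gamma_1(X)=X$, $\gamma_{i+1}(X)=[\gamma_i(X),X]$; $G'=\gamma_2(G)$. For subgroups $U,V$, $[U,{}_0V]=U$, $[U,{}_{i+1}V]=[[U,{}_iV],V]$. The $c$-nilpotent multiplier of $G\cong F/R$ ($F$ free) is $M^{(c)}(G)=(R\cap\gamma_{c+1}(F))/[R,{}_cF]$, independent of the presentation. For groups $B,A$, $\otimes^{c+1}(B,A)$ denotes the tensor product over $\mathbb Z$ $B_{ab}\otimes A_{ab}\otimes\cdots\otimes A_{ab}$ with $c$ copies of $A_{ab}$, where $X_{ab}=X/X'$. $d(X)$ is the minimal number of generators of $X$ and $\exp(X)$ its exponent. *)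

theory Defs
  imports "HOL-Algebra.Algebra"
begin

definition comm_subgroup :: "('a, 'b) monoid_scheme \<Rightarrow> 'a set \<Rightarrow> 'a set \<Rightarrow> 'a set" where
  "comm_subgroup G U V = generate G
     {inv\<^bsub>G\<^esub> x \<otimes>\<^bsub>G\<^esub> inv\<^bsub>G\<^esub> y \<otimes>\<^bsub>G\<^esub> x \<otimes>\<^bsub>G\<^esub> y | x y. x \<in> U \<and> y \<in> V}"

text \<open>Lower central series, indexed as in the paper: gamma G 1 = G, gamma G (i+1) = [gamma G i, G].
  (The value at index 0 is a junk value, also set to G.)\<close>
fun gamma :: "('a, 'b) monoid_scheme \<Rightarrow> nat \<Rightarrow> 'a set" where
  "gamma G 0 = carrier G"
| "gamma G (Suc 0) = carrier G"
| "gamma G (Suc (Suc i)) = comm_subgroup G (gamma G (Suc i)) (carrier G)"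

fun iter_comm :: "('a, 'b) monoid_scheme \<Rightarrow> 'a set \<Rightarrow> 'a set \<Rightarrow> nat \<Rightarrow> 'a set" where
  "iter_comm G U V 0 = U"
| "iter_comm G U V (Suc i) = comm_subgroup G (iter_comm G U V i) V"

definition nilpotent_of_class :: "('a, 'b) monoid_scheme \<Rightarrow> nat \<Rightarrow> bool" where
  "nilpotent_of_class G t \<longleftrightarrow> gamma G (Suc t) = {\<one>\<^bsub>G\<^esub>} \<and> (\<forall>s<t. gamma G (Suc s) \<noteq> {\<one>\<^bsub>G\<^esub>})"

definition abelianization :: "('a, 'b) monoid_scheme \<Rightarrow> 'a set monoid" where
  "abelianization G = G Mod (gamma G 2)"

text \<open>A letter (True, x) stands for x, (False, x) for x^-1.\<close>
definition inverse_letters :: "bool \<times> 'a \<Rightarrow> bool \<times> 'a \<Rightarrow> bool" where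
  "inverse_letters a b \<longleftrightarrow> snd a = snd b \<and> fst a \<noteq> fst b"

fun word_normalize :: "(bool \<times> 'a) list \<Rightarrow> (bool \<times> 'a) list" where
  "word_normalize [] = []"
| "word_normalize (a # w) =
     (case word_normalize w of
        [] \<Rightarrow> [a]
      | b # v \<Rightarrow> (if inverse_letters a b then v else a # b # v))"

definition free_group :: "'a set \<Rightarrow> (bool \<times> 'a) list monoid" where
  "free_group S = \<lparr>carrier = {w. word_normalize w = w \<and> snd ` set w \<subseteq> S},
                   monoid.mult = (\<lambda>u v. word_normalize (u @ v)),
                   monoid.one = []\<rparr>"

fun word_eval :: "('a, 'b) monoid_scheme \<Rightarrow> (bool \<times> 'a) list \<Rightarrow> 'a" where
  "word_eval G [] = \<one>\<^bsub>G\<^esub>"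
| "word_eval G ((e, x) # w) = (if e then x else inv\<^bsub>G\<^esub> x) \<otimes>\<^bsub>G\<^esub> word_eval G w"

text \<open>Computed from the standard free presentation G = F/R with F the free group on the
  underlying set of G and R the kernel of the evaluation map F \<rightarrow> G:
  M^(c)(G) = (R \<inter> gamma_{c+1}(F)) / [R, _c F].\<close>
definition c_nilpotent_multiplier ::
  "nat \<Rightarrow> ('a, 'b) monoid_scheme \<Rightarrow> (bool \<times> 'a) list set monoid" where
  "c_nilpotent_multiplier c G =
     (let F = free_group (carrier G);
          R = kernel F G (word_eval G)
      in subgroup_generated F (R \<inter> gamma F (Suc c)) Mod iter_comm F R (carrier F) c)"

text \<open>B \<otimes> A \<otimes> ... \<otimes> A (c copies of A) over Z, for abelian groups B, A: the free abelian
  group on tuples (b, [a_1,...,a_c]) modulo the relations expressing additivity in each slot.\<close>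
definition tensor_gens :: "('b, 'm) monoid_scheme \<Rightarrow> ('c, 'n) monoid_scheme \<Rightarrow> nat \<Rightarrow> ('b \<times> 'c list) set" where
  "tensor_gens B A c = {(b, as). b \<in> carrier B \<and> length as = c \<and> set as \<subseteq> carrier A}"

definition tensor_relations ::
  "('b, 'm) monoid_scheme \<Rightarrow> ('c, 'n) monoid_scheme \<Rightarrow> nat \<Rightarrow> ('b \<times> 'c list \<Rightarrow>\<^sub>0 int) set" where
  "tensor_relations B A c =
     {frag_of (b1 \<otimes>\<^bsub>B\<^esub> b2, as) - frag_of (b1, as) - frag_of (b2, as) | b1 b2 as.
        b1 \<in> carrier B \<and> b2 \<in> carrier B \<and> length as = c \<and> set as \<subseteq> carrier A}
   \<union> {frag_of (b, as[i := a1 \<otimes>\<^bsub>A\<^esub> a2]) - frag_of (b, as[i := a1]) - frag_of (b, as[i := a2])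
        | b as i a1 a2. b \<in> carrier B \<and> length as = c \<and> set as \<subseteq> carrier A \<and> i < c
                        \<and> a1 \<in> carrier A \<and> a2 \<in> carrier A}"

definition tensor_power_pair ::
  "('b, 'm) monoid_scheme \<Rightarrow> ('c, 'n) monoid_scheme \<Rightarrow> nat \<Rightarrow> ('b \<times> 'c list \<Rightarrow>\<^sub>0 int) set monoid" where
  "tensor_power_pair B A c =
     (let F = free_Abelian_group (tensor_gens B A c)
      in F Mod generate F (tensor_relations B A c))"

definition tensor_cp1 ::
  "nat \<Rightarrow> ('b, 'm) monoid_scheme \<Rightarrow> ('c, 'n) monoid_scheme \<Rightarrow> ('b set \<times> 'c set list \<Rightarrow>\<^sub>0 int) set monoid" where
  "tensor_cp1 c B A = tensor_power_pair (abelianization B) (abelianization A) c"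

definition group_exponent :: "('a, 'b) monoid_scheme \<Rightarrow> nat" where
  "group_exponent G =
     (if \<exists>n::nat>0. \<forall>x\<in>carrier G. x [^]\<^bsub>G\<^esub> n = \<one>\<^bsub>G\<^esub>
      then LEAST n::nat. n > 0 \<and> (\<forall>x\<in>carrier G. x [^]\<^bsub>G\<^esub> n = \<one>\<^bsub>G\<^esub>)
      else 0)"

definition min_generators :: "('a, 'b) monoid_scheme \<Rightarrow> nat" where
  "min_generators G = (LEAST n. \<exists>S. S \<subseteq> carrier G \<and> finite S \<and> card S = n \<and> generate G S = carrier G)"

end

theory Submission
  imports Defs
begin

text \<open>Let \<open>F\<close> be free on \<open>G\<close> with kernel \<open>R\<close>, let \<open>S k\<close> be the preimage of \<open>gamma G k\<close> in \<open>F\<close> and put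
  \<open>A k = [S k, F, \<dots>, F]\<close> with \<open>c\<close> copies of \<open>F\<close>. Then
  \<open>gamma F (c+1) \<supseteq> A 2 \<supseteq> \<dots> \<supseteq> A (t+1) = [R, F, \<dots>, F]\<close> has abelian factors. The top factor is an image of the
  multiplier of \<open>G/G'\<close>. The map \<open>(s, f\<^sub>1, \<dots>, f\<^sub>c) \<mapsto> [s, f\<^sub>1, \<dots>, f\<^sub>c]\<close> is multilinear modulo \<open>A (k+1)\<close> and, because
  \<open>[gamma F (i+1), R] \<subseteq> [R, F, \<dots>, F]\<close> by the three subgroup lemma, it presents \<open>A k / A (k+1)\<close> as a quotient of
  \<open>gamma G k \<otimes> (G / gamma G k) \<otimes> \<dots> \<otimes> (G / gamma G k)\<close>. Counting along the chain gives (i), since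
  \<open>gamma F (c+1) / A (t+1)\<close> is an extension of \<open>gamma G (c+1)\<close> by the multiplier of \<open>G\<close>; intersecting the chain
  with the subgroup \<open>R \<inter> gamma F (c+1)\<close> gives (ii) and (iii).\<close>

section \<open>Commutator subgroups\<close>

text \<open>Three obstacles shape the proof. The later tensor factors are abelianized, and for
  \<open>k \<ge> 2\<close> the abelianization of \<open>G / gamma G k\<close> is
  \<open>G / G'\<close>. So a bracket \<open>[s, f1, ..., fc]\<close> must not feel a change of any
  \<open>fi\<close> by an element of \<open>S 2 = R * gamma F 2\<close>. Elements of
  \<open>R\<close> are the hard case: the head \<open>[s, f1, ..., fi]\<close> lies in
  \<open>gamma F (i+1)\<close>, its bracket with \<open>R\<close> falls into
  \<open>[R, F, ..., F]\<close>, and this lies in the next term because \<open>R\<close> is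
  contained in every \<open>S k\<close>. Factors from \<open>gamma F 2\<close> vanish because the
  bracket is additive in that slot with commuting values. Secondly, the multipliers of
  \<open>G\<close> and \<open>G/G'\<close> live over free groups on different sets; they are
  compared by lifts in both directions that are inverse only up to congruence. Thirdly, the
  multiplier of \<open>G\<close> is a subgroup of \<open>gamma F (c+1) / A (t+1)\<close>, and
  subgroups may need more generators; hence (iii) descends through the abelian factors, where they
  do not. Infinite orders and unbounded exponents count as 0, which divisibility tolerates, but
  \<open>d\<close> requires proofs of finite generation.\<close>

definition commutator :: "('a, 'b) monoid_scheme \<Rightarrow> 'a \<Rightarrow> 'a \<Rightarrow> 'a" where
  "commutator G x y = inv\<^bsub>G\<^esub> x \<otimes>\<^bsub>G\<^esub> inv\<^bsub>G\<^esub> y \<otimes>\<^bsub>G\<^esub> x \<otimes>\<^bsub>G\<^esub> y"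

lemma comm_subgroup_eq:
  "comm_subgroup G U V = generate G {commutator G x y | x y. x \<in> U \<and> y \<in> V}"
  by (simp add: comm_subgroup_def commutator_def)

lemma (in group_hom) hom_commutator:
  "\<lbrakk>x \<in> carrier G; y \<in> carrier G\<rbrakk> \<Longrightarrow> h (commutator G x y) = commutator H (h x) (h y)"
  by (simp add: commutator_def)

lemma (in group_hom) hom_comm_subgroup:
  assumes "U \<subseteq> carrier G" "V \<subseteq> carrier G"
  shows "h ` comm_subgroup G U V = comm_subgroup H (h ` U) (h ` V)"
proof -
  have "h ` {commutator G x y | x y. x \<in> U \<and> y \<in> V}
      = {commutator H x y | x y. x \<in> h ` U \<and> y \<in> h ` V}"
    using assms by (auto simp: image_def subset_iff) (metis hom_commutator)+
  moreover have "{commutator G x y | x y. x \<in> U \<and> y \<in> V} \<subseteq> carrier G"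
    using assms by (auto simp: commutator_def subset_iff)
  ultimately show ?thesis
    unfolding comm_subgroup_eq by (subst generate_img[symmetric]) auto
qed

text \<open>Makes the lower central series an instance of \<open>iter_comm\<close>, so that
  normality and images under homomorphisms are settled for both at once.\<close>

lemma gamma_Suc: "gamma G (Suc i) = iter_comm G (carrier G) (carrier G) i"
  by (induction i) auto

text \<open>The definition peels off the last commutator with \<open>V\<close>, while a left-normed
  bracket consumes its entries from the first. Moving the first commutator into the starting
  subgroup makes inductions over lists of entries possible.\<close>

lemma iter_comm_Suc_shift:
  "iter_comm G U V (Suc i) = iter_comm G (comm_subgroup G U V) V i"
  by (induction i) auto

context group
begin

section \<open>Elementary commutator calculus\<close>

lemma group_cancel:
  "\<lbrakk>x \<in> carrier G; y \<in> carrier G\<rbrakk> \<Longrightarrow> x \<otimes> (inv x \<otimes> y) = y"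
  "\<lbrakk>x \<in> carrier G; y \<in> carrier G\<rbrakk> \<Longrightarrow> inv x \<otimes> (x \<otimes> y) = y"
  by (simp_all flip: m_assoc)

lemmas group_word_simps = m_assoc inv_mult_group group_cancel

lemma commutator_closed [simp]:
  "\<lbrakk>x \<in> carrier G; y \<in> carrier G\<rbrakk> \<Longrightarrow> commutator G x y \<in> carrier G"
  by (simp add: commutator_def)

lemma inv_commutator:
  "\<lbrakk>x \<in> carrier G; y \<in> carrier G\<rbrakk> \<Longrightarrow> inv (commutator G x y) = commutator G y x"
  by (simp add: commutator_def group_word_simps)

lemma commutator_eq_one_iff:
  assumes "x \<in> carrier G" "y \<in> carrier G"
  shows "commutator G x y = \<one> \<longleftrightarrow> x \<otimes> y = y \<otimes> x"
proof -
  have "commutator G x y = inv (y \<otimes> x) \<otimes> (x \<otimes> y)"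
    using assms by (simp add: commutator_def group_word_simps)
  then show ?thesis
    using assms by (metis inv_closed inv_equality inv_inv l_inv m_closed)
qed

lemma mult_eq_commutator:
  assumes "x \<in> carrier G" "y \<in> carrier G"
  shows "x \<otimes> y = y \<otimes> x \<otimes> commutator G x y"
  using assms by (simp add: commutator_def group_word_simps)

lemma commute_mult:
  "\<lbrakk>a \<in> carrier G; b \<in> carrier G; r \<in> carrier G; a \<otimes> r = r \<otimes> a; b \<otimes> r = r \<otimes> b\<rbrakk>
    \<Longrightarrow> (a \<otimes> b) \<otimes> r = r \<otimes> (a \<otimes> b)"
  by (metis m_assoc)

lemma commute_inv:
  assumes "a \<in> carrier G" "r \<in> carrier G" "a \<otimes> r = r \<otimes> a"
  shows "inv a \<otimes> r = r \<otimes> inv a"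
proof -
  have "inv a \<otimes> r = inv a \<otimes> (r \<otimes> a) \<otimes> inv a"
    using assms(1,2) by (simp add: group_word_simps)
  also have "\<dots> = r \<otimes> inv a"
    using assms(1,2) by (simp add: group_word_simps flip: assms(3))
  finally show ?thesis .
qed

lemma comm_subgroup_subset:
  assumes "subgroup H G" "\<And>x y. x \<in> U \<Longrightarrow> y \<in> V \<Longrightarrow> commutator G x y \<in> H"
  shows "comm_subgroup G U V \<subseteq> H"
  unfolding comm_subgroup_eq using assms by (intro generate_subgroup_incl) auto

lemma commutator_in_comm_subgroup:
  "x \<in> U \<Longrightarrow> y \<in> V \<Longrightarrow> commutator G x y \<in> comm_subgroup G U V"
  unfolding comm_subgroup_eq by (rule generate.incl) blast

lemma subgroup_comm_subgroup:
  assumes "U \<subseteq> carrier G" "V \<subseteq> carrier G"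
  shows "subgroup (comm_subgroup G U V) G"
  unfolding comm_subgroup_eq
  using assms by (intro generate_is_subgroup) (auto simp: subset_iff)

lemma comm_subgroup_mono:
  "U \<subseteq> U' \<Longrightarrow> V \<subseteq> V' \<Longrightarrow> comm_subgroup G U V \<subseteq> comm_subgroup G U' V'"
  unfolding comm_subgroup_eq by (rule mono_generate) blast

lemma comm_subgroup_commute_subset:
  assumes "U \<subseteq> carrier G" "V \<subseteq> carrier G"
  shows "comm_subgroup G U V \<subseteq> comm_subgroup G V U"
proof (rule comm_subgroup_subset)
  show sg: "subgroup (comm_subgroup G V U) G"
    using assms by (simp add: subgroup_comm_subgroup)
  fix x y assume "x \<in> U" "y \<in> V"
  then show "commutator G x y \<in> comm_subgroup G V U"
    using assms subgroup.m_inv_closed[OF sg commutator_in_comm_subgroup]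
    by (metis inv_commutator subsetD)
qed

lemma comm_subgroup_commute:
  "U \<subseteq> carrier G \<Longrightarrow> V \<subseteq> carrier G \<Longrightarrow> comm_subgroup G U V = comm_subgroup G V U"
  by (meson comm_subgroup_commute_subset subset_antisym)

lemma normal_conj_closed:
  "N \<lhd> G \<Longrightarrow> n \<in> N \<Longrightarrow> g \<in> carrier G \<Longrightarrow> g \<otimes> n \<otimes> inv g \<in> N"
  by (simp add: normal.inv_op_closed2)

lemma normal_subset: "N \<lhd> G \<Longrightarrow> N \<subseteq> carrier G"
  by (simp add: normal_imp_subgroup subgroup.subset)

lemma conj_commutator:
  "\<lbrakk>x \<in> carrier G; y \<in> carrier G; g \<in> carrier G\<rbrakk> \<Longrightarrow>
    g \<otimes> commutator G x y \<otimes> inv g = commutator G (g \<otimes> x \<otimes> inv g) (g \<otimes> y \<otimes> inv g)"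
  by (simp add: commutator_def group_word_simps)

lemma normal_comm_subgroup:
  assumes "U \<lhd> G" "V \<lhd> G"
  shows "comm_subgroup G U V \<lhd> G"
  unfolding comm_subgroup_eq
proof (rule normal_generateI)
  show "{commutator G x y | x y. x \<in> U \<and> y \<in> V} \<subseteq> carrier G"
    using assms[THEN normal_subset] by (auto simp: subset_iff)
  fix h g assume "h \<in> {commutator G x y | x y. x \<in> U \<and> y \<in> V}" "g \<in> carrier G"
  then obtain x y where xy: "x \<in> U" "y \<in> V" "h = commutator G x y" by blast
  with assms[THEN normal_subset] \<open>g \<in> carrier G\<close>
  have "g \<otimes> h \<otimes> inv g = commutator G (g \<otimes> x \<otimes> inv g) (g \<otimes> y \<otimes> inv g)"
    by (simp add: conj_commutator subset_iff)
  then show "g \<otimes> h \<otimes> inv g \<in> {commutator G x y | x y. x \<in> U \<and> y \<in> V}"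
    using assms xy \<open>g \<in> carrier G\<close> normal_conj_closed by blast
qed

lemma comm_subgroup_le_left:
  assumes "U \<lhd> G" "V \<subseteq> carrier G"
  shows "comm_subgroup G U V \<subseteq> U"
proof (rule comm_subgroup_subset)
  show U: "subgroup U G" using assms by (simp add: normal_imp_subgroup)
  fix x y assume xy: "x \<in> U" "y \<in> V"
  then have c: "x \<in> carrier G" "y \<in> carrier G"
    using assms normal_subset by blast+
  then have "commutator G x y = inv x \<otimes> (inv y \<otimes> x \<otimes> y)"
    by (simp add: commutator_def m_assoc)
  moreover have "inv y \<otimes> x \<otimes> y \<in> U"
    using assms xy c by (simp add: normal.inv_op_closed1)
  ultimately show "commutator G x y \<in> U"
    using xy U by (simp add: subgroup.m_closed subgroup.m_inv_closed)
qed

lemma normal_iter_comm: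
  "U \<lhd> G \<Longrightarrow> iter_comm G U (carrier G) i \<lhd> G"
  by (induction i) (simp_all add: normal_comm_subgroup normal_self)

lemma normal_gamma: "gamma G i \<lhd> G"
proof (cases i)
  case 0
  then show ?thesis by (simp add: normal_self)
next
  case (Suc j)
  then show ?thesis by (metis gamma_Suc normal_iter_comm normal_self)
qed

lemma iter_comm_mono:
  "U \<subseteq> U' \<Longrightarrow> iter_comm G U V i \<subseteq> iter_comm G U' V i"
  by (induction i) (simp_all add: comm_subgroup_mono)

lemma gamma_Suc_subset: "gamma G (Suc i) \<subseteq> gamma G i"
proof (cases i)
  case (Suc j)
  then show ?thesis by (simp add: comm_subgroup_le_left normal_gamma)
qed auto

lemma gamma_antimono: "i \<le> j \<Longrightarrow> gamma G j \<subseteq> gamma G i"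
  by (rule lift_Suc_antimono_le[of "gamma G"]) (auto simp: gamma_Suc_subset simp del: gamma.simps)

section \<open>Commutation modulo a normal subgroup\<close>

lemma group_hom_rcos: "N \<lhd> G \<Longrightarrow> group_hom G (G Mod N) (\<lambda>x. N #> x)"
  by (simp add: group_hom.intro group_hom_axioms.intro normal.factorgroup_is_group
      normal.r_coset_hom_Mod)

lemma rcos_eq_iff:
  assumes "subgroup N G" "x \<in> carrier G" "y \<in> carrier G"
  shows "N #> x = N #> y \<longleftrightarrow> x \<otimes> inv y \<in> N"
proof
  assume "N #> x = N #> y"
  then have "x \<in> N #> y" using assms rcos_self by blast
  then show "x \<otimes> inv y \<in> N"
    using assms by (simp add: subgroup.rcos_module_imp)
next
  assume "x \<otimes> inv y \<in> N"
  then have "x \<in> N #> y" using assms by (simp add: subgroup.rcos_module_rev)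
  then show "N #> x = N #> y" using assms repr_independence by metis
qed

lemma rcos_eq_self_iff:
  "subgroup N G \<Longrightarrow> x \<in> carrier G \<Longrightarrow> N #> x = N \<longleftrightarrow> x \<in> N"
  by (metis coset_join1 coset_join2 subgroup.subset)

text \<open>Turns membership of a commutator in \<open>N\<close> into commutation in
  \<open>G Mod N\<close>, where closure under products and inverses is a matter of
  rearranging.\<close>

lemma commutator_mem_iff:
  assumes "N \<lhd> G" "x \<in> carrier G" "y \<in> carrier G"
  shows "commutator G x y \<in> N \<longleftrightarrow>
    (N #> x) \<otimes>\<^bsub>G Mod N\<^esub> (N #> y) = (N #> y) \<otimes>\<^bsub>G Mod N\<^esub> (N #> x)"
proof -
  interpret Q: group_hom G "G Mod N" "\<lambda>x. N #> x" using assms by (simp add: group_hom_rcos)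
  have "commutator G x y \<in> N \<longleftrightarrow> N #> commutator G x y = N"
    using assms by (simp add: normal_imp_subgroup rcos_eq_self_iff)
  also have "\<dots> \<longleftrightarrow> commutator (G Mod N) (N #> x) (N #> y) = \<one>\<^bsub>G Mod N\<^esub>"
    using assms Q.hom_commutator by simp
  also have "\<dots> \<longleftrightarrow> (N #> x) \<otimes>\<^bsub>G Mod N\<^esub> (N #> y) = (N #> y) \<otimes>\<^bsub>G Mod N\<^esub> (N #> x)"
    using assms Q.hom_closed by (intro Q.H.commutator_eq_one_iff) auto
  finally show ?thesis .
qed

text \<open>This is the preimage of the centralizer of the image of \<open>R\<close> in
  \<open>G Mod N\<close>. Hence a containment \<open>[X, R] \<subseteq> N\<close> need only be
  checked on generators of \<open>X\<close>.\<close>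

lemma subgroup_centralizer_mod:
  assumes N: "N \<lhd> G" and R: "R \<subseteq> carrier G"
  shows "subgroup {g \<in> carrier G. \<forall>r\<in>R. commutator G g r \<in> N} G"
proof -
  interpret Q: group_hom G "G Mod N" "\<lambda>x. N #> x" using N by (simp add: group_hom_rcos)
  have eq: "{g \<in> carrier G. \<forall>r\<in>R. commutator G g r \<in> N} = {g \<in> carrier G. \<forall>r\<in>R.
    (N #> g) \<otimes>\<^bsub>G Mod N\<^esub> (N #> r) = (N #> r) \<otimes>\<^bsub>G Mod N\<^esub> (N #> g)}"
    using R by (auto simp: commutator_mem_iff[OF N] subset_iff simp del: mult_FactGroup)
  show ?thesis unfolding eq
  proof (rule subgroupI)
    have "\<one> \<in> {g \<in> carrier G. \<forall>r\<in>R. (N #> g) \<otimes>\<^bsub>G Mod N\<^esub> (N #> r) = (N #> r) \<otimes>\<^bsub>G Mod N\<^esub> (N #> g)}"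
      using R by (auto simp: Q.hom_one subset_iff simp del: mult_FactGroup one_FactGroup coset_mult_one)
    then show "{g \<in> carrier G. \<forall>r\<in>R. (N #> g) \<otimes>\<^bsub>G Mod N\<^esub> (N #> r) = (N #> r) \<otimes>\<^bsub>G Mod N\<^esub> (N #> g)} \<noteq> {}"
      by blast
  next
    fix a assume "a \<in> {g \<in> carrier G. \<forall>r\<in>R. (N #> g) \<otimes>\<^bsub>G Mod N\<^esub> (N #> r) = (N #> r) \<otimes>\<^bsub>G Mod N\<^esub> (N #> g)}"
    then have a: "a \<in> carrier G" "\<And>r. r \<in> R \<Longrightarrow> (N #> a) \<otimes>\<^bsub>G Mod N\<^esub> (N #> r) = (N #> r) \<otimes>\<^bsub>G Mod N\<^esub> (N #> a)"
      by blast+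
    have "(N #> inv a) \<otimes>\<^bsub>G Mod N\<^esub> (N #> r) = (N #> r) \<otimes>\<^bsub>G Mod N\<^esub> (N #> inv a)" if "r \<in> R" for r
      using Q.H.commute_inv[OF Q.hom_closed Q.hom_closed a(2)] that a(1) R
      by (simp add: subset_iff del: mult_FactGroup)
    with a show "inv a \<in> {g \<in> carrier G. \<forall>r\<in>R. (N #> g) \<otimes>\<^bsub>G Mod N\<^esub> (N #> r) = (N #> r) \<otimes>\<^bsub>G Mod N\<^esub> (N #> g)}"
      by blast
    fix b assume "b \<in> {g \<in> carrier G. \<forall>r\<in>R. (N #> g) \<otimes>\<^bsub>G Mod N\<^esub> (N #> r) = (N #> r) \<otimes>\<^bsub>G Mod N\<^esub> (N #> g)}"
    then have b: "b \<in> carrier G" "\<And>r. r \<in> R \<Longrightarrow> (N #> b) \<otimes>\<^bsub>G Mod N\<^esub> (N #> r) = (N #> r) \<otimes>\<^bsub>G Mod N\<^esub> (N #> b)"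
      by blast+
    have "(N #> (a \<otimes> b)) \<otimes>\<^bsub>G Mod N\<^esub> (N #> r) = (N #> r) \<otimes>\<^bsub>G Mod N\<^esub> (N #> (a \<otimes> b))" if "r \<in> R" for r
      unfolding Q.hom_mult[OF a(1) b(1)]
      using that R a b by (intro Q.H.commute_mult Q.hom_closed a(2) b(2)) auto
    with a b show "a \<otimes> b \<in> {g \<in> carrier G. \<forall>r\<in>R. (N #> g) \<otimes>\<^bsub>G Mod N\<^esub> (N #> r) = (N #> r) \<otimes>\<^bsub>G Mod N\<^esub> (N #> g)}"
      by blast
  qed blast
qed

text \<open>Moving \<open>r\<close> past \<open>xy\<close> and past \<open>yx\<close> costs the same factor \<open>[r,y][r,x]\<close>, which cancels because it
  commutes with \<open>[x,y]\<close>.\<close>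
lemma commutator_commute:
  assumes c: "x \<in> carrier G" "y \<in> carrier G" "r \<in> carrier G"
    and 1: "commutator G r x \<otimes> y = y \<otimes> commutator G r x"
    and 2: "commutator G r x \<otimes> commutator G r y = commutator G r y \<otimes> commutator G r x"
    and 3: "commutator G r y \<otimes> x = x \<otimes> commutator G r y"
    and 4: "commutator G r x \<otimes> commutator G x y = commutator G x y \<otimes> commutator G r x"
    and 5: "commutator G r y \<otimes> commutator G x y = commutator G x y \<otimes> commutator G r y"
  shows "commutator G x y \<otimes> r = r \<otimes> commutator G x y"
proof -
  let ?u = "commutator G r x" and ?v = "commutator G r y"
  have u: "r \<otimes> x = x \<otimes> (r \<otimes> ?u)" and v: "r \<otimes> y = y \<otimes> (r \<otimes> ?v)"
    using c by (simp_all add: commutator_def group_word_simps)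
  have "r \<otimes> (x \<otimes> y) = x \<otimes> (r \<otimes> (?u \<otimes> y))"
    using c u by (simp add: m_assoc flip: m_assoc[of r x y])
  also have "\<dots> = x \<otimes> ((r \<otimes> y) \<otimes> ?u)" using c 1 by (simp add: m_assoc)
  also have "\<dots> = (x \<otimes> y) \<otimes> (r \<otimes> (?v \<otimes> ?u))" using c v by (simp add: m_assoc)
  finally have xy: "r \<otimes> (x \<otimes> y) = (x \<otimes> y) \<otimes> (r \<otimes> (?v \<otimes> ?u))" .
  have "r \<otimes> (y \<otimes> x) = y \<otimes> (r \<otimes> (?v \<otimes> x))"
    using c v by (simp add: m_assoc flip: m_assoc[of r y x])
  also have "\<dots> = y \<otimes> ((r \<otimes> x) \<otimes> ?v)" using c 3 by (simp add: m_assoc)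
  also have "\<dots> = (y \<otimes> x) \<otimes> (r \<otimes> (?u \<otimes> ?v))" using c u by (simp add: m_assoc)
  finally have yx: "r \<otimes> (y \<otimes> x) = (y \<otimes> x) \<otimes> (r \<otimes> (?v \<otimes> ?u))" using 2 by simp
  let ?k = "?v \<otimes> ?u" and ?C = "commutator G x y"
  have kC: "?k \<otimes> ?C = ?C \<otimes> ?k"
    using c 4 5 by (intro commute_mult) auto
  have "(y \<otimes> x) \<otimes> ((r \<otimes> ?C) \<otimes> ?k) = ((y \<otimes> x) \<otimes> (r \<otimes> ?k)) \<otimes> ?C"
    using c kC by (simp add: m_assoc)
  also have "\<dots> = r \<otimes> (x \<otimes> y)"
    using c by (simp add: m_assoc mult_eq_commutator[of x y] flip: yx)
  also have "\<dots> = (y \<otimes> x) \<otimes> ((?C \<otimes> r) \<otimes> ?k)"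
    using c xy by (simp add: m_assoc mult_eq_commutator[of x y])
  finally show ?thesis using c by simp
qed

text \<open>With \<open>A = gamma G (Suc i)\<close>, the three subgroup argument controls
  \<open>[[A, G], R]\<close> by \<open>[[R, A], G]\<close> and \<open>[[R, G], A]\<close>. The
  induction hypothesis for \<open>R\<close> puts \<open>[R, A]\<close> one commutator above the
  target, and the one for the normal subgroup \<open>[R, G]\<close> puts \<open>[[R, G], A]\<close>
  into the target itself; this is why \<open>R\<close> is generalized.\<close>

lemma comm_subgroup_normal_gamma_subset:
  assumes "R \<lhd> G"
  shows "comm_subgroup G (gamma G (Suc i)) R \<subseteq> iter_comm G R (carrier G) (Suc i)"
  using assms
proof (induction i arbitrary: R)
  case 0
  then show ?case
    by (simp add: comm_subgroup_commute_subset normal_subset)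
next
  case (Suc i)
  let ?N = "iter_comm G R (carrier G) (Suc (Suc i))"
  let ?A = "gamma G (Suc i)"
  let ?RF = "comm_subgroup G R (carrier G)"
  have N: "?N \<lhd> G" and A: "?A \<lhd> G" and RF: "?RF \<lhd> G" and Rc: "R \<subseteq> carrier G"
    using Suc.prems normal_iter_comm normal_gamma
    by (auto simp del: iter_comm.simps intro!: normal_comm_subgroup normal_self normal_subset)
  interpret Q: group_hom G "G Mod ?N" "\<lambda>x. ?N #> x" using N by (simp add: group_hom_rcos)
  have com1: "(?N #> v) \<otimes>\<^bsub>G Mod ?N\<^esub> (?N #> x) = (?N #> x) \<otimes>\<^bsub>G Mod ?N\<^esub> (?N #> v)"
    if "v \<in> ?RF" "x \<in> ?A" for v x
  proof -
    have "commutator G x v \<in> comm_subgroup G ?A ?RF"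
      using that by (rule_tac commutator_in_comm_subgroup)
    then have "commutator G x v \<in> ?N"
      using Suc.IH[OF RF] unfolding iter_comm_Suc_shift by blast
    then show ?thesis
      using that A RF normal_subset commutator_mem_iff[OF N, of x v] by (metis subsetD)
  qed
  \<comment> \<open>\<open>[R, A]\<close> lies in \<open>[R, G, ..., G]\<close> with one
    \<open>G\<close> fewer than in \<open>?N\<close>, so it is central modulo
    \<open>?N\<close>.\<close>
  have com2: "(?N #> u) \<otimes>\<^bsub>G Mod ?N\<^esub> (?N #> y) = (?N #> y) \<otimes>\<^bsub>G Mod ?N\<^esub> (?N #> u)"
    if "u \<in> comm_subgroup G R ?A" "y \<in> carrier G" for u y
  proof -
    have "u \<in> comm_subgroup G ?A R"
      using that comm_subgroup_commute[OF Rc normal_subset[OF A]] by simp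
    then have u: "u \<in> iter_comm G R (carrier G) (Suc i)"
      using Suc.IH[OF Suc.prems] by blast
    then have "commutator G u y \<in> ?N"
      unfolding iter_comm.simps(2)[of G R _ "Suc i"] using that by (rule_tac commutator_in_comm_subgroup)
    moreover have "u \<in> carrier G"
      using u normal_subset[OF normal_iter_comm[OF Suc.prems]] by blast
    ultimately show ?thesis
      using that commutator_mem_iff[OF N, of u y] by blast
  qed
  have "comm_subgroup G ?A (carrier G) \<subseteq> {g \<in> carrier G. \<forall>r\<in>R. commutator G g r \<in> ?N}"
  proof (rule comm_subgroup_subset)
    show "subgroup {g \<in> carrier G. \<forall>r\<in>R. commutator G g r \<in> ?N} G"
      by (rule subgroup_centralizer_mod[OF N Rc])
    fix x y assume xy: "x \<in> ?A" "y \<in> carrier G"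
    then have x: "x \<in> carrier G" using A normal_subset by blast
    have C: "commutator G x y \<in> ?A"
      using comm_subgroup_le_left[OF A subset_refl] commutator_in_comm_subgroup[OF xy] by blast
    have "commutator G (commutator G x y) r \<in> ?N" if r: "r \<in> R" for r
    proof -
      have rc: "r \<in> carrier G" using r Rc by blast
      have u: "commutator G r x \<in> comm_subgroup G R ?A"
        using r xy by (rule_tac commutator_in_comm_subgroup)
      have v: "commutator G r y \<in> ?RF"
        using r xy by (rule_tac commutator_in_comm_subgroup)
      have "(?N #> commutator G x y) \<otimes>\<^bsub>G Mod ?N\<^esub> (?N #> r) = (?N #> r) \<otimes>\<^bsub>G Mod ?N\<^esub> (?N #> commutator G x y)"
        unfolding Q.hom_commutator[OF x xy(2)]
      proof (rule Q.H.commutator_commute)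
        note h = Q.hom_commutator[OF rc x, symmetric] Q.hom_commutator[OF rc xy(2), symmetric]
          Q.hom_commutator[OF x xy(2), symmetric]
        show "commutator (G Mod ?N) (?N #> r) (?N #> x) \<otimes>\<^bsub>G Mod ?N\<^esub> (?N #> y) =
            (?N #> y) \<otimes>\<^bsub>G Mod ?N\<^esub> commutator (G Mod ?N) (?N #> r) (?N #> x)"
          unfolding h by (rule com2[OF u xy(2)])
        show "commutator (G Mod ?N) (?N #> r) (?N #> x) \<otimes>\<^bsub>G Mod ?N\<^esub> commutator (G Mod ?N) (?N #> r) (?N #> y) =
            commutator (G Mod ?N) (?N #> r) (?N #> y) \<otimes>\<^bsub>G Mod ?N\<^esub> commutator (G Mod ?N) (?N #> r) (?N #> x)"
          unfolding h by (rule com2[OF u commutator_closed[OF rc xy(2)]])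
        show "commutator (G Mod ?N) (?N #> r) (?N #> y) \<otimes>\<^bsub>G Mod ?N\<^esub> (?N #> x) =
            (?N #> x) \<otimes>\<^bsub>G Mod ?N\<^esub> commutator (G Mod ?N) (?N #> r) (?N #> y)"
          unfolding h by (rule com1[OF v xy(1)])
        show "commutator (G Mod ?N) (?N #> r) (?N #> x) \<otimes>\<^bsub>G Mod ?N\<^esub> commutator (G Mod ?N) (?N #> x) (?N #> y) =
            commutator (G Mod ?N) (?N #> x) (?N #> y) \<otimes>\<^bsub>G Mod ?N\<^esub> commutator (G Mod ?N) (?N #> r) (?N #> x)"
          unfolding h by (rule com2[OF u commutator_closed[OF x xy(2)]])
        show "commutator (G Mod ?N) (?N #> r) (?N #> y) \<otimes>\<^bsub>G Mod ?N\<^esub> commutator (G Mod ?N) (?N #> x) (?N #> y) =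
            commutator (G Mod ?N) (?N #> x) (?N #> y) \<otimes>\<^bsub>G Mod ?N\<^esub> commutator (G Mod ?N) (?N #> r) (?N #> y)"
          unfolding h by (rule com1[OF v C])
      qed (use x xy rc Q.hom_closed in auto)
      then show ?thesis
        using commutator_mem_iff[OF N commutator_closed[OF x xy(2)] rc] by blast
    qed
    then show "commutator G x y \<in> {g \<in> carrier G. \<forall>r\<in>R. commutator G g r \<in> ?N}"
      using x xy by simp
  qed
  then have "comm_subgroup G (gamma G (Suc (Suc i))) R \<subseteq> ?N"
    using N by (intro comm_subgroup_subset) (auto simp: normal_imp_subgroup)
  then show ?case .
qed

end

section \<open>Iterated brackets modulo a central pair\<close>

text \<open>The left-normed commutator \<open>[u, f1, ..., fn]\<close>.\<close>

primrec iter_bracket :: "('a, 'b) monoid_scheme \<Rightarrow> 'a \<Rightarrow> 'a list \<Rightarrow> 'a" where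
  "iter_bracket G u [] = u"
| "iter_bracket G u (f # fs) = iter_bracket G (commutator G u f) fs"

context group
begin

lemma rcos_mult_cong:
  assumes "N \<lhd> G" "a \<in> carrier G" "b \<in> carrier G" "a' \<in> carrier G" "b' \<in> carrier G"
    "N #> a = N #> a'" "N #> b = N #> b'"
  shows "N #> (a \<otimes> b) = N #> (a' \<otimes> b')"
proof -
  interpret Q: group_hom G "G Mod N" "\<lambda>x. N #> x" using assms by (simp add: group_hom_rcos)
  show ?thesis unfolding Q.hom_mult[OF assms(2,3)] Q.hom_mult[OF assms(4,5)] using assms by simp
qed

lemma rcos_eq_imp_mem:
  assumes "subgroup N G" "subgroup H G" "N \<subseteq> H" "a \<in> carrier G" "b \<in> H" "N #> a = N #> b"
  shows "a \<in> H"
proof -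
  have b: "b \<in> carrier G" using assms subgroup.subset by blast
  have "a \<otimes> inv b \<in> H" using assms b rcos_eq_iff by blast
  then have "a \<otimes> inv b \<otimes> b \<in> H" using assms subgroup.m_closed by metis
  then show ?thesis using assms b by (simp add: m_assoc)
qed

lemma rcos_drop_right:
  assumes "N \<lhd> G" "n \<in> N" "a \<in> carrier G"
  shows "N #> (a \<otimes> n) = N #> a"
proof -
  have n: "n \<in> carrier G" "subgroup N G" using assms normal_subset normal_imp_subgroup by blast+
  have "N #> n = N #> \<one>" using assms n by (simp add: rcos_eq_self_iff normal_subset)
  then show ?thesis using rcos_mult_cong[OF assms(1,3) n(1) assms(3) one_closed] assms by simp
qed

lemma rcos_drop_left:
  assumes "N \<lhd> G" "n \<in> N" "a \<in> carrier G"
  shows "N #> (n \<otimes> a) = N #> a"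
proof -
  have n: "n \<in> carrier G" "subgroup N G" using assms normal_subset normal_imp_subgroup by blast+
  have "N #> n = N #> \<one>" using assms n by (simp add: rcos_eq_self_iff normal_subset)
  then show ?thesis using rcos_mult_cong[OF assms(1) n(1) assms(3) one_closed assms(3)] assms by simp
qed

lemma rcos_swap:
  assumes "N \<lhd> G" "a \<in> carrier G" "b \<in> carrier G" "commutator G a b \<in> N"
  shows "N #> (a \<otimes> b) = N #> (b \<otimes> a)"
  using rcos_drop_right[OF assms(1,4), of "b \<otimes> a"] assms mult_eq_commutator[of a b] by simp

text \<open>Says that \<open>L / N\<close> is central in \<open>G Mod N\<close>. Bracketing both
  subgroups with \<open>G\<close> preserves this, so the property travels down the list of entries
  of a bracket.\<close>

definition central_pair :: "'a set \<Rightarrow> 'a set \<Rightarrow> bool" where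
  "central_pair L N \<longleftrightarrow> L \<lhd> G \<and> N \<lhd> G \<and> N \<subseteq> L \<and> comm_subgroup G L (carrier G) \<subseteq> N"

lemma central_pair_comm_subgroup:
  "central_pair L N \<Longrightarrow> central_pair (comm_subgroup G L (carrier G)) (comm_subgroup G N (carrier G))"
  by (simp add: central_pair_def comm_subgroup_mono normal_comm_subgroup normal_self)

lemma central_pair_iter_comm:
  "central_pair L N \<Longrightarrow> central_pair (iter_comm G L (carrier G) i) (iter_comm G N (carrier G) i)"
  by (induction i) (simp_all add: central_pair_comm_subgroup)

text \<open>\<open>[u u', f] = [u, f] [[u, f], u'] [u', f]\<close>. Centrality puts
  \<open>[u, f]\<close> into \<open>N\<close>, so the middle factor lies in the modulus
  \<open>[N, G]\<close>.\<close>

lemma commutator_mult_left: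
  assumes "central_pair L N" "u \<in> L" "u' \<in> L" "f \<in> carrier G"
  shows "comm_subgroup G N (carrier G) #> commutator G (u \<otimes> u') f =
    comm_subgroup G N (carrier G) #> (commutator G u f \<otimes> commutator G u' f)"
proof -
  let ?N' = "comm_subgroup G N (carrier G)"
  have n: "L \<lhd> G" "N \<lhd> G" "comm_subgroup G L (carrier G) \<subseteq> N"
    using assms unfolding central_pair_def by auto
  have N': "?N' \<lhd> G" using n by (simp add: normal_comm_subgroup normal_self)
  have c: "u \<in> carrier G" "u' \<in> carrier G" using assms n normal_subset by blast+
  let ?d = "commutator G (commutator G u f) u'"
  have "commutator G u f \<in> N"
    using n commutator_in_comm_subgroup[OF assms(2,4)] by blast
  then have d: "?d \<in> ?N'" using c by (intro commutator_in_comm_subgroup)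
  have "commutator G (u \<otimes> u') f = commutator G u f \<otimes> ?d \<otimes> commutator G u' f"
    using c assms(4) by (simp add: commutator_def group_word_simps)
  then show ?thesis
    using rcos_mult_cong[OF N' _ _ _ _ rcos_drop_right[OF N' d] refl] c assms(4) by simp
qed

text \<open>\<open>[u, f f'] = [u, f'] [u, f] [[u, f], f']\<close>. The last factor lies in
  \<open>[N, G]\<close>, and so does the commutator of the first two, which allows them to be
  swapped.\<close>

lemma commutator_mult_right:
  assumes "central_pair L N" "u \<in> L" "f \<in> carrier G" "f' \<in> carrier G"
  shows "comm_subgroup G N (carrier G) #> commutator G u (f \<otimes> f') =
    comm_subgroup G N (carrier G) #> (commutator G u f \<otimes> commutator G u f')"
proof -
  let ?N' = "comm_subgroup G N (carrier G)"
  have n: "L \<lhd> G" "N \<lhd> G" "comm_subgroup G L (carrier G) \<subseteq> N"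
    using assms unfolding central_pair_def by auto
  have N': "?N' \<lhd> G" using n by (simp add: normal_comm_subgroup normal_self)
  have c: "u \<in> carrier G" using assms n normal_subset by blast+
  let ?d = "commutator G (commutator G u f) f'"
  have uN: "commutator G u f \<in> N"
    using n commutator_in_comm_subgroup[OF assms(2,3)] by blast
  then have d: "?d \<in> ?N'" using assms by (intro commutator_in_comm_subgroup)
  have "commutator G (commutator G u f) (commutator G u f') \<in> ?N'"
    using uN c assms by (intro commutator_in_comm_subgroup) auto
  then have "?N' #> (commutator G u f' \<otimes> commutator G u f) = ?N' #> (commutator G u f \<otimes> commutator G u f')"
    using c assms by (intro rcos_swap[OF N', symmetric]) auto
  moreover have "commutator G u (f \<otimes> f') = (commutator G u f' \<otimes> commutator G u f) \<otimes> ?d"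
    using c assms(3,4) by (simp add: commutator_def group_word_simps)
  ultimately show ?thesis
    using rcos_drop_right[OF N' d] c assms(3,4) by simp
qed

lemma iter_bracket_closed:
  "u \<in> carrier G \<Longrightarrow> set fs \<subseteq> carrier G \<Longrightarrow> iter_bracket G u fs \<in> carrier G"
  by (induction fs arbitrary: u) auto

lemma iter_bracket_in_iter_comm:
  "u \<in> L \<Longrightarrow> set fs \<subseteq> V \<Longrightarrow> iter_bracket G u fs \<in> iter_comm G L V (length fs)"
proof (induction fs arbitrary: u L)
  case (Cons f fs)
  then show ?case
    using commutator_in_comm_subgroup[of u L f V] by (simp add: iter_comm_Suc_shift del: iter_comm.simps)
qed simp

lemma central_pairD:
  assumes "central_pair L N"
  shows "L \<lhd> G" "N \<lhd> G" "N \<subseteq> L" "comm_subgroup G L (carrier G) \<subseteq> N" "L \<subseteq> carrier G" "N \<subseteq> carrier G"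
  using assms unfolding central_pair_def by (auto dest: normal_subset)

text \<open>Additivity is proved together with congruence, since the latter feeds the induction step.\<close>
lemma iter_bracket_mult_aux:
  assumes "central_pair L N" "set fs \<subseteq> carrier G"
  shows "(\<forall>u\<in>L. \<forall>u'\<in>L. iter_comm G N (carrier G) (length fs) #> iter_bracket G (u \<otimes> u') fs =
      iter_comm G N (carrier G) (length fs) #> (iter_bracket G u fs \<otimes> iter_bracket G u' fs))
    \<and> (\<forall>u\<in>L. \<forall>u'\<in>L. N #> u = N #> u' \<longrightarrow>
      iter_comm G N (carrier G) (length fs) #> iter_bracket G u fs =
      iter_comm G N (carrier G) (length fs) #> iter_bracket G u' fs)"
  using assms
proof (induction fs arbitrary: L N)
  case Nil
  show ?case by simp
next
  case (Cons f fs)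
  let ?L' = "comm_subgroup G L (carrier G)" and ?N' = "comm_subgroup G N (carrier G)"
  let ?M = "iter_comm G N (carrier G) (length (f # fs))"
  have M: "?M = iter_comm G ?N' (carrier G) (length fs)"
    by (simp add: iter_comm_Suc_shift del: iter_comm.simps)
  note cp = Cons.prems(1) and fs = Cons.prems(2)
  note cp' = central_pair_comm_subgroup[OF cp]
  have f: "f \<in> carrier G" "set fs \<subseteq> carrier G" using fs by auto
  have mult: "\<forall>u\<in>L. \<forall>u'\<in>L. ?M #> iter_bracket G (u \<otimes> u') (f # fs) =
      ?M #> (iter_bracket G u (f # fs) \<otimes> iter_bracket G u' (f # fs))"
  proof (intro ballI)
    fix u u' assume u: "u \<in> L" "u' \<in> L"
    have "u \<otimes> u' \<in> L"
      using u central_pairD[OF cp] by (meson normal_imp_subgroup subgroup.m_closed)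
    then have b: "commutator G (u \<otimes> u') f \<in> ?L'" "commutator G u f \<in> ?L'" "commutator G u' f \<in> ?L'"
      using u f by (auto intro: commutator_in_comm_subgroup)
    then have b': "commutator G u f \<otimes> commutator G u' f \<in> ?L'"
      using central_pairD(1)[OF cp'] by (meson normal_imp_subgroup subgroup.m_closed)
    show "?M #> iter_bracket G (u \<otimes> u') (f # fs) =
        ?M #> (iter_bracket G u (f # fs) \<otimes> iter_bracket G u' (f # fs))"
      unfolding M iter_bracket.simps
      using Cons.IH[OF cp' f(2), THEN conjunct2, rule_format, OF b(1) b' commutator_mult_left[OF cp u f(1)]]
        Cons.IH[OF cp' f(2), THEN conjunct1, rule_format, OF b(2,3)]
      by (rule trans)
  qed
  note D = central_pairD[OF cp]
  have Mn: "?M \<lhd> G" using D by (intro normal_iter_comm)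
  have cong: "?M #> iter_bracket G u (f # fs) = ?M #> iter_bracket G u' (f # fs)"
    if u: "u \<in> L" "u' \<in> L" and eq: "N #> u = N #> u'" for u u'
  proof -
    have uc: "u \<in> carrier G" "u' \<in> carrier G" using u D by blast+
    have n: "u \<otimes> inv u' \<in> N" using eq uc D by (simp add: rcos_eq_iff normal_imp_subgroup)
    \<comment> \<open>Here \<open>u\<close> is an element of \<open>N\<close> times
      \<open>u'\<close>, and a bracket that starts in \<open>N\<close> stays in the modulus.\<close>
    have "u = (u \<otimes> inv u') \<otimes> u'" using uc by (simp add: m_assoc)
    then have "?M #> iter_bracket G u (f # fs) =
        ?M #> (iter_bracket G (u \<otimes> inv u') (f # fs) \<otimes> iter_bracket G u' (f # fs))"
      using mult n u D(3) by (metis subsetD)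
    also have "\<dots> = ?M #> iter_bracket G u' (f # fs)"
      by (rule rcos_drop_left[OF Mn iter_bracket_in_iter_comm[OF n fs] iter_bracket_closed[OF uc(2) fs]])
    finally show ?thesis .
  qed
  show ?case using mult cong by blast
qed

lemmas iter_bracket_mult = iter_bracket_mult_aux[THEN conjunct1, rule_format]
lemmas iter_bracket_cong = iter_bracket_mult_aux[THEN conjunct2, rule_format]

text \<open>At slot \<open>i\<close> the product splits by additivity of a single commutator in its
  second entry. From there on it sits in the first entry, and additivity there carries it through
  the rest of the list.\<close>

lemma iter_bracket_mult_slot:
  assumes "central_pair L N" "u \<in> L" "set fs \<subseteq> carrier G" "i < length fs" "a \<in> carrier G" "b \<in> carrier G"
  shows "iter_comm G N (carrier G) (length fs) #> iter_bracket G u (fs[i := a \<otimes> b]) =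
      iter_comm G N (carrier G) (length fs) #> (iter_bracket G u (fs[i := a]) \<otimes> iter_bracket G u (fs[i := b]))"
  using assms
proof (induction fs arbitrary: L N u i)
  case (Cons f fs)
  let ?L' = "comm_subgroup G L (carrier G)" and ?N' = "comm_subgroup G N (carrier G)"
  have M: "iter_comm G N (carrier G) (length (f # fs)) = iter_comm G ?N' (carrier G) (length fs)"
    by (simp add: iter_comm_Suc_shift del: iter_comm.simps)
  note cp' = central_pair_comm_subgroup[OF Cons.prems(1)]
  have b: "commutator G u x \<in> ?L'" if "x \<in> carrier G" for x
    using Cons.prems that by (intro commutator_in_comm_subgroup)
  show ?case
  proof (cases i)
    case 0
    have "commutator G u a \<otimes> commutator G u b \<in> ?L'"
      using b Cons.prems central_pairD(1)[OF cp'] by (meson normal_imp_subgroup subgroup.m_closed)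
    then show ?thesis
      unfolding M 0 iter_bracket.simps list_update.simps nat.case
      using Cons.prems b
      by (intro trans[OF iter_bracket_cong[OF cp' _ _ _ commutator_mult_right[OF Cons.prems(1,2,5,6)]]
            iter_bracket_mult[OF cp']]) auto
  next
    case (Suc j)
    then show ?thesis
      unfolding M using Cons.IH[OF cp' b] Cons.prems by simp
  qed
qed simp

text \<open>By the last hypothesis, bracketing the head of length \<open>i\<close> with
  \<open>K\<close> drops from the series of \<open>L\<close> into that of \<open>N\<close>, so the
  entries matter only modulo \<open>K\<close>. It is applied with \<open>K\<close> the preimage of
  the derived subgroup.\<close>

lemma iter_bracket_cong_slots:
  assumes "central_pair L N" "u \<in> L" "list_all2 (\<lambda>f g. f \<otimes> inv g \<in> K) fs gs"
    "set fs \<subseteq> carrier G" "set gs \<subseteq> carrier G"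
    "\<And>i. comm_subgroup G (iter_comm G L (carrier G) i) K \<subseteq> iter_comm G N (carrier G) (Suc i)"
  shows "iter_comm G N (carrier G) (length fs) #> iter_bracket G u fs =
    iter_comm G N (carrier G) (length fs) #> iter_bracket G u gs"
  using assms(3,1,2,4-6)
proof (induction fs gs arbitrary: L N u rule: list_all2_induct)
  case (Cons f fs g gs)
  let ?L' = "comm_subgroup G L (carrier G)" and ?N' = "comm_subgroup G N (carrier G)"
  have M: "iter_comm G N (carrier G) (length (f # fs)) = iter_comm G ?N' (carrier G) (length fs)"
    by (simp add: iter_comm_Suc_shift del: iter_comm.simps)
  note cp' = central_pair_comm_subgroup[OF Cons.prems(1)]
  have b: "commutator G u x \<in> ?L'" if "x \<in> carrier G" for x
    using Cons.prems that by (intro commutator_in_comm_subgroup)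
  have c: "u \<in> carrier G" "f \<in> carrier G" "g \<in> carrier G"
    using Cons.prems central_pairD(5)[OF Cons.prems(1)] by auto
  have "commutator G u (f \<otimes> inv g) \<in> comm_subgroup G L K"
    using Cons by (intro commutator_in_comm_subgroup)
  then have k: "commutator G u (f \<otimes> inv g) \<in> ?N'"
    using Cons.prems(5)[of 0] by auto
  have "f = (f \<otimes> inv g) \<otimes> g" using c by (simp add: m_assoc)
  then have "?N' #> commutator G u f = ?N' #> (commutator G u (f \<otimes> inv g) \<otimes> commutator G u g)"
    using commutator_mult_right[OF Cons.prems(1,2), of "f \<otimes> inv g" g] c by simp
  also have "\<dots> = ?N' #> commutator G u g"
    using c by (intro rcos_drop_left[OF central_pairD(2)[OF cp'] k]) auto
  finally have "iter_comm G ?N' (carrier G) (length fs) #> iter_bracket G (commutator G u f) fs =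
      iter_comm G ?N' (carrier G) (length fs) #> iter_bracket G (commutator G u g) fs"
    using Cons.prems c b by (intro iter_bracket_cong[OF cp']) auto
  \<comment> \<open>The hypothesis on \<open>K\<close> at index \<open>i + 1\<close> for the pair
    \<open>L\<close>, \<open>N\<close> is the one at index \<open>i\<close> for
    \<open>[L, G]\<close>, \<open>[N, G]\<close>.\<close>
  also have "\<dots> = iter_comm G ?N' (carrier G) (length fs) #> iter_bracket G (commutator G u g) gs"
    using Cons.prems c b Cons.prems(5)[of "Suc _"] 
    by (intro Cons.IH[OF cp']) (auto simp: iter_comm_Suc_shift simp del: iter_comm.simps)
  finally show ?case unfolding M by simp
qed simp

text \<open>The commutator is additive in both entries modulo \<open>[N, G]\<close>, which is
  contained in the generated subgroup \<open>H\<close>. So the \<open>l\<close> with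
  \<open>[l, x] \<in> H\<close>, and then the \<open>f\<close> with \<open>[l, f] \<in> H\<close>,
  form subgroups, and these are everything once they contain generators.\<close>

lemma generate_eq_comm_subgroup:
  assumes cp: "central_pair L N" and Y: "Y \<subseteq> carrier G" "generate G (Y \<union> N) = L"
    and S: "S \<subseteq> carrier G" "generate G S = carrier G"
  shows "generate G ({commutator G y x | y x. y \<in> Y \<and> x \<in> S} \<union> comm_subgroup G N (carrier G))
    = comm_subgroup G L (carrier G)"
proof -
  let ?L' = "comm_subgroup G L (carrier G)" and ?N' = "comm_subgroup G N (carrier G)"
  let ?Z = "{commutator G y x | y x. y \<in> Y \<and> x \<in> S} \<union> ?N'"
  note D = central_pairD[OF cp] and D' = central_pairD[OF central_pair_comm_subgroup[OF cp]]
  have YL: "Y \<subseteq> L" using Y generate.incl[of _ "Y \<union> N" G] by blast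
  have Z: "?Z \<subseteq> ?L'" using D' YL S commutator_in_comm_subgroup by blast
  define H where "H = generate G ?Z"
  have H: "subgroup H G"
    unfolding H_def using Z D' by (intro generate_is_subgroup) blast
  have ZH: "?Z \<subseteq> H" unfolding H_def by (auto intro: generate.incl)
  then have N'Z: "?N' \<subseteq> H" by blast
  note mem = rcos_eq_imp_mem[OF normal_imp_subgroup[OF D'(2)] H N'Z]
  have Ls: "subgroup L G" using D by (simp add: normal_imp_subgroup)
  have cancel: "b \<in> H" if "a \<in> H" "a \<otimes> b \<in> H" "b \<in> carrier G" for a b
  proof -
    have "a \<in> carrier G" using that subgroup.subset[OF H] by blast
    then have "b = inv a \<otimes> (a \<otimes> b)" using that by (simp add: group_cancel)
    then show ?thesis
      using subgroup.m_closed[OF H subgroup.m_inv_closed[OF H that(1)] that(2)] by simp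
  qed
  have one: "commutator G \<one> x \<in> H" "commutator G x \<one> \<in> H" if "x \<in> carrier G" for x
    using that H by (simp_all add: commutator_def subgroup.one_closed)
  have sub1: "subgroup {l \<in> L. commutator G l x \<in> H} G" if x: "x \<in> carrier G" for x
  proof (rule subgroupI)
    show "{l \<in> L. commutator G l x \<in> H} \<subseteq> carrier G" using D by blast
    have "\<one> \<in> {l \<in> L. commutator G l x \<in> H}"
      using one x Ls by (simp add: subgroup.one_closed)
    then show "{l \<in> L. commutator G l x \<in> H} \<noteq> {}" by blast
    fix a assume a: "a \<in> {l \<in> L. commutator G l x \<in> H}"
    have c: "a \<in> carrier G" "inv a \<in> L" using a D Ls by (auto simp: subgroup.m_inv_closed)
    have eq: "?N' #> commutator G \<one> x = ?N' #> (commutator G a x \<otimes> commutator G (inv a) x)"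
      using commutator_mult_left[OF cp, of a "inv a" x] a c x by simp
    have "commutator G a x \<otimes> commutator G (inv a) x \<in> H"
      using c x by (intro mem[OF _ one(1)[OF x] eq[symmetric]]) simp
    then show "inv a \<in> {l \<in> L. commutator G l x \<in> H}"
      using a c x cancel[of "commutator G a x" "commutator G (inv a) x"] by simp
    fix b assume b: "b \<in> {l \<in> L. commutator G l x \<in> H}"
    have c': "b \<in> carrier G" "a \<otimes> b \<in> L" using a b D Ls by (auto simp: subgroup.m_closed)
    have "commutator G (a \<otimes> b) x \<in> H"
      using a b c c' x by (intro mem[OF _ subgroup.m_closed[OF H] commutator_mult_left[OF cp]]) auto
    then show "a \<otimes> b \<in> {l \<in> L. commutator G l x \<in> H}" using c' by simp
  qed
  have "L \<subseteq> {l \<in> L. commutator G l x \<in> H}" if x: "x \<in> S" for x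
  proof -
    have xc: "x \<in> carrier G" using x S by blast
    have "Y \<union> N \<subseteq> {l \<in> L. commutator G l x \<in> H}"
    proof
      fix y assume y: "y \<in> Y \<union> N"
      have "commutator G y x \<in> ?Z" using y x xc commutator_in_comm_subgroup[of y N x "carrier G"] by blast
      then show "y \<in> {l \<in> L. commutator G l x \<in> H}"
        using y YL D ZH by blast
    qed
    then show ?thesis using generate_subgroup_incl[OF _ sub1[OF xc]] Y by blast
  qed
  then have step1: "commutator G l x \<in> H" if "l \<in> L" "x \<in> S" for l x
    using that by blast
  have sub2: "subgroup {f \<in> carrier G. commutator G l f \<in> H} G" if l: "l \<in> L" for l
  proof (rule subgroupI)
    have lc: "l \<in> carrier G" using l D by blast
    show "{f \<in> carrier G. commutator G l f \<in> H} \<subseteq> carrier G" by blast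
    have "\<one> \<in> {f \<in> carrier G. commutator G l f \<in> H}" using one lc by simp
    then show "{f \<in> carrier G. commutator G l f \<in> H} \<noteq> {}" by blast
    fix a assume a: "a \<in> {f \<in> carrier G. commutator G l f \<in> H}"
    have eq: "?N' #> commutator G l \<one> = ?N' #> (commutator G l a \<otimes> commutator G l (inv a))"
      using commutator_mult_right[OF cp l, of a "inv a"] a by simp
    have "commutator G l a \<otimes> commutator G l (inv a) \<in> H"
      using lc a by (intro mem[OF _ one(2)[OF lc] eq[symmetric]]) simp
    then show "inv a \<in> {f \<in> carrier G. commutator G l f \<in> H}"
      using a lc cancel[of "commutator G l a" "commutator G l (inv a)"] by simp
    fix b assume b: "b \<in> {f \<in> carrier G. commutator G l f \<in> H}"
    have "commutator G l (a \<otimes> b) \<in> H"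
      using a b lc l by (intro mem[OF _ subgroup.m_closed[OF H] commutator_mult_right[OF cp]]) auto
    then show "a \<otimes> b \<in> {f \<in> carrier G. commutator G l f \<in> H}" using a b by simp
  qed
  have "carrier G \<subseteq> {f \<in> carrier G. commutator G l f \<in> H}" if "l \<in> L" for l
    using generate_subgroup_incl[OF _ sub2[OF that]] step1[OF that] S by blast
  then have "?L' \<subseteq> H"
    using H by (intro comm_subgroup_subset) auto
  moreover have "H \<subseteq> ?L'"
    unfolding H_def using Z D' by (intro generate_subgroup_incl) (auto simp: normal_imp_subgroup)
  ultimately show ?thesis unfolding H_def by blast
qed

text \<open>Serves twice: with \<open>Y = L\<close> it makes the map out of the tensor power onto,
  and with finite \<open>Y\<close> and \<open>S\<close> it shows that a quotient of the lower
  central series is finitely generated.\<close>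

lemma generate_eq_iter_comm:
  assumes "central_pair L N" "Y \<subseteq> carrier G" "generate G (Y \<union> N) = L"
    "S \<subseteq> carrier G" "generate G S = carrier G"
  shows "generate G ({iter_bracket G y fs | y fs. y \<in> Y \<and> set fs \<subseteq> S \<and> length fs = c}
      \<union> iter_comm G N (carrier G) c) = iter_comm G L (carrier G) c"
  using assms
proof (induction c arbitrary: L N Y)
  case 0
  have "{iter_bracket G y fs | y fs. y \<in> Y \<and> set fs \<subseteq> S \<and> length fs = 0} = Y" by force
  then show ?case using 0 by simp
next
  case (Suc c)
  let ?Y' = "{commutator G y x | y x. y \<in> Y \<and> x \<in> S}"
  have eq: "{iter_bracket G y fs | y fs. y \<in> Y \<and> set fs \<subseteq> S \<and> length fs = Suc c} =
      {iter_bracket G y fs | y fs. y \<in> ?Y' \<and> set fs \<subseteq> S \<and> length fs = c}" (is "?A = ?B")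
  proof
    show "?A \<subseteq> ?B"
    proof
      fix z assume "z \<in> ?A"
      then obtain y fs where "z = iter_bracket G y fs" "y \<in> Y" "set fs \<subseteq> S" "length fs = Suc c" by blast
      moreover from this obtain f fs' where "fs = f # fs'" by (cases fs) auto
      ultimately show "z \<in> ?B" by auto
    qed
    show "?B \<subseteq> ?A"
    proof
      fix z assume "z \<in> ?B"
      then obtain y x fs where "z = iter_bracket G y (x # fs)" "y \<in> Y" "x \<in> S" "set fs \<subseteq> S" "length fs = c"
        by auto
      then have "z = iter_bracket G y (x # fs)" "y \<in> Y" "set (x # fs) \<subseteq> S" "length (x # fs) = Suc c" by auto
      then show "z \<in> ?A" by blast
    qed
  qed
  show ?case unfolding eq iter_comm_Suc_shift
  proof (rule Suc.IH)
    show "?Y' \<subseteq> carrier G" using Suc.prems by (auto simp: subset_iff)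
  qed (use Suc.prems generate_eq_comm_subgroup central_pair_comm_subgroup in auto)
qed

end

section \<open>Subquotients and tensor powers\<close>

text \<open>The section \<open>U / V\<close>, in the shape in which
  \<open>c_nilpotent_multiplier\<close> is defined, so that the multiplier is literally one of
  these.\<close>

abbreviation subquotient :: "('a, 'b) monoid_scheme \<Rightarrow> 'a set \<Rightarrow> 'a set \<Rightarrow> 'a set monoid" where
  "subquotient G U V \<equiv> subgroup_generated G U Mod V"

context group
begin

lemma generate_subgroup_self: "subgroup H G \<Longrightarrow> generate G H = H"
  by (rule generateI[symmetric]) auto

lemma normal_subgroup_generated:
  assumes "subgroup U G" "V \<lhd> G" "V \<subseteq> U"
  shows "V \<lhd> subgroup_generated G U"
proof -
  have "subgroup_generated G U = G\<lparr>carrier := U\<rparr>"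
    using subgroup.carrier_subgroup_generated_subgroup[OF assms(1)] unfolding subgroup_generated_def by simp
  then show ?thesis using assms by (simp add: normal_restrict_supergroup)
qed

lemma rcos_subgroup_generated [simp]: "r_coset (subgroup_generated G U) V x = V #> x"
  by (simp add: r_coset_def)

lemma group_subquotient:
  "\<lbrakk>subgroup U G; V \<lhd> G; V \<subseteq> U\<rbrakk> \<Longrightarrow> group (subquotient G U V)"
  by (simp add: normal.factorgroup_is_group normal_subgroup_generated)

lemma carrier_subquotient:
  "subgroup U G \<Longrightarrow> carrier (subquotient G U V) = (\<lambda>x. V #> x) ` U"
  by (simp add: carrier_FactGroup subgroup.carrier_subgroup_generated_subgroup)

lemma mult_subquotient:
  assumes "V \<lhd> G" "x \<in> carrier G" "y \<in> carrier G"
  shows "(V #> x) \<otimes>\<^bsub>subquotient G U V\<^esub> (V #> y) = V #> (x \<otimes> y)"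
proof -
  have "(V #> x) \<otimes>\<^bsub>subquotient G U V\<^esub> (V #> y) = (V #> x) <#> (V #> y)"
    by (simp add: set_mult_def)
  then show ?thesis using assms by (simp add: normal.rcos_sum)
qed

lemma hom_subquotient:
  assumes "subgroup U G" "V \<lhd> G"
  shows "(\<lambda>x. V #> x) \<in> hom (subgroup_generated G U) (subquotient G U V)"
  using assms subgroup.mem_carrier[OF assms(1)]
  by (intro homI) (auto simp: carrier_subquotient subgroup.carrier_subgroup_generated_subgroup
      mult_subquotient simp del: mult_FactGroup)

lemma comm_group_subquotient:
  assumes "subgroup U G" "V \<lhd> G" "V \<subseteq> U"
    and comm: "\<And>x y. x \<in> U \<Longrightarrow> y \<in> U \<Longrightarrow> commutator G x y \<in> V"
  shows "comm_group (subquotient G U V)"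
proof (rule group.group_comm_groupI[OF group_subquotient[OF assms(1-3)]])
  fix C D assume "C \<in> carrier (subquotient G U V)" "D \<in> carrier (subquotient G U V)"
  then obtain x y where xy: "x \<in> U" "y \<in> U" "C = V #> x" "D = V #> y"
    using assms by (auto simp: carrier_subquotient)
  then have "x \<in> carrier G" "y \<in> carrier G" using assms subgroup.mem_carrier by metis+
  then show "C \<otimes>\<^bsub>subquotient G U V\<^esub> D = D \<otimes>\<^bsub>subquotient G U V\<^esub> C"
    unfolding xy(3,4) using mult_subquotient assms(2) rcos_swap[OF assms(2) _ _ comm[OF xy(1,2)]] by presburger
qed

end

section \<open>Tensor powers and their maps onto sections\<close>

lemma group_tensor_power_pair:
  assumes "group B" "group A"
  shows "comm_group (tensor_power_pair B A c)"
    and "tensor_relations B A c \<subseteq> carrier (free_Abelian_group (tensor_gens B A c))"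
proof -
  interpret B: group B by fact
  interpret A: group A by fact
  let ?F = "free_Abelian_group (tensor_gens B A c)"
  interpret F: comm_group ?F by (rule abelian_free_Abelian_group)
  have diff: "x - y - z \<in> carrier ?F" if "x \<in> carrier ?F" "y \<in> carrier ?F" "z \<in> carrier ?F" for x y z
    using that keys_diff[of x y] keys_diff[of "x - y" z] unfolding carrier_free_Abelian_group_iff by blast
  have upd: "(b, as[i := a]) \<in> tensor_gens B A c"
    if "b \<in> carrier B" "length as = c" "set as \<subseteq> carrier A" "a \<in> carrier A" for b as i a
    using that set_update_subset_insert[of as i a] by (auto simp: tensor_gens_def)
  show rel: "tensor_relations B A c \<subseteq> carrier ?F"
  proof
    fix r assume "r \<in> tensor_relations B A c"
    then consider b1 b2 as where "r = frag_of (b1 \<otimes>\<^bsub>B\<^esub> b2, as) - frag_of (b1, as) - frag_of (b2, as)"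
        "b1 \<in> carrier B" "b2 \<in> carrier B" "length as = c" "set as \<subseteq> carrier A"
      | b as i a1 a2 where
        "r = frag_of (b, as[i := a1 \<otimes>\<^bsub>A\<^esub> a2]) - frag_of (b, as[i := a1]) - frag_of (b, as[i := a2])"
        "b \<in> carrier B" "length as = c" "set as \<subseteq> carrier A" "a1 \<in> carrier A" "a2 \<in> carrier A"
      unfolding tensor_relations_def by blast
    then show "r \<in> carrier ?F"
    proof cases
      case 1
      then show ?thesis
        by (simp only: frag_of_in_free_Abelian_group, intro diff)
          (simp_all only: frag_of_in_free_Abelian_group, simp_all add: tensor_gens_def)
    next
      case 2
      then show ?thesis
        by (simp only:, intro diff) (simp_all only: frag_of_in_free_Abelian_group upd A.m_closed)
    qed
  qed
  show "comm_group (tensor_power_pair B A c)"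
    unfolding tensor_power_pair_def Let_def
    by (intro F.abelian_FactGroup F.generate_is_subgroup rel)
qed

text \<open>Finite factors admit only finitely many tuples, and their classes generate. This makes
  \<open>min_generators\<close> of the tensor powers a genuine minimum.\<close>

lemma finitely_generated_tensor_power_pair:
  assumes B: "group B" "finite (carrier B)" and A: "group A" "finite (carrier A)"
  shows "\<exists>S \<subseteq> carrier (tensor_power_pair B A c). finite S \<and>
    generate (tensor_power_pair B A c) S = carrier (tensor_power_pair B A c)"
proof -
  let ?T = "tensor_gens B A c"
  let ?F = "free_Abelian_group ?T"
  let ?R = "generate ?F (tensor_relations B A c)"
  interpret F: comm_group ?F by (rule abelian_free_Abelian_group)
  have R: "?R \<lhd> ?F"
    using F.generate_is_subgroup group_tensor_power_pair(2)[OF B(1) A(1)] F.normal_iff_subgroup by blast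
  then interpret Q: group_hom ?F "?F Mod ?R" "\<lambda>x. ?R #>\<^bsub>?F\<^esub> x" by (rule F.group_hom_rcos)
  have "finite ?T"
  proof (rule finite_subset)
    show "?T \<subseteq> carrier B \<times> {as. set as \<subseteq> carrier A \<and> length as = c}" by (auto simp: tensor_gens_def)
    show "finite (carrier B \<times> {as. set as \<subseteq> carrier A \<and> length as = c})"
      using assms finite_lists_length_eq by blast
  qed
  have sub: "frag_of ` ?T \<subseteq> carrier ?F" by auto
  have gen: "generate ?F (frag_of ` ?T) = carrier ?F"
  proof
    from sub show "generate ?F (frag_of ` ?T) \<subseteq> carrier ?F" by (rule F.generate_incl)
    show "carrier ?F \<subseteq> generate ?F (frag_of ` ?T)"
    proof
      fix x assume "x \<in> carrier ?F"
      then have "Poly_Mapping.keys x \<subseteq> ?T" by simp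
      then show "x \<in> generate ?F (frag_of ` ?T)"
      proof (induction rule: free_Abelian_group_induct[consumes 1, case_names zero diff gen])
        case zero
        show ?case using generate.one[of ?F] by simp
      next
        case (diff x y)
        then have "inv\<^bsub>?F\<^esub> y \<in> generate ?F (frag_of ` ?T)"
          using F.generate_m_inv_closed[OF sub] by blast
        then have "x \<otimes>\<^bsub>?F\<^esub> inv\<^bsub>?F\<^esub> y \<in> generate ?F (frag_of ` ?T)"
          using diff generate.eng by metis
        then show ?case using diff by simp
      next
        case (gen a)
        then show ?case by (simp add: generate.incl)
      qed
    qed
  qed
  let ?S = "(\<lambda>x. ?R #>\<^bsub>?F\<^esub> x) ` frag_of ` ?T"
  have "generate (?F Mod ?R) ?S = carrier (?F Mod ?R)"
    using Q.generate_img[OF sub] unfolding gen carrier_FactGroup .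
  moreover have "?S \<subseteq> carrier (?F Mod ?R)"
    unfolding carrier_FactGroup by (intro image_mono) auto
  moreover have "finite ?S" using \<open>finite ?T\<close> by simp
  ultimately show ?thesis
    unfolding tensor_power_pair_def Let_def by blast
qed

context group
begin

text \<open>Both \<open>\<alpha>\<close> and \<open>\<beta>\<close> are onto; points with equal
  value agree modulo \<open>N\<close>, respectively differ by an element of \<open>K\<close>. So
  \<open>L / N\<close> is an image of \<open>B\<close>, and the later entries of a bracket matter
  only through \<open>A\<close>. The bracket of arbitrary preimages is therefore well defined modulo
  the lower term and multilinear, and such brackets generate the upper term.\<close>

lemma tensor_power_pair_epi:
  fixes B :: "('c, 'm) monoid_scheme" and A :: "('d, 'n) monoid_scheme"
  assumes cp: "central_pair L N"
    and B: "group B" and A: "group A"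
    and \<alpha>: "\<alpha> ` L = carrier B" "\<And>u u'. u \<in> L \<Longrightarrow> u' \<in> L \<Longrightarrow> \<alpha> (u \<otimes> u') = \<alpha> u \<otimes>\<^bsub>B\<^esub> \<alpha> u'"
      "\<And>u u'. u \<in> L \<Longrightarrow> u' \<in> L \<Longrightarrow> \<alpha> u = \<alpha> u' \<Longrightarrow> N #> u = N #> u'"
    and \<beta>: "\<beta> ` carrier G = carrier A"
      "\<And>f g. f \<in> carrier G \<Longrightarrow> g \<in> carrier G \<Longrightarrow> \<beta> (f \<otimes> g) = \<beta> f \<otimes>\<^bsub>A\<^esub> \<beta> g"
      "\<And>f g. f \<in> carrier G \<Longrightarrow> g \<in> carrier G \<Longrightarrow> \<beta> f = \<beta> g \<Longrightarrow> f \<otimes> inv g \<in> K"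
    and K: "\<And>i. comm_subgroup G (iter_comm G L (carrier G) i) K \<subseteq> iter_comm G N (carrier G) (Suc i)"
  shows "\<exists>h. h \<in> epi (tensor_power_pair B A c)
    (subquotient G (iter_comm G L (carrier G) c) (iter_comm G N (carrier G) c))"
proof -
  interpret B: group B by fact
  interpret A: group A by fact
  let ?L = "iter_comm G L (carrier G) c" and ?N = "iter_comm G N (carrier G) c"
  let ?Q = "subquotient G ?L ?N"
  note D = central_pairD[OF cp] and D' = central_pairD[OF central_pair_iter_comm[OF cp, of c]]
  have Ls: "subgroup L G" "subgroup ?L G" using D D' by (simp_all add: normal_imp_subgroup)
  have comm: "commutator G x y \<in> ?N" if "x \<in> ?L" "y \<in> ?L" for x y
    using that D' commutator_in_comm_subgroup[of x ?L y "carrier G"] by blast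
  interpret Q: comm_group ?Q
    by (rule comm_group_subquotient[OF Ls(2) D'(2,3) comm])
  let ?T = "tensor_gens B A c"
  let ?F = "free_Abelian_group ?T"
  let ?R = "generate ?F (tensor_relations B A c)"
  interpret F: comm_group ?F by (rule abelian_free_Abelian_group)
  \<comment> \<open>Mere choices of preimages, not homomorphisms; that \<open>f\<close> below is
    additive comes from the congruence lemmas for brackets.\<close>
  define s where "s = inv_into L \<alpha>"
  define r where "r = inv_into (carrier G) \<beta>"
  have s: "s b \<in> L" "\<alpha> (s b) = b" if "b \<in> carrier B" for b
    using that \<alpha>(1) unfolding s_def by (auto intro: inv_into_into f_inv_into_f)
  have r: "r a \<in> carrier G" "\<beta> (r a) = a" if "a \<in> carrier A" for a
    using that \<beta>(1) unfolding r_def by (auto intro: inv_into_into f_inv_into_f)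
  have rs: "set (map r as) \<subseteq> carrier G" if "set as \<subseteq> carrier A" for as
    using that r by auto
  define f where "f = (\<lambda>(b, as). ?N #> iter_bracket G (s b) (map r as))"
  have br: "iter_bracket G u fs \<in> ?L" if "u \<in> L" "set fs \<subseteq> carrier G" "length fs = c" for u fs
    using iter_bracket_in_iter_comm[OF that(1,2)] that(3) by simp
  have brc: "iter_bracket G u fs \<in> carrier G" if "u \<in> L" "set fs \<subseteq> carrier G" for u fs
    using that D by (intro iter_bracket_closed) auto
  have "f ` ?T \<subseteq> carrier ?Q"
    using br s rs by (auto simp: f_def tensor_gens_def carrier_subquotient[OF Ls(2)])
  then obtain h where h: "h \<in> hom ?F ?Q" "\<And>x. x \<in> ?T \<Longrightarrow> h (frag_of x) = f x"
    using Q.free_Abelian_group_universal by blast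
  interpret h: group_hom ?F ?Q h
    using h by (simp add: group_hom_def group_hom_axioms_def Q.is_group)
  have ker: "x - y - z \<in> kernel ?F ?Q h"
    if "x \<in> carrier ?F" "y \<in> carrier ?F" "z \<in> carrier ?F" "h x = h y \<otimes>\<^bsub>?Q\<^esub> h z" for x y z
  proof -
    have e: "x - y - z = x \<otimes>\<^bsub>?F\<^esub> inv\<^bsub>?F\<^esub> (y \<otimes>\<^bsub>?F\<^esub> z)"
      using that F.m_closed[of y z] by (simp add: algebra_simps)
    have yz: "y \<otimes>\<^bsub>?F\<^esub> z \<in> carrier ?F" using that by (intro F.m_closed)
    have hx: "h x = h (y \<otimes>\<^bsub>?F\<^esub> z)" using that h.hom_mult by metis
    have "h (x \<otimes>\<^bsub>?F\<^esub> inv\<^bsub>?F\<^esub> (y \<otimes>\<^bsub>?F\<^esub> z)) = h x \<otimes>\<^bsub>?Q\<^esub> inv\<^bsub>?Q\<^esub> h (y \<otimes>\<^bsub>?F\<^esub> z)"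
      using h.hom_mult[OF that(1) F.inv_closed[OF yz]] h.hom_inv[OF yz] by metis
    also have "\<dots> = \<one>\<^bsub>?Q\<^esub>"
      unfolding hx by (rule Q.r_inv[OF h.hom_closed[OF yz]])
    finally have "h (x \<otimes>\<^bsub>?F\<^esub> inv\<^bsub>?F\<^esub> (y \<otimes>\<^bsub>?F\<^esub> z)) = \<one>\<^bsub>?Q\<^esub>" .
    then show ?thesis unfolding e kernel_def using F.m_closed[OF that(1) F.inv_closed[OF yz]] by blast
  qed
  have "tensor_relations B A c \<subseteq> kernel ?F ?Q h"
  proof
    fix x assume "x \<in> tensor_relations B A c"
    then consider b1 b2 as where "x = frag_of (b1 \<otimes>\<^bsub>B\<^esub> b2, as) - frag_of (b1, as) - frag_of (b2, as)"
        "b1 \<in> carrier B" "b2 \<in> carrier B" "length as = c" "set as \<subseteq> carrier A"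
      | b as i a1 a2 where
        "x = frag_of (b, as[i := a1 \<otimes>\<^bsub>A\<^esub> a2]) - frag_of (b, as[i := a1]) - frag_of (b, as[i := a2])"
        "b \<in> carrier B" "length as = c" "set as \<subseteq> carrier A" "i < c" "a1 \<in> carrier A" "a2 \<in> carrier A"
      unfolding tensor_relations_def by blast
    then show "x \<in> kernel ?F ?Q h"
    proof cases
      case 1
      let ?fs = "map r as"
      have t: "(b1 \<otimes>\<^bsub>B\<^esub> b2, as) \<in> ?T" "(b1, as) \<in> ?T" "(b2, as) \<in> ?T"
        using 1 by (auto simp: tensor_gens_def)
      have l: "length ?fs = c" using 1 by simp
      have s12: "s b1 \<otimes> s b2 \<in> L" using s 1 Ls(1) by (simp add: subgroup.m_closed)
      note b12 = B.m_closed[OF 1(2,3)]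
      have "\<alpha> (s (b1 \<otimes>\<^bsub>B\<^esub> b2)) = \<alpha> (s b1 \<otimes> s b2)"
        unfolding s(2)[OF b12] using s 1 \<alpha>(2) by simp
      then have eq: "N #> s (b1 \<otimes>\<^bsub>B\<^esub> b2) = N #> (s b1 \<otimes> s b2)"
        by (rule \<alpha>(3)[OF s(1)[OF b12] s12])
      have "?N #> iter_bracket G (s (b1 \<otimes>\<^bsub>B\<^esub> b2)) ?fs = ?N #> iter_bracket G (s b1 \<otimes> s b2) ?fs"
        by (rule iter_bracket_cong[OF cp rs[OF 1(5)] s(1)[OF b12] s12 eq, unfolded l])
      also have "\<dots> = ?N #> (iter_bracket G (s b1) ?fs \<otimes> iter_bracket G (s b2) ?fs)"
        by (rule iter_bracket_mult[OF cp rs[OF 1(5)] s(1)[OF 1(2)] s(1)[OF 1(3)], unfolded l])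
      also have "\<dots> = (?N #> iter_bracket G (s b1) ?fs) \<otimes>\<^bsub>?Q\<^esub> (?N #> iter_bracket G (s b2) ?fs)"
        using s 1 rs by (intro mult_subquotient[OF D'(2), symmetric] brc) auto
      finally have "f (b1 \<otimes>\<^bsub>B\<^esub> b2, as) = f (b1, as) \<otimes>\<^bsub>?Q\<^esub> f (b2, as)"
        unfolding f_def prod.case .
      then show ?thesis unfolding 1(1) using t h(2) by (intro ker) (simp_all del: mult_FactGroup)
    next
      case 2
      let ?fs = "map r as"
      have t: "(b, as[i := a]) \<in> ?T" if "a \<in> carrier A" for a
        using that 2 set_update_subset_insert[of as i a] by (auto simp: tensor_gens_def)
      have l: "length ?fs = c" using 2 by simp
      have upd: "set (?fs[i := g]) \<subseteq> carrier G" if "g \<in> carrier G" for g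
        using that rs[OF 2(4)] set_update_subset_insert[of ?fs i g] by blast
      \<comment> \<open>The chosen preimage of a product differs from the product of the chosen
        preimages by an element of \<open>K\<close>; all other slots agree.\<close>
      have "list_all2 (\<lambda>f g. f \<otimes> inv g \<in> K) (?fs[i := r (a1 \<otimes>\<^bsub>A\<^esub> a2)]) (?fs[i := r a1 \<otimes> r a2])"
      proof (rule list_all2_all_nthI)
        fix n assume n: "n < length (?fs[i := r (a1 \<otimes>\<^bsub>A\<^esub> a2)])"
        then have m: "r (as ! n) \<in> carrier G" using rs[OF 2(4)] by (auto simp: subset_iff)
        then have 1: "r (as ! n) \<otimes> inv r (as ! n) \<in> K" by (intro \<beta>(3)) auto
        have "\<beta> (r (a1 \<otimes>\<^bsub>A\<^esub> a2)) = \<beta> (r a1 \<otimes> r a2)"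
          unfolding r(2)[OF A.m_closed[OF 2(6,7)]] using r 2 \<beta>(2) by simp
        then have 2: "r (a1 \<otimes>\<^bsub>A\<^esub> a2) \<otimes> inv (r a1 \<otimes> r a2) \<in> K"
          by (rule \<beta>(3)[OF r(1)[OF A.m_closed[OF 2(6,7)]] m_closed[OF r(1)[OF 2(6)] r(1)[OF 2(7)]]])
        show "?fs[i := r (a1 \<otimes>\<^bsub>A\<^esub> a2)] ! n \<otimes> inv (?fs[i := r a1 \<otimes> r a2] ! n) \<in> K"
          using n 1 2 by (cases "n = i") auto
      qed simp
      then have "?N #> iter_bracket G (s b) (?fs[i := r (a1 \<otimes>\<^bsub>A\<^esub> a2)]) =
          ?N #> iter_bracket G (s b) (?fs[i := r a1 \<otimes> r a2])"
        using iter_bracket_cong_slots[OF cp s(1)[OF 2(2)] _ upd[OF r(1)[OF A.m_closed[OF 2(6,7)]]]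
            upd[OF m_closed[OF r(1)[OF 2(6)] r(1)[OF 2(7)]]] K] l by simp
      also have "\<dots> = ?N #> (iter_bracket G (s b) (?fs[i := r a1]) \<otimes> iter_bracket G (s b) (?fs[i := r a2]))"
        using iter_bracket_mult_slot[OF cp s(1)[OF 2(2)] rs[OF 2(4)], of i "r a1" "r a2"] l r 2 by simp
      also have "\<dots> = (?N #> iter_bracket G (s b) (?fs[i := r a1])) \<otimes>\<^bsub>?Q\<^esub> (?N #> iter_bracket G (s b) (?fs[i := r a2]))"
        using s 2 upd r by (intro mult_subquotient[OF D'(2), symmetric] brc) auto
      finally have "f (b, as[i := a1 \<otimes>\<^bsub>A\<^esub> a2]) = f (b, as[i := a1]) \<otimes>\<^bsub>?Q\<^esub> f (b, as[i := a2])"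
        unfolding f_def prod.case map_update .
      then show ?thesis unfolding 2(1) using t 2 h(2) by (intro ker) (simp_all del: mult_FactGroup)
    qed
  qed
  then have ker_R: "?R \<subseteq> kernel ?F ?Q h"
    using F.generate_subgroup_incl h.subgroup_kernel by blast
  have "?R \<lhd> ?F"
    using F.generate_is_subgroup group_tensor_power_pair(2)[OF B A] F.normal_iff_subgroup by blast
  then obtain g where g: "g \<in> hom (?F Mod ?R) ?Q" "\<And>x. x \<in> carrier ?F \<Longrightarrow> g (?R #>\<^bsub>?F\<^esub> x) = h x"
    using h.FactGroup_universal_kernel[OF _ ker_R] by blast
  have img: "subgroup (h ` carrier ?F) ?Q" by (rule h.img_is_subgroup)
  \<comment> \<open>Surjectivity: the elements of \<open>?L\<close> whose class lies in the image of
    \<open>h\<close> form a subgroup, so it suffices to treat the generating brackets.\<close>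
  have sub: "subgroup {x \<in> ?L. ?N #> x \<in> h ` carrier ?F} G"
  proof (rule subgroupI)
    interpret p: group_hom "subgroup_generated G ?L" ?Q "\<lambda>x. ?N #> x"
      using hom_subquotient[OF Ls(2) D'(2)] by (simp add: group_hom_def group_hom_axioms_def Q.is_group)
    have pc: "carrier (subgroup_generated G ?L) = ?L"
      by (rule subgroup.carrier_subgroup_generated_subgroup[OF Ls(2)])
    show "{x \<in> ?L. ?N #> x \<in> h ` carrier ?F} \<subseteq> carrier G" using D' by blast
    have "\<one> \<in> {x \<in> ?L. ?N #> x \<in> h ` carrier ?F}"
      using p.hom_one subgroup.one_closed[OF img] subgroup.one_closed[OF Ls(2)] by simp
    then show "{x \<in> ?L. ?N #> x \<in> h ` carrier ?F} \<noteq> {}" by blast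
    fix x assume x: "x \<in> {x \<in> ?L. ?N #> x \<in> h ` carrier ?F}"
    then have "?N #> inv x = inv\<^bsub>?Q\<^esub> (?N #> x)"
      using p.hom_inv[of x] pc by simp
    then show "inv x \<in> {x \<in> ?L. ?N #> x \<in> h ` carrier ?F}"
      using x subgroup.m_inv_closed[OF img] subgroup.m_inv_closed[OF Ls(2)] by simp
    fix y assume y: "y \<in> {x \<in> ?L. ?N #> x \<in> h ` carrier ?F}"
    then have "?N #> (x \<otimes> y) = (?N #> x) \<otimes>\<^bsub>?Q\<^esub> (?N #> y)"
      using p.hom_mult[of x y] x pc by (simp del: mult_FactGroup)
    then show "x \<otimes> y \<in> {x \<in> ?L. ?N #> x \<in> h ` carrier ?F}"
      using x y subgroup.m_closed[OF img] subgroup.m_closed[OF Ls(2)] by (simp del: mult_FactGroup)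
  qed
  have "{iter_bracket G y fs | y fs. y \<in> L \<and> set fs \<subseteq> carrier G \<and> length fs = c} \<union> ?N
      \<subseteq> {x \<in> ?L. ?N #> x \<in> h ` carrier ?F}"
  proof
    fix z assume "z \<in> {iter_bracket G y fs | y fs. y \<in> L \<and> set fs \<subseteq> carrier G \<and> length fs = c} \<union> ?N"
    then consider y fs where "z = iter_bracket G y fs" "y \<in> L" "set fs \<subseteq> carrier G" "length fs = c"
      | "z \<in> ?N" by blast
    then show "z \<in> {x \<in> ?L. ?N #> x \<in> h ` carrier ?F}"
    proof cases
      case 1
      let ?as = "map \<beta> fs"
      have as: "set ?as \<subseteq> carrier A" using 1 \<beta>(1) by auto
      have b: "\<alpha> y \<in> carrier B" using 1 \<alpha>(1) by blast
      have t: "(\<alpha> y, ?as) \<in> ?T" using as b 1 by (simp add: tensor_gens_def)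
      \<comment> \<open>A bracket with arbitrary entries agrees modulo \<open>?N\<close> with the
        bracket of the chosen preimages of their images, that is, with a value of
        \<open>f\<close>.\<close>
      have "N #> y = N #> s (\<alpha> y)" using 1 s b by (intro \<alpha>(3)) auto
      then have "?N #> z = ?N #> iter_bracket G (s (\<alpha> y)) fs"
        using iter_bracket_cong[OF cp 1(3) 1(2), unfolded 1(4)] s b 1(1) by simp
      also have "list_all2 (\<lambda>f g. f \<otimes> inv g \<in> K) fs (map r ?as)"
        using 1 as r \<beta>(1) by (auto simp: list_all2_conv_all_nth intro!: \<beta>(3) dest!: nth_mem)
      then have "?N #> iter_bracket G (s (\<alpha> y)) fs = ?N #> iter_bracket G (s (\<alpha> y)) (map r ?as)"
        using iter_bracket_cong_slots[OF cp s(1)[OF b] _ 1(3) rs[OF as] K] 1(4) by simp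
      finally have "?N #> z = h (frag_of (\<alpha> y, ?as))"
        using h(2)[OF t] by (simp add: f_def)
      moreover have "frag_of (\<alpha> y, ?as) \<in> carrier ?F" using t by simp
      ultimately show ?thesis using br 1 by blast
    next
      case 2
      then have "?N #> z = \<one>\<^bsub>?Q\<^esub>"
        using D' by (simp add: coset_join2 normal_imp_subgroup subset_iff)
      then show ?thesis using 2 D' subgroup.one_closed[OF img] by auto
    qed
  qed
  then have "generate G ({iter_bracket G y fs | y fs. y \<in> L \<and> set fs \<subseteq> carrier G \<and> length fs = c} \<union> ?N)
      \<subseteq> {x \<in> ?L. ?N #> x \<in> h ` carrier ?F}"
    by (rule generate_subgroup_incl[OF _ sub])
  moreover have LN: "generate G (L \<union> N) = L"
    using generate_subgroup_self[OF Ls(1)] D(3) by (simp add: sup_absorb1)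
  ultimately have "?L \<subseteq> {x \<in> ?L. ?N #> x \<in> h ` carrier ?F}"
    unfolding generate_eq_iter_comm[OF cp D(5) LN subset_refl generate_subgroup_self[OF subgroup_self]]
    by (simp only:)
  then have "carrier ?Q \<subseteq> h ` carrier ?F"
    unfolding carrier_subquotient[OF Ls(2)] by blast
  also have "h ` carrier ?F = g ` carrier (?F Mod ?R)"
    unfolding carrier_FactGroup image_image using g(2) by (intro image_cong) auto
  finally have "g \<in> epi (?F Mod ?R) ?Q"
    using g(1) hom_carrier[OF g(1)] unfolding epi_def by blast
  then show ?thesis unfolding tensor_power_pair_def Let_def by blast
qed

end

section \<open>Free groups on reduced words\<close>

text \<open>The single step inside \<open>word_normalize\<close>. It lets a letter act on reduced
  words, so that normalization becomes a \<open>foldr\<close> of these actions, as in van der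
  Waerden's construction of the free group.\<close>

fun cons_reduce :: "bool \<times> 'a \<Rightarrow> (bool \<times> 'a) list \<Rightarrow> (bool \<times> 'a) list" where
  "cons_reduce a [] = [a]"
| "cons_reduce a (b # v) = (if inverse_letters a b then v else a # b # v)"

lemma word_normalize_Cons: "word_normalize (a # w) = cons_reduce a (word_normalize w)"
  by (cases "word_normalize w") auto

declare word_normalize.simps(2) [simp del]

lemma word_normalize_append: "word_normalize (u @ v) = foldr cons_reduce u (word_normalize v)"
  by (induction u) (auto simp: word_normalize_Cons)

text \<open>A local form of the fixed point condition \<open>word_normalize w = w\<close> that
  defines the carrier.\<close>

definition reduced_word :: "(bool \<times> 'a) list \<Rightarrow> bool" where
  "reduced_word w \<longleftrightarrow> successively (\<lambda>a b. \<not> inverse_letters a b) w"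

lemma reduced_word_cons_reduce: "reduced_word w \<Longrightarrow> reduced_word (cons_reduce a w)"
  by (cases w; cases "tl w") (auto simp: reduced_word_def)

lemma reduced_word_normalize: "reduced_word (word_normalize w)"
  by (induction w) (auto simp: word_normalize_Cons reduced_word_cons_reduce, simp add: reduced_word_def)

lemma word_normalize_reduced: "reduced_word w \<Longrightarrow> word_normalize w = w"
proof (induction w)
  case (Cons a w)
  then have "reduced_word w" by (cases w) (auto simp: reduced_word_def)
  with Cons show ?case
    by (cases w) (auto simp: word_normalize_Cons reduced_word_def)
qed simp

lemma word_normalize_idem [simp]: "word_normalize (word_normalize w) = word_normalize w"
  by (simp add: reduced_word_normalize word_normalize_reduced)

lemma reduced_word_foldr: "reduced_word w \<Longrightarrow> reduced_word (foldr cons_reduce u w)"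
  by (induction u) (auto simp: reduced_word_cons_reduce)

text \<open>If \<open>b\<close> cancels the head of \<open>w\<close>, that head is \<open>a\<close>,
  and putting \<open>a\<close> back must not trigger a second cancellation; this is what reducedness
  of \<open>w\<close> excludes.\<close>

lemma cons_reduce_cancel:
  assumes "inverse_letters a b" "reduced_word w"
  shows "cons_reduce a (cons_reduce b w) = w"
proof (cases w)
  case (Cons d v)
  show ?thesis
  proof (cases "inverse_letters b d")
    case True
    then have "d = a" using assms(1) by (cases a; cases b; cases d) (auto simp: inverse_letters_def)
    then show ?thesis
      using Cons True assms(2) by (cases v) (auto simp: reduced_word_def)
  qed (use Cons assms in auto)
qed (use assms in auto)

text \<open>Inverse letters act on reduced words by inverse maps, so a cancellation inside the
  acting word does not change its effect. Associativity of the multiplication rests on this.\<close>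

lemma foldr_cons_reduce:
  assumes "reduced_word w"
  shows "foldr cons_reduce (cons_reduce a u) w = cons_reduce a (foldr cons_reduce u w)"
  using assms by (cases u) (auto simp: cons_reduce_cancel reduced_word_foldr)

lemma foldr_word_normalize:
  "reduced_word w \<Longrightarrow> foldr cons_reduce (word_normalize u) w = foldr cons_reduce u w"
  by (induction u) (auto simp: word_normalize_Cons foldr_cons_reduce)

lemma word_normalize_append_left: "word_normalize (word_normalize u @ v) = word_normalize (u @ v)"
  by (simp add: word_normalize_append foldr_word_normalize reduced_word_normalize)

lemma word_normalize_append_right: "word_normalize (u @ word_normalize v) = word_normalize (u @ v)"
  by (simp add: word_normalize_append)

lemma set_cons_reduce: "set (cons_reduce a w) \<subseteq> insert a (set w)"
  by (cases w) auto

lemma set_word_normalize: "set (word_normalize w) \<subseteq> set w"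
proof (induction w)
  case (Cons a w)
  then show ?case using set_cons_reduce[of a "word_normalize w"] by (auto simp: word_normalize_Cons)
qed simp

definition inverse_word :: "(bool \<times> 'a) list \<Rightarrow> (bool \<times> 'a) list" where
  "inverse_word w = rev (map (apfst Not) w)"

lemma word_normalize_inverse_word: "word_normalize (inverse_word w @ w) = []"
proof (induction w)
  case Nil
  then show ?case by (simp add: inverse_word_def)
next
  case (Cons a w)
  have "inverse_letters (apfst Not a) a" by (cases a) (simp add: inverse_letters_def)
  then have "word_normalize (apfst Not a # a # w) = word_normalize w"
    by (simp add: word_normalize_Cons cons_reduce_cancel reduced_word_normalize)
  moreover have "word_normalize (inverse_word (a # w) @ a # w) =
      word_normalize (inverse_word w @ word_normalize (apfst Not a # a # w))"
    by (simp add: inverse_word_def word_normalize_append_right)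
  ultimately show ?case using Cons by (simp add: word_normalize_append_right)
qed

lemma carrier_free_group:
  "w \<in> carrier (free_group S) \<longleftrightarrow> word_normalize w = w \<and> snd ` set w \<subseteq> S"
  by (simp add: free_group_def)

lemma mult_free_group: "u \<otimes>\<^bsub>free_group S\<^esub> v = word_normalize (u @ v)"
  by (simp add: free_group_def)

lemma one_free_group: "\<one>\<^bsub>free_group S\<^esub> = []"
  by (simp add: free_group_def)

lemma word_normalize_in_free_group:
  "snd ` set w \<subseteq> S \<Longrightarrow> word_normalize w \<in> carrier (free_group S)"
  using set_word_normalize[of w] by (auto simp: carrier_free_group)

lemma group_free_group: "group (free_group S)"
proof (rule groupI)
  show "\<one>\<^bsub>free_group S\<^esub> \<in> carrier (free_group S)"
    by (simp add: carrier_free_group one_free_group)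
  fix u v w assume u: "u \<in> carrier (free_group S)"
  show "\<one>\<^bsub>free_group S\<^esub> \<otimes>\<^bsub>free_group S\<^esub> u = u"
    using u by (simp add: carrier_free_group one_free_group mult_free_group)
  have "snd ` set (inverse_word u) \<subseteq> S"
    using u by (force simp: carrier_free_group inverse_word_def)
  then have "word_normalize (inverse_word u) \<in> carrier (free_group S)"
    by (rule word_normalize_in_free_group)
  moreover have "word_normalize (inverse_word u) \<otimes>\<^bsub>free_group S\<^esub> u = \<one>\<^bsub>free_group S\<^esub>"
    by (simp add: mult_free_group one_free_group word_normalize_append_left word_normalize_inverse_word)
  ultimately show "\<exists>y\<in>carrier (free_group S). y \<otimes>\<^bsub>free_group S\<^esub> u = \<one>\<^bsub>free_group S\<^esub>" by blast
  assume v: "v \<in> carrier (free_group S)"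
  show "u \<otimes>\<^bsub>free_group S\<^esub> v \<in> carrier (free_group S)"
    unfolding mult_free_group using u v by (intro word_normalize_in_free_group) (auto simp: carrier_free_group)
  assume w: "w \<in> carrier (free_group S)"
  show "u \<otimes>\<^bsub>free_group S\<^esub> v \<otimes>\<^bsub>free_group S\<^esub> w = u \<otimes>\<^bsub>free_group S\<^esub> (v \<otimes>\<^bsub>free_group S\<^esub> w)"
    by (simp add: mult_free_group word_normalize_append_left word_normalize_append_right)
qed

text \<open>The extension of \<open>f\<close> to the free group by its universal property;
  \<open>word_eval\<close> is the case of the identity.\<close>

definition word_lift :: "('b, 'm) monoid_scheme \<Rightarrow> ('a \<Rightarrow> 'b) \<Rightarrow> (bool \<times> 'a) list \<Rightarrow> 'b" where
  "word_lift H f w = word_eval H (map (apsnd f) w)"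

lemma word_lift_ident: "word_lift H (\<lambda>x::'a. x) = word_eval H"
proof -
  have "apsnd (\<lambda>x. x) = (id :: bool \<times> 'a \<Rightarrow> bool \<times> 'a)" by (auto simp: fun_eq_iff)
  then show ?thesis unfolding word_lift_def by simp
qed

context group
begin

lemma word_lift_Cons:
  "word_lift G f (a # w) = (if fst a then f (snd a) else inv f (snd a)) \<otimes> word_lift G f w"
  by (cases a) (simp add: word_lift_def)

lemma word_lift_closed: "f ` snd ` set w \<subseteq> carrier G \<Longrightarrow> word_lift G f w \<in> carrier G"
proof (induction w)
  case Nil
  then show ?case by (simp add: word_lift_def)
qed (auto simp: word_lift_Cons)

lemma word_lift_append:
  "f ` snd ` set (u @ v) \<subseteq> carrier G \<Longrightarrow> word_lift G f (u @ v) = word_lift G f u \<otimes> word_lift G f v"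
proof (induction u)
  case Nil
  then show ?case using word_lift_closed[of f v] by (simp add: word_lift_def)
next
  case (Cons a u)
  then show ?case using word_lift_closed[of f u] word_lift_closed[of f v]
    by (auto simp: word_lift_Cons m_assoc image_Un)
qed

lemma word_lift_cons_reduce:
  assumes "f ` snd ` set (a # w) \<subseteq> carrier G"
  shows "word_lift G f (cons_reduce a w) = word_lift G f (a # w)"
proof (cases w)
  case (Cons b v)
  have "word_lift G f v \<in> carrier G" using assms Cons by (intro word_lift_closed) auto
  then show ?thesis
    using Cons assms by (auto simp: word_lift_Cons inverse_letters_def group_cancel)
qed simp

lemma word_lift_normalize:
  "f ` snd ` set w \<subseteq> carrier G \<Longrightarrow> word_lift G f (word_normalize w) = word_lift G f w"
proof (induction w)
  case (Cons a w)
  have "f ` snd ` set (a # word_normalize w) \<subseteq> carrier G"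
    using Cons.prems set_word_normalize[of w] by auto
  then have "word_lift G f (word_normalize (a # w)) = word_lift G f (a # word_normalize w)"
    by (simp add: word_normalize_Cons word_lift_cons_reduce)
  then show ?case using Cons by (simp add: word_lift_Cons)
qed simp

lemma group_hom_word_lift:
  assumes "f ` S \<subseteq> carrier G"
  shows "group_hom (free_group S) G (word_lift G f)"
proof -
  have sub: "f ` snd ` set w \<subseteq> carrier G" if "w \<in> carrier (free_group S)" for w
    using that assms by (auto simp: carrier_free_group)
  have "word_lift G f \<in> hom (free_group S) G"
  proof (rule homI)
    show "word_lift G f w \<in> carrier G" if "w \<in> carrier (free_group S)" for w
      using word_lift_closed[OF sub[OF that]] .
    fix u v assume "u \<in> carrier (free_group S)" "v \<in> carrier (free_group S)"
    then have "f ` snd ` set (u @ v) \<subseteq> carrier G" using sub by (simp add: image_Un)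
    then show "word_lift G f (u \<otimes>\<^bsub>free_group S\<^esub> v) = word_lift G f u \<otimes> word_lift G f v"
      by (simp add: mult_free_group word_lift_normalize word_lift_append)
  qed
  then show ?thesis
    by (intro group_hom.intro group_hom_axioms.intro group_free_group is_group)
qed

lemma word_lift_letter: "x \<in> S \<Longrightarrow> f ` S \<subseteq> carrier G \<Longrightarrow> word_lift G f [(True, x)] = f x"
  by (auto simp: word_lift_def)

end

lemma letter_in_free_group: "x \<in> S \<Longrightarrow> [(e, x)] \<in> carrier (free_group S)"
  by (simp add: carrier_free_group word_normalize_Cons)

lemma generate_letters:
  "generate (free_group S) ((\<lambda>x. [(True, x)]) ` S) = carrier (free_group S)" (is "generate ?F ?Y = _")
proof
  interpret F: group ?F by (rule group_free_group)
  have Y: "?Y \<subseteq> carrier ?F" by (auto simp: letter_in_free_group)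
  then show "generate ?F ?Y \<subseteq> carrier ?F" by (rule F.generate_incl)
  have letter: "[(e, x)] \<in> generate ?F ?Y" if "x \<in> S" for e x
  proof (cases e)
    case True
    then show ?thesis using that by (auto intro: generate.incl)
  next
    case False
    have "[(False, x)] \<otimes>\<^bsub>?F\<^esub> [(True, x)] = \<one>\<^bsub>?F\<^esub>"
      by (simp add: mult_free_group one_free_group word_normalize_Cons inverse_letters_def)
    then have "inv\<^bsub>?F\<^esub> [(True, x)] = [(False, x)]"
      by (rule F.inv_equality) (simp_all add: that letter_in_free_group)
    moreover have "inv\<^bsub>?F\<^esub> [(True, x)] \<in> generate ?F ?Y"
      using that by (intro generate.inv imageI)
    ultimately show ?thesis using False by simp
  qed
  show "carrier ?F \<subseteq> generate ?F ?Y"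
  proof
    fix w assume "w \<in> carrier ?F"
    then show "w \<in> generate ?F ?Y"
    proof (induction w)
      case Nil
      then show ?case using generate.one[of ?F] by (simp add: one_free_group)
    next
      case (Cons a w)
      have r: "reduced_word (a # w)"
        using Cons.prems reduced_word_normalize[of "a # w"] by (simp add: carrier_free_group)
      then have "reduced_word w" by (cases w) (auto simp: reduced_word_def)
      then have "w \<in> carrier ?F"
        using Cons.prems by (auto simp: carrier_free_group word_normalize_reduced)
      moreover have "[a] \<in> generate ?F ?Y"
        using Cons.prems letter[of "snd a" "fst a"] by (simp add: carrier_free_group)
      \<comment> \<open>No cancellation occurs because \<open>a # w\<close> is reduced.\<close>
      moreover have "[a] \<otimes>\<^bsub>?F\<^esub> w = a # w"
        using r by (simp add: mult_free_group word_normalize_reduced)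
      ultimately show ?case using Cons.IH generate.eng[of "[a]" ?F ?Y w] by simp
    qed
  qed
qed

lemma hom_eq_on_generate:
  assumes "group_hom G H h" "group_hom G H k" "Y \<subseteq> carrier G" "\<And>y. y \<in> Y \<Longrightarrow> h y = k y"
    "x \<in> generate G Y"
  shows "h x = k x"
proof -
  interpret h: group_hom G H h by fact
  interpret k: group_hom G H k by fact
  have gen: "y \<in> carrier G" if "y \<in> generate G Y" for y
    using that h.G.generate_in_carrier[OF assms(3)] by blast
  show ?thesis
    using assms(5)
  proof induction
    case (inv y)
    then have "y \<in> carrier G" using assms(3) by blast
    then show ?case using assms(4)[OF inv] h.hom_inv[of y] k.hom_inv[of y] by simp
  next
    case (eng y z)
    then show ?case using gen h.hom_mult[of y z] k.hom_mult[of y z] by simp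
  next
    case one
    show ?case by (simp only: h.hom_one k.hom_one)
  next
    case (incl y)
    then show ?case by (rule assms(4))
  qed
qed

lemma free_group_hom_eq:
  assumes "group_hom (free_group S) H h" "group_hom (free_group S) H k"
    "\<And>x. x \<in> S \<Longrightarrow> h [(True, x)] = k [(True, x)]" "w \<in> carrier (free_group S)"
  shows "h w = k w"
proof (rule hom_eq_on_generate[OF assms(1,2)])
  show "(\<lambda>x. [(True, x)]) ` S \<subseteq> carrier (free_group S)" by (auto simp: letter_in_free_group)
  show "w \<in> generate (free_group S) ((\<lambda>x. [(True, x)]) ` S)" using assms(4) by (simp add: generate_letters)
qed (use assms(3) in auto)

section \<open>Order, exponent and generators of subquotients\<close>

text \<open>An infinite group has \<open>order\<close> 0, and the identity holds in this convention
  as well, so divisibility of orders passes along epimorphisms between possibly infinite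
  groups.\<close>

lemma (in group_hom) order_kernel_image:
  assumes "h ` carrier G = carrier H"
  shows "order G = order H * card (kernel G H h)"
proof -
  have "card (rcosets\<^bsub>G\<^esub> kernel G H h) = order (G Mod kernel G H h)"
    by (simp add: order_def FactGroup_def)
  also have "\<dots> = order H"
    using iso_same_order FactGroup_iso[OF assms] unfolding is_iso_def by blast
  finally show ?thesis using G.lagrange[OF subgroup_kernel] by simp
qed

lemma (in group_hom) order_dvd:
  "h ` carrier G = carrier H \<Longrightarrow> order H dvd order G"
  by (simp add: order_kernel_image)

context group
begin

text \<open>When no positive exponent exists the value is 0, and the zeroth power is trivially the
  identity.\<close>

lemma pow_group_exponent: "x \<in> carrier G \<Longrightarrow> x [^] group_exponent G = \<one>"
proof (cases "\<exists>n::nat>0. \<forall>x\<in>carrier G. x [^] n = \<one>")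
  case True
  then have "\<forall>x\<in>carrier G. x [^] (LEAST n::nat. n > 0 \<and> (\<forall>x\<in>carrier G. x [^] n = \<one>)) = \<one>"
    using LeastI_ex[of "\<lambda>n::nat. n > 0 \<and> (\<forall>x\<in>carrier G. x [^] n = \<one>)"] by blast
  moreover assume "x \<in> carrier G"
  ultimately show ?thesis unfolding group_exponent_def if_P[OF True] by blast
next
  case False
  show ?thesis unfolding group_exponent_def if_not_P[OF False] by simp
qed

text \<open>Division with remainder: the remainder annihilates the group too, so minimality forces
  it to be 0. For \<open>n = 0\<close> every number divides.\<close>

lemma group_exponent_dvd:
  assumes "\<And>x. x \<in> carrier G \<Longrightarrow> x [^] n = \<one>"
  shows "group_exponent G dvd (n::nat)"
proof (cases "n = 0")
  case False
  let ?P = "\<lambda>n::nat. n > 0 \<and> (\<forall>x\<in>carrier G. x [^] n = \<one>)"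
  have ex: "?P n" using assms False by simp
  then have "\<exists>n::nat>0. \<forall>x\<in>carrier G. x [^] n = \<one>" by blast
  then have e: "group_exponent G = (LEAST n. ?P n)" unfolding group_exponent_def by (rule if_P)
  have pos: "group_exponent G > 0" unfolding e using LeastI[of ?P n, OF ex] by simp
  have "x [^] (n mod group_exponent G) = \<one>" if x: "x \<in> carrier G" for x
  proof -
    have "\<one> = x [^] (group_exponent G * (n div group_exponent G) + n mod group_exponent G)"
      using assms[OF x] by simp
    also have "\<dots> = (x [^] group_exponent G) [^] (n div group_exponent G) \<otimes> x [^] (n mod group_exponent G)"
      by (simp only: nat_pow_pow[OF x] nat_pow_mult[OF x])
    also have "\<dots> = x [^] (n mod group_exponent G)"
      unfolding pow_group_exponent[OF x] using x by simp
    finally show ?thesis by simp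
  qed
  then have "\<not> n mod group_exponent G > 0"
    using not_less_Least[of "n mod group_exponent G" ?P] pos by (auto simp flip: e)
  then show ?thesis by (simp add: mod_eq_0_iff_dvd)
qed simp

end

lemma (in group_hom) group_exponent_dvd_epi:
  assumes "h ` carrier G = carrier H"
  shows "group_exponent H dvd group_exponent G"
proof (rule H.group_exponent_dvd)
  fix y assume "y \<in> carrier H"
  then obtain x where "x \<in> carrier G" "y = h x" using assms by blast
  then show "y [^]\<^bsub>H\<^esub> group_exponent G = \<one>\<^bsub>H\<^esub>"
    using hom_nat_pow[of x "group_exponent G"] G.pow_group_exponent by simp
qed

text \<open>\<open>min_generators\<close> is a least number, hence an unspecified value when the group is not finitely generated.\<close>
definition finitely_generated :: "('a, 'b) monoid_scheme \<Rightarrow> bool" where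
  "finitely_generated G \<longleftrightarrow> (\<exists>S \<subseteq> carrier G. finite S \<and> generate G S = carrier G)"

lemma min_generators_witness:
  assumes "finitely_generated G"
  obtains S where "S \<subseteq> carrier G" "finite S" "generate G S = carrier G" "card S = min_generators G"
proof -
  have "\<exists>n S. S \<subseteq> carrier G \<and> finite S \<and> card S = n \<and> generate G S = carrier G"
    using assms unfolding finitely_generated_def by blast
  from LeastI_ex[OF this] show thesis
    using that unfolding min_generators_def by blast
qed

lemma min_generators_le:
  "\<lbrakk>S \<subseteq> carrier G; finite S; generate G S = carrier G\<rbrakk> \<Longrightarrow> min_generators G \<le> card S"
  unfolding min_generators_def by (rule Least_le) blast

lemma (in group_hom) generators_image:
  assumes "h ` carrier G = carrier H" "S \<subseteq> carrier G" "finite S" "generate G S = carrier G"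
  shows "\<exists>S' \<subseteq> carrier H. finite S' \<and> generate H S' = carrier H \<and> card S' \<le> card S"
proof (intro exI conjI)
  show "h ` S \<subseteq> carrier H" using assms(1,2) by blast
  show "generate H (h ` S) = carrier H" unfolding generate_img[OF assms(2)] assms(1,4) ..
qed (use assms(3) card_image_le in auto)

context group
begin

text \<open>The third isomorphism theorem, kept as an epimorphism with explicit kernel
  \<open>W / V\<close> so that orders multiply.\<close>

lemma subquotient_epi:
  assumes "subgroup U G" "V \<lhd> G" "W \<lhd> G" "V \<subseteq> W" "W \<subseteq> U"
  shows "\<exists>h. group_hom (subquotient G U V) (subquotient G U W) h \<and>
    h ` carrier (subquotient G U V) = carrier (subquotient G U W) \<and>
    kernel (subquotient G U V) (subquotient G U W) h = carrier (subquotient G W V)"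
proof -
  let ?S = "subgroup_generated G U"
  have W: "subgroup W G" using assms by (simp add: normal_imp_subgroup)
  have VU: "V \<subseteq> U" using assms by blast
  have c: "carrier ?S = U" by (rule subgroup.carrier_subgroup_generated_subgroup[OF assms(1)])
  have W1: "W #> x = \<one>\<^bsub>subquotient G U W\<^esub> \<longleftrightarrow> x \<in> W" if "x \<in> U" for x
    using rcos_eq_self_iff[OF W subgroup.mem_carrier[OF assms(1) that]] by simp
  interpret p: group_hom ?S "subquotient G U W" "\<lambda>x. W #> x"
    using hom_subquotient[OF assms(1,3)] group_subquotient[OF assms(1,3,5)]
    by (intro group_hom.intro group_hom_axioms.intro) auto
  have "V \<subseteq> kernel ?S (subquotient G U W) (\<lambda>x. W #> x)"
    using W1 assms(4,5) VU by (auto simp: kernel_def c)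
  then obtain h where h: "h \<in> hom (subquotient G U V) (subquotient G U W)"
      "\<And>x. x \<in> U \<Longrightarrow> h (V #> x) = W #> x"
    using p.FactGroup_universal_kernel[OF normal_subgroup_generated[OF assms(1,2) VU]]
    unfolding c rcos_subgroup_generated by blast
  have "group_hom (subquotient G U V) (subquotient G U W) h"
    using h group_subquotient[OF assms(1,3,5)] group_subquotient[OF assms(1,2) VU]
    by (intro group_hom.intro group_hom_axioms.intro)
  moreover have "h ` carrier (subquotient G U V) = carrier (subquotient G U W)"
    unfolding carrier_subquotient[OF assms(1)] image_image using h(2) by (intro image_cong) auto
  moreover have "kernel (subquotient G U V) (subquotient G U W) h = carrier (subquotient G W V)"
  proof -
    have "h (V #> x) = \<one>\<^bsub>subquotient G U W\<^esub> \<longleftrightarrow> x \<in> W" if "x \<in> U" for x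
      unfolding h(2)[OF that] by (rule W1[OF that])
    then show ?thesis
      unfolding kernel_def carrier_subquotient[OF assms(1)] carrier_subquotient[OF W]
      using assms(5) by blast
  qed
  ultimately show ?thesis by blast
qed

lemma order_subquotient:
  assumes "subgroup U G" "V \<lhd> G" "W \<lhd> G" "V \<subseteq> W" "W \<subseteq> U"
  shows "order (subquotient G U V) = order (subquotient G U W) * order (subquotient G W V)"
proof -
  obtain h where h: "group_hom (subquotient G U V) (subquotient G U W) h"
    "h ` carrier (subquotient G U V) = carrier (subquotient G U W)"
    "kernel (subquotient G U V) (subquotient G U W) h = carrier (subquotient G W V)"
    using subquotient_epi[OF assms] by blast
  show ?thesis using group_hom.order_kernel_image[OF h(1,2)] unfolding h(3) by (simp add: order_def)
qed

lemma order_subquotient_chain: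
  assumes "subgroup U G" "\<And>i. A i \<lhd> G" "\<And>i. A (Suc i) \<subseteq> A i" "A 0 \<subseteq> U"
  shows "order (subquotient G U (A n)) =
    order (subquotient G U (A 0)) * (\<Prod>i<n. order (subquotient G (A i) (A (Suc i))))"
proof (induction n)
  case (Suc n)
  have "A n \<subseteq> A 0" using assms(3) by (rule lift_Suc_antimono_le) simp
  then have "order (subquotient G U (A (Suc n))) = order (subquotient G U (A n)) * order (subquotient G (A n) (A (Suc n)))"
    using assms by (intro order_subquotient) auto
  then show ?case using Suc by simp
qed simp

lemma subquotient_pow:
  assumes "subgroup U G" "V \<lhd> G" "V \<subseteq> U" "x \<in> U"
  shows "(V #> x) [^]\<^bsub>subquotient G U V\<^esub> (n::nat) = V #> (x [^] n)"
proof -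
  interpret p: group_hom "subgroup_generated G U" "subquotient G U V" "\<lambda>x. V #> x"
    using hom_subquotient[OF assms(1,2)] group_subquotient[OF assms(1-3)]
    by (intro group_hom.intro group_hom_axioms.intro) auto
  have "x \<in> carrier (subgroup_generated G U)"
    using assms by (simp add: subgroup.carrier_subgroup_generated_subgroup)
  from p.hom_nat_pow[OF this, of n] show ?thesis by (simp add: pow_subgroup_generated)
qed

lemma subquotient_pow_eq_one_iff:
  assumes "subgroup U G" "V \<lhd> G" "V \<subseteq> U" "x \<in> U"
  shows "(V #> x) [^]\<^bsub>subquotient G U V\<^esub> (n::nat) = \<one>\<^bsub>subquotient G U V\<^esub> \<longleftrightarrow> x [^] n \<in> V"
  unfolding subquotient_pow[OF assms]
  using assms subgroup.mem_carrier[OF assms(1,4)] by (simp add: rcos_eq_self_iff normal_imp_subgroup)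

lemma pow_group_exponent_subquotient:
  assumes "subgroup U G" "V \<lhd> G" "V \<subseteq> U" "x \<in> U"
  shows "x [^] group_exponent (subquotient G U V) \<in> V"
proof -
  have "V #> x \<in> carrier (subquotient G U V)" using assms by (simp add: carrier_subquotient)
  from group.pow_group_exponent[OF group_subquotient[OF assms(1-3)] this]
  show ?thesis unfolding subquotient_pow_eq_one_iff[OF assms] .
qed

text \<open>Each exponent moves the power one step down the chain. The starting point is any element
  of \<open>U\<close>, so the bound also serves subgroups of \<open>U\<close>, such as the one that
  carries the multiplier.\<close>

lemma pow_exponent_chain:
  assumes "subgroup U G" "\<And>i. A i \<lhd> G" "\<And>i. A (Suc i) \<subseteq> A i" "A 0 \<subseteq> U" "x \<in> U"
  shows "x [^] (group_exponent (subquotient G U (A 0)) *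
    (\<Prod>i<n. group_exponent (subquotient G (A i) (A (Suc i))))) \<in> A n"
proof (induction n)
  case 0
  then show ?case using assms pow_group_exponent_subquotient by simp
next
  case (Suc n)
  from pow_group_exponent_subquotient[OF normal_imp_subgroup[OF assms(2)] assms(2,3) Suc]
  show ?case using subgroup.mem_carrier[OF assms(1,5)] by (simp add: nat_pow_pow mult.assoc)
qed

lemma subquotient_generators_lift:
  assumes U: "subgroup U G" "V \<lhd> G" "V \<subseteq> U"
    and S: "S \<subseteq> carrier (subquotient G U V)" "finite S"
      "generate (subquotient G U V) S = carrier (subquotient G U V)"
  shows "\<exists>S' \<subseteq> U. finite S' \<and> card S' \<le> card S \<and> generate G (S' \<union> V) = U"
proof -
  let ?H = "subgroup_generated G U"
  interpret p: group_hom ?H "subquotient G U V" "\<lambda>x. V #> x"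
    using hom_subquotient[OF U(1,2)] group_subquotient[OF U]
    by (intro group_hom.intro group_hom_axioms.intro) auto
  have c: "carrier ?H = U" by (rule subgroup.carrier_subgroup_generated_subgroup[OF U(1)])
  \<comment> \<open>One representative per coset, so that the number of generators is
    preserved.\<close>
  obtain S' where S': "S' \<subseteq> U" "S = (\<lambda>x. V #> x) ` S'" "inj_on (\<lambda>x. V #> x) S'"
    using S(1) unfolding carrier_subquotient[OF U(1)] by (metis subset_image_inj)
  define W where "W = generate G (S' \<union> V)"
  have Uc: "U \<subseteq> carrier G" using U subgroup.subset by blast
  have W: "subgroup W G" unfolding W_def using S' U(3) Uc by (intro generate_is_subgroup) blast
  have VW: "V \<subseteq> W" "S' \<subseteq> W" unfolding W_def by (auto intro: generate.incl)
  have WU: "W \<subseteq> U" unfolding W_def using S' U by (intro generate_subgroup_incl) auto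
  have "subgroup W ?H" using W WU by (simp add: subgroup_subgroup_generated_iff c)
  then have "generate ?H S' \<subseteq> W" by (rule p.G.generate_subgroup_incl[OF VW(2)])
  then have sub: "(\<lambda>x. V #> x) ` generate ?H S' \<subseteq> (\<lambda>x. V #> x) ` W" by (rule image_mono)
  have "S' \<subseteq> carrier ?H" using S'(1) unfolding c .
  then have "(\<lambda>x. V #> x) ` generate ?H S' = carrier (subquotient G U V)"
    unfolding S(3)[symmetric] S'(2) by (rule p.generate_img[symmetric])
  then have im: "(\<lambda>x. V #> x) ` U \<subseteq> (\<lambda>x. V #> x) ` W"
    using sub unfolding carrier_subquotient[OF U(1)] by (rule ord_eq_le_trans[OF sym])
  have "U \<subseteq> W"
  proof
    fix u assume "u \<in> U"
    then obtain w where w: "w \<in> W" "V #> u = V #> w" using im by blast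
    then show "u \<in> W"
      using rcos_eq_imp_mem[OF normal_imp_subgroup[OF U(2)] W VW(1) _ w(1) w(2)] \<open>u \<in> U\<close> Uc by blast
  qed
  then have "W = U" using WU by blast
  moreover have "finite S'" using finite_imageD[OF _ S'(3)] S(2) unfolding S'(2) .
  moreover have "card S' \<le> card S" unfolding S'(2) card_image[OF S'(3)] ..
  ultimately show ?thesis using S' unfolding W_def by blast
qed

lemma subquotient_generators:
  assumes U: "subgroup U G" "V \<lhd> G" "V \<subseteq> U"
    and S: "S \<subseteq> U" "finite S" "generate G (S \<union> V) = U"
  shows "finitely_generated (subquotient G U V) \<and> min_generators (subquotient G U V) \<le> card S"
proof -
  let ?Q = "subquotient G U V"
  let ?H = "subgroup_generated G U"
  interpret p: group_hom ?H ?Q "\<lambda>x. V #> x"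
    using hom_subquotient[OF U(1,2)] group_subquotient[OF U]
    by (intro group_hom.intro group_hom_axioms.intro) auto
  have c: "carrier ?H = U" by (rule subgroup.carrier_subgroup_generated_subgroup[OF U(1)])
  define T where "T = (\<lambda>x. V #> x) ` S"
  have T: "T \<subseteq> carrier ?Q" unfolding T_def carrier_subquotient[OF U(1)] using S by blast
  have sT: "subgroup (generate ?Q T) ?Q" using T by (rule p.H.generate_is_subgroup)
  define W where "W = {x \<in> U. V #> x \<in> generate ?Q T}"
  have "subgroup W ?H"
  proof (rule p.G.subgroupI)
    show "W \<subseteq> carrier ?H" unfolding W_def c by blast
    have "\<one>\<^bsub>?H\<^esub> \<in> W" unfolding W_def
      using p.hom_one subgroup.one_closed[OF sT] p.G.one_closed c by simp
    then show "W \<noteq> {}" by blast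
    fix x assume x: "x \<in> W"
    then have xc: "x \<in> carrier ?H" unfolding W_def c by blast
    then show "inv\<^bsub>?H\<^esub> x \<in> W"
      using x p.hom_inv[OF xc] subgroup.m_inv_closed[OF sT] p.G.inv_closed[OF xc] c unfolding W_def by simp
    fix y assume y: "y \<in> W"
    then have yc: "y \<in> carrier ?H" unfolding W_def c by blast
    then show "x \<otimes>\<^bsub>?H\<^esub> y \<in> W"
      using x y p.hom_mult[OF xc yc] subgroup.m_closed[OF sT, of "V #> x" "V #> y"] p.G.m_closed[OF xc yc] c
      unfolding W_def by (simp del: mult_FactGroup mult_subgroup_generated)
  qed
  then have W: "subgroup W G" by (simp add: subgroup_subgroup_generated_iff)
  have "S \<union> V \<subseteq> W"
  proof
    fix x assume "x \<in> S \<union> V"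
    moreover have "V #> x \<in> generate ?Q T" if "x \<in> S"
      using that unfolding T_def by (intro generate.incl imageI)
    moreover have "V #> x \<in> generate ?Q T" if "x \<in> V"
    proof -
      have "V #> x = \<one>\<^bsub>?Q\<^esub>"
        using that U by (simp add: coset_join2 normal_imp_subgroup subset_iff subgroup.mem_carrier)
      then show ?thesis using subgroup.one_closed[OF sT] by simp
    qed
    ultimately show "x \<in> W" unfolding W_def using S(1) U(3) by blast
  qed
  then have "U \<subseteq> W" using generate_subgroup_incl[OF _ W] S(3) by blast
  then have "carrier ?Q \<subseteq> generate ?Q T" unfolding carrier_subquotient[OF U(1)] W_def by blast
  then have gen: "generate ?Q T = carrier ?Q" using p.H.generate_incl[OF T] by blast
  have "finite T" "card T \<le> card S" unfolding T_def using S(2) by (simp_all add: card_image_le)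
  then show ?thesis
    using T gen min_generators_le[OF T] unfolding finitely_generated_def by (meson order_trans)
qed

end

text \<open>Subgroups of the integers are cyclic: the least positive element divides the others by
  division with remainder, and \<open>d = 0\<close> serves when only 0 occurs.\<close>

lemma int_subgroup_principal:
  fixes I :: "int set"
  assumes "0 \<in> I" "\<And>k l. k \<in> I \<Longrightarrow> l \<in> I \<Longrightarrow> k - l \<in> I"
  shows "\<exists>d\<in>I. \<forall>k\<in>I. d dvd k"
proof (cases "\<exists>n. n > 0 \<and> int n \<in> I")
  case True
  define d where "d = (LEAST n. n > 0 \<and> int n \<in> I)"
  have d: "d > 0" "int d \<in> I" using LeastI_ex[OF True] unfolding d_def by auto
  have mult: "int n * int d \<in> I" for n
  proof (induction n)
    case (Suc n)
    have "int n * int d - (0 - int d) \<in> I" using Suc assms d by blast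
    then show ?case by (simp add: algebra_simps)
  qed (simp add: assms)
  have "int d dvd k" if "k \<in> I" for k
  proof -
    have q: "(k div int d) * int d \<in> I"
    proof (cases "k div int d \<ge> 0")
      case True
      then show ?thesis using mult[of "nat (k div int d)"] by simp
    next
      case False
      then have "0 - int (nat (- (k div int d))) * int d \<in> I" using mult assms by blast
      then show ?thesis using False by simp
    qed
    have "k mod int d = k - (k div int d) * int d" by (simp add: minus_div_mult_eq_mod)
    then have m: "k mod int d \<in> I" using q assms(2)[OF that] by simp
    have "\<not> nat (k mod int d) > 0"
    proof
      assume "nat (k mod int d) > 0"
      then have "d \<le> nat (k mod int d)"
        using m Least_le[of "\<lambda>n. n > 0 \<and> int n \<in> I" "nat (k mod int d)", folded d_def] by simp
      moreover have "k mod int d < int d" "k mod int d \<ge> 0" using d by simp_all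
      ultimately show False by linarith
    qed
    then have "k mod int d = 0" using d pos_mod_sign[of "int d" k] by linarith
    then show ?thesis by (simp add: dvd_eq_mod_eq_0)
  qed
  then show ?thesis using d by blast
next
  case False
  have "k = 0" if "k \<in> I" for k
  proof (rule ccontr)
    assume "k \<noteq> 0"
    moreover have "0 - k \<in> I" using assms that by blast
    ultimately have "int (nat \<bar>k\<bar>) \<in> I" "nat \<bar>k\<bar> > 0" using that by (auto simp: abs_if)
    then show False using False by blast
  qed
  then show ?thesis using assms(1) by auto
qed

section \<open>Generators of subgroups and congruent homomorphisms\<close>

context group
begin

text \<open>The central \<open>n\<close> cancels at once; \<open>r\<close> moves past
  \<open>b\<close> and meets its inverse. In the application \<open>n\<close> and \<open>r\<close>
  measure how far two homomorphisms differ on the two entries of a commutator.\<close>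

lemma commutator_congruent:
  assumes c: "n \<in> carrier G" "r \<in> carrier G" "b \<in> carrier G" "g \<in> carrier G"
    and n: "\<And>z. z \<in> carrier G \<Longrightarrow> n \<otimes> z = z \<otimes> n" and br: "b \<otimes> r = r \<otimes> b"
  shows "commutator G (n \<otimes> b) (r \<otimes> g) = commutator G b g"
proof -
  have n': "inv n \<otimes> (z \<otimes> (n \<otimes> w)) = z \<otimes> w" if "z \<in> carrier G" "w \<in> carrier G" for z w
  proof -
    have "z \<otimes> (n \<otimes> w) = n \<otimes> (z \<otimes> w)" using n[of z] that c by (simp flip: m_assoc)
    then show ?thesis using that c by (simp add: group_cancel)
  qed
  have "commutator G (n \<otimes> b) (r \<otimes> g) = inv b \<otimes> (inv n \<otimes> ((inv g \<otimes> inv r) \<otimes> (n \<otimes> ((b \<otimes> r) \<otimes> g))))"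
    using c by (simp add: commutator_def group_word_simps)
  also have "\<dots> = inv b \<otimes> ((inv g \<otimes> inv r) \<otimes> ((r \<otimes> b) \<otimes> g))"
    using c n' br by simp
  also have "\<dots> = commutator G b g"
    using c by (simp add: commutator_def group_word_simps)
  finally show ?thesis .
qed

text \<open>The exponents of \<open>a\<close> occurring in \<open>K\<close> form a subgroup of the integers, so modulo \<open>U\<close> one element of \<open>K\<close>
  generates everything.\<close>
lemma subgroup_of_cyclic_extension:
  assumes U: "subgroup U G" and V: "V \<lhd> G" "V \<subseteq> U" and a: "a \<in> carrier G"
    and comm: "\<And>u k. u \<in> U \<Longrightarrow> commutator G u (a [^] (k::int)) \<in> V"
    and K: "subgroup K G"
  shows "\<exists>b\<in>K. K \<inter> generate G (insert a U) \<subseteq> generate G (insert b (K \<inter> U))"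
proof -
  define W where "W = {a [^] k \<otimes> u | (k::int) u. u \<in> U}"
  have Uc: "\<And>u. u \<in> U \<Longrightarrow> u \<in> carrier G" using U subgroup.subset by blast
  \<comment> \<open>\<open>a\<close> normalizes \<open>U\<close> because \<open>[u, a^k]\<close>
    lies in \<open>V \<subseteq> U\<close>; hence the products of a power of \<open>a\<close> with
    an element of \<open>U\<close> already form a subgroup.\<close>
  have conj: "inv (a [^] k) \<otimes> u \<otimes> a [^] k \<in> U" if u: "u \<in> U" for u and k :: int
  proof -
    have "inv (a [^] k) \<otimes> u \<otimes> a [^] k = u \<otimes> commutator G u (a [^] k)"
      using Uc[OF u] a by (simp add: commutator_def group_word_simps)
    then show ?thesis using subgroup.m_closed[OF U u] comm[OF u] V by auto
  qed
  have W: "subgroup W G"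
  proof (rule subgroupI)
    show "W \<subseteq> carrier G" unfolding W_def using a Uc by auto
    show "W \<noteq> {}" unfolding W_def using subgroup.one_closed[OF U] by blast
    fix x assume "x \<in> W"
    then obtain k :: int and u where x: "x = a [^] k \<otimes> u" "u \<in> U" unfolding W_def by blast
    have "inv x = a [^] (- k) \<otimes> (inv (a [^] (- k)) \<otimes> inv u \<otimes> a [^] (- k))"
      using x a Uc by (simp add: int_pow_neg group_word_simps)
    moreover have "inv (a [^] (- k)) \<otimes> inv u \<otimes> a [^] (- k) \<in> U"
      using x U by (intro conj) (simp add: subgroup.m_inv_closed)
    ultimately show "inv x \<in> W" unfolding W_def by blast
    fix y assume "y \<in> W"
    then obtain l :: int and v where y: "y = a [^] l \<otimes> v" "v \<in> U" unfolding W_def by blast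
    have "x \<otimes> y = a [^] (k + l) \<otimes> ((inv (a [^] l) \<otimes> u \<otimes> a [^] l) \<otimes> v)"
      using x y a Uc by (simp add: int_pow_mult group_word_simps)
    moreover have "(inv (a [^] l) \<otimes> u \<otimes> a [^] l) \<otimes> v \<in> U"
      using conj x y U by (simp add: subgroup.m_closed)
    ultimately show "x \<otimes> y \<in> W" unfolding W_def by blast
  qed
  have "a \<in> W"
    unfolding W_def using a subgroup.one_closed[OF U] by (intro CollectI exI[of _ "1::int"] exI[of _ "\<one>"]) simp
  moreover have "u \<in> W" if "u \<in> U" for u
    unfolding W_def using Uc[OF that] that by (intro CollectI exI[of _ "0::int"] exI[of _ u]) simp
  ultimately have gen: "generate G (insert a U) \<subseteq> W"
    using W by (intro generate_subgroup_incl) auto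
  define I where "I = {k::int. \<exists>u\<in>U. a [^] k \<otimes> u \<in> K}"
  have I0: "0 \<in> I"
    unfolding I_def using subgroup.one_closed[OF U] subgroup.one_closed[OF K] by (auto intro!: bexI[of _ "\<one>"])
  have diff: "k - l \<in> I" if kl: "k \<in> I" "l \<in> I" for k l
  proof -
    obtain u v where u: "u \<in> U" "a [^] k \<otimes> u \<in> K" and v: "v \<in> U" "a [^] l \<otimes> v \<in> K"
      using kl unfolding I_def by blast
    have c: "u \<in> carrier G" "v \<in> carrier G" using u v Uc by auto
    let ?w = "inv (a [^] (- l)) \<otimes> (u \<otimes> inv v) \<otimes> a [^] (- l)"
    have "(a [^] k \<otimes> u) \<otimes> inv (a [^] l \<otimes> v) \<in> K"
      using u v K by (simp add: subgroup.m_closed subgroup.m_inv_closed)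
    moreover have "(a [^] k \<otimes> u) \<otimes> inv (a [^] l \<otimes> v) = a [^] (k - l) \<otimes> ?w"
      using c a int_pow_mult[OF a, of k "- l"] by (simp add: int_pow_neg group_word_simps)
    moreover have "?w \<in> U"
      using u v U by (intro conj) (simp add: subgroup.m_closed subgroup.m_inv_closed)
    ultimately show ?thesis unfolding I_def by auto
  qed
  obtain d where d: "d \<in> I" "\<And>k. k \<in> I \<Longrightarrow> d dvd k"
    using int_subgroup_principal[OF I0 diff] by blast
  then obtain v where v: "v \<in> U" "a [^] d \<otimes> v \<in> K" unfolding I_def by blast
  define b where "b = a [^] d \<otimes> v"
  have bc: "b \<in> carrier G" unfolding b_def using a v Uc by simp
  have bW: "\<exists>w\<in>U. b [^] m = a [^] (d * m) \<otimes> w" for m :: int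
  proof -
    have pos: "\<exists>w\<in>U. b [^] (int n) = a [^] (d * int n) \<otimes> w" for n
    proof (induction n)
      case 0
      then show ?case using subgroup.one_closed[OF U] by (auto intro!: bexI[of _ "\<one>"])
    next
      case (Suc n)
      then obtain w where w: "w \<in> U" "b [^] (int n) = a [^] (d * int n) \<otimes> w" by blast
      have "b [^] (int (Suc n)) = b [^] (int n) \<otimes> b"
        using int_pow_mult[OF bc, of "int n" 1] bc by (simp add: add.commute)
      also have "\<dots> = (a [^] (d * int n) \<otimes> a [^] d) \<otimes> ((inv (a [^] d) \<otimes> w \<otimes> a [^] d) \<otimes> v)"
        unfolding w(2) unfolding b_def using a Uc[OF w(1)] Uc[OF v(1)] by (simp add: group_word_simps)
      also have "a [^] (d * int n) \<otimes> a [^] d = a [^] (d * int (Suc n))"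
        using int_pow_mult[OF a, of "d * int n" d] by (simp add: algebra_simps del: int_pow_mult)
      finally show ?case
        using subgroup.m_closed[OF U conj[OF w(1)] v(1)] by blast
    qed
    show ?thesis
    proof (cases "m \<ge> 0")
      case True
      then show ?thesis using pos[of "nat m"] by simp
    next
      case False
      then obtain w where w: "w \<in> U" "b [^] (- m) = a [^] (d * (- m)) \<otimes> w" using pos[of "nat (- m)"] by auto
      have "b [^] m = inv (b [^] (- m))" using bc by (simp add: int_pow_neg)
      also have "\<dots> = a [^] (d * m) \<otimes> (inv (a [^] (d * m)) \<otimes> inv w \<otimes> a [^] (d * m))"
        unfolding w(2) using a Uc[OF w(1)] by (simp add: int_pow_neg group_word_simps)
      finally show ?thesis
        using conj[OF subgroup.m_inv_closed[OF U w(1)]] by blast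
    qed
  qed
  have "K \<inter> generate G (insert a U) \<subseteq> generate G (insert b (K \<inter> U))"
  proof
    fix x assume x: "x \<in> K \<inter> generate G (insert a U)"
    then obtain k :: int and u where k: "x = a [^] k \<otimes> u" "u \<in> U" using gen unfolding W_def by blast
    then have "k \<in> I" unfolding I_def using x by blast
    then obtain m where m: "k = d * m" using d(2) by blast
    obtain w where w: "w \<in> U" "b [^] m = a [^] k \<otimes> w" using bW m by blast
    have gc: "insert b (K \<inter> U) \<subseteq> carrier G" using bc Uc by blast
    note sg = generate_is_subgroup[OF gc]
    have bK: "b [^] m \<in> K" using subgroup_int_pow_closed[OF K] v(2) unfolding b_def by blast
    have bg: "b [^] m \<in> generate G (insert b (K \<inter> U))"
      using subgroup_int_pow_closed[OF sg] generate.incl[of b "insert b (K \<inter> U)" G] by blast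
    \<comment> \<open>Once the right power of \<open>b\<close> is removed from \<open>x\<close>, the
      rest lies in both \<open>K\<close> and \<open>U\<close>.\<close>
    have e: "inv w \<otimes> u = inv (b [^] m) \<otimes> x"
      unfolding w(2) k(1) using a Uc[OF w(1)] Uc[OF k(2)] by (simp add: group_word_simps)
    have "inv w \<otimes> u \<in> U" using U w k by (simp add: subgroup.m_closed subgroup.m_inv_closed)
    moreover have "inv (b [^] m) \<otimes> x \<in> K"
      using subgroup.m_closed[OF K subgroup.m_inv_closed[OF K bK]] x by blast
    ultimately have "inv (b [^] m) \<otimes> x \<in> generate G (insert b (K \<inter> U))"
      unfolding e by (intro generate.incl) blast
    from subgroup.m_closed[OF sg bg this] show "x \<in> generate G (insert b (K \<inter> U))"
      using bc k a Uc by (simp add: group_cancel)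
  qed
  then show ?thesis using v(2) unfolding b_def by blast
qed

text \<open>In an abelian group a subgroup needs no more generators than the whole. Here this is
  done relative to \<open>V\<close>: adding one generator \<open>a\<close> to \<open>S\<close> costs
  \<open>K\<close> at most one further generator.\<close>

lemma subgroup_generators_mod:
  assumes V: "V \<lhd> G" and K: "subgroup K G" and S: "finite S" "S \<subseteq> carrier G"
    and comm: "\<And>x y. x \<in> generate G (S \<union> V) \<Longrightarrow> y \<in> generate G (S \<union> V) \<Longrightarrow> commutator G x y \<in> V"
  shows "\<exists>S'\<subseteq>K. finite S' \<and> card S' \<le> card S \<and> K \<inter> generate G (S \<union> V) \<subseteq> generate G (S' \<union> (K \<inter> V))"
  using S comm
proof (induction S)
  case empty
  have "generate G V = V" by (rule generate_subgroup_self[OF normal_imp_subgroup[OF V]])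
  moreover have "K \<inter> V \<subseteq> generate G (K \<inter> V)" by (auto intro: generate.incl)
  ultimately show ?case by (intro exI[of _ "{}"]) simp
next
  case (insert a S)
  let ?U = "generate G (S \<union> V)" and ?U' = "generate G (insert a S \<union> V)"
  have Vc: "V \<subseteq> carrier G" by (rule normal_subset[OF V])
  have a: "a \<in> carrier G" and Sc: "S \<union> V \<subseteq> carrier G" "insert a S \<union> V \<subseteq> carrier G"
    using insert.prems(1) Vc by auto
  have UU: "?U \<subseteq> ?U'" by (rule mono_generate) blast
  have U': "subgroup ?U' G" by (rule generate_is_subgroup[OF Sc(2)])
  have U: "subgroup ?U G" by (rule generate_is_subgroup[OF Sc(1)])
  have VU: "V \<subseteq> ?U" by (auto intro: generate.incl)
  have "\<exists>S'\<subseteq>K. finite S' \<and> card S' \<le> card S \<and> K \<inter> ?U \<subseteq> generate G (S' \<union> (K \<inter> V))"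
    using insert.prems UU by (intro insert.IH) auto
  then obtain S' where S': "S' \<subseteq> K" "finite S'" "card S' \<le> card S" "K \<inter> ?U \<subseteq> generate G (S' \<union> (K \<inter> V))"
    by blast
  have ak: "a [^] k \<in> ?U'" for k :: int
    using subgroup_int_pow_closed[OF U'] generate.incl[of a "insert a S \<union> V" G] by blast
  have "commutator G u (a [^] k) \<in> V" if "u \<in> ?U" for u and k :: int
    using that UU ak by (intro insert.prems(2)) auto
  from subgroup_of_cyclic_extension[OF U V VU a this K]
  obtain b where b: "b \<in> K" "K \<inter> generate G (insert a ?U) \<subseteq> generate G (insert b (K \<inter> ?U))" by blast
  have "insert a S \<union> V \<subseteq> insert a ?U" by (auto intro: generate.incl)
  then have 1: "?U' \<subseteq> generate G (insert a ?U)" by (rule mono_generate)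
  let ?H = "generate G (insert b S' \<union> (K \<inter> V))"
  have Kc: "K \<subseteq> carrier G" by (rule subgroup.subset[OF K])
  have H: "subgroup ?H G" using b(1) S'(1) Kc by (intro generate_is_subgroup) blast
  have "generate G (S' \<union> (K \<inter> V)) \<subseteq> ?H" by (rule mono_generate) blast
  then have "insert b (K \<inter> ?U) \<subseteq> ?H" using S'(4) by (auto intro: generate.incl)
  then have "generate G (insert b (K \<inter> ?U)) \<subseteq> ?H" by (rule generate_subgroup_incl[OF _ H])
  then have "K \<inter> ?U' \<subseteq> ?H" using 1 b(2) by blast
  moreover have "card (insert b S') \<le> card (insert a S)"
    using S'(2,3) insert.hyps card_insert_le_m1[of "Suc (card S)"] by (simp add: card_insert_if)
  ultimately show ?case using b(1) S'(1,2) by (intro exI[of _ "insert b S'"]) auto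
qed

lemma subquotient_subgroup_generators:
  assumes U: "subgroup U G" "V \<lhd> G" "V \<subseteq> U"
    and fg: "finitely_generated (subquotient G U V)" "min_generators (subquotient G U V) \<le> d"
    and comm: "\<And>x y. x \<in> U \<Longrightarrow> y \<in> U \<Longrightarrow> commutator G x y \<in> V"
    and K: "subgroup K G"
  shows "\<exists>S\<subseteq>K. finite S \<and> card S \<le> d \<and> K \<inter> U \<subseteq> generate G (S \<union> (K \<inter> V))"
proof -
  obtain T where T: "T \<subseteq> carrier (subquotient G U V)" "finite T"
    "generate (subquotient G U V) T = carrier (subquotient G U V)" "card T = min_generators (subquotient G U V)"
    using min_generators_witness[OF fg(1)] by blast
  obtain S where S: "S \<subseteq> U" "finite S" "card S \<le> card T" "generate G (S \<union> V) = U"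
    using subquotient_generators_lift[OF U T(1-3)] by blast
  have "\<exists>S'\<subseteq>K. finite S' \<and> card S' \<le> card S \<and> K \<inter> generate G (S \<union> V) \<subseteq> generate G (S' \<union> (K \<inter> V))"
    using S comm subgroup.subset[OF U(1)] by (intro subgroup_generators_mod[OF U(2) K]) auto
  then obtain S' where "S' \<subseteq> K" "finite S'" "card S' \<le> card S" "K \<inter> U \<subseteq> generate G (S' \<union> (K \<inter> V))"
    unfolding S(4) by blast
  moreover have "card S \<le> d" using S(3) T(4) fg(2) by simp
  ultimately show ?thesis by (meson order_trans)
qed

text \<open>Generators of \<open>K\<close> are collected factor by factor. Those needed for
  \<open>K \<inter> A i\<close> modulo \<open>K \<inter> A (Suc i)\<close> are no more than those of
  the whole factor, because the factor is abelian.\<close>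

lemma subgroup_generators_chain:
  assumes U: "subgroup U G" and A: "\<And>i. A i \<lhd> G" "\<And>i. A (Suc i) \<subseteq> A i" "A 0 \<subseteq> U"
    and K: "subgroup K G" "K \<subseteq> U"
    and fg0: "finitely_generated (subquotient G U (A 0))" "min_generators (subquotient G U (A 0)) \<le> d"
    and comm0: "\<And>x y. x \<in> U \<Longrightarrow> y \<in> U \<Longrightarrow> commutator G x y \<in> A 0"
    and fg: "\<And>i. i < n \<Longrightarrow> finitely_generated (subquotient G (A i) (A (Suc i)))"
      "\<And>i. i < n \<Longrightarrow> min_generators (subquotient G (A i) (A (Suc i))) \<le> e i"
    and comm: "\<And>i x y. i < n \<Longrightarrow> x \<in> A i \<Longrightarrow> y \<in> A i \<Longrightarrow> commutator G x y \<in> A (Suc i)"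
  shows "\<exists>S\<subseteq>K. finite S \<and> card S \<le> d + (\<Sum>i<n. e i) \<and> K \<subseteq> generate G (S \<union> (K \<inter> A n))"
  using fg comm
proof (induction n)
  case 0
  show ?case
    using subquotient_subgroup_generators[OF U A(1,3) fg0 comm0 K(1)] K(2) by (simp add: Int_absorb2)
next
  case (Suc n)
  obtain S where S: "S \<subseteq> K" "finite S" "card S \<le> d + (\<Sum>i<n. e i)" "K \<subseteq> generate G (S \<union> (K \<inter> A n))"
    using Suc.IH Suc.prems by auto
  obtain T where T: "T \<subseteq> K" "finite T" "card T \<le> e n" "K \<inter> A n \<subseteq> generate G (T \<union> (K \<inter> A (Suc n)))"
    using subquotient_subgroup_generators[OF normal_imp_subgroup[OF A(1)] A(1,2) Suc.prems(1,2)[OF lessI]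
        Suc.prems(3)[OF lessI] K(1)] by blast
  let ?H = "generate G ((S \<union> T) \<union> (K \<inter> A (Suc n)))"
  have H: "subgroup ?H G"
    using S(1) T(1) subgroup.subset[OF K(1)] by (intro generate_is_subgroup) blast
  have "generate G (T \<union> (K \<inter> A (Suc n))) \<subseteq> ?H" by (rule mono_generate) blast
  then have "S \<union> (K \<inter> A n) \<subseteq> ?H" using T(4) by (auto intro: generate.incl)
  then have "K \<subseteq> ?H" using S(4) generate_subgroup_incl[OF _ H] by blast
  moreover have "card (S \<union> T) \<le> d + (\<Sum>i<Suc n. e i)"
    using card_Un_le[of S T] S(3) T(3) by simp
  ultimately show ?case using S(1,2) T(1,2) by (intro exI[of _ "S \<union> T"]) simp
qed

end

section \<open>Homomorphisms and iterated commutator subgroups\<close>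

lemma (in group) iter_comm_closed:
  "U \<subseteq> carrier G \<Longrightarrow> V \<subseteq> carrier G \<Longrightarrow> iter_comm G U V i \<subseteq> carrier G"
  by (induction i) (simp_all add: subgroup.subset[OF subgroup_comm_subgroup])

lemma (in group_hom) hom_iter_comm:
  assumes "U \<subseteq> carrier G" "V \<subseteq> carrier G"
  shows "h ` iter_comm G U V i = iter_comm H (h ` U) (h ` V) i"
  by (induction i) (simp_all add: hom_comm_subgroup G.iter_comm_closed assms)

lemma (in group_hom) hom_iter_comm_subset:
  assumes "U \<subseteq> carrier G" "h ` U \<subseteq> W"
  shows "h ` iter_comm G U (carrier G) i \<subseteq> iter_comm H W (carrier H) i"
proof (induction i)
  case (Suc i)
  have "h ` iter_comm G U (carrier G) (Suc i) =
      comm_subgroup H (h ` iter_comm G U (carrier G) i) (h ` carrier G)"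
    using hom_comm_subgroup[OF G.iter_comm_closed[OF assms(1) subset_refl] subset_refl] by simp
  also have "\<dots> \<subseteq> comm_subgroup H (iter_comm H W (carrier H) i) (carrier H)"
    using Suc.IH by (intro H.comm_subgroup_mono) auto
  finally show ?case by simp
qed (use assms in simp)

lemma (in group_hom) hom_gamma_subset: "h ` gamma G (Suc i) \<subseteq> gamma H (Suc i)"
  unfolding gamma_Suc by (intro hom_iter_comm_subset) auto

lemma (in group_hom) hom_gamma:
  "h ` carrier G = carrier H \<Longrightarrow> h ` gamma G (Suc i) = gamma H (Suc i)"
  unfolding gamma_Suc by (simp add: hom_iter_comm)

text \<open>On a generator \<open>[u, f]\<close> the discrepancy at \<open>u\<close> lies by
  induction in \<open>[R, H, ..., H]\<close> and is central modulo the next term. The discrepancy at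
  \<open>f\<close> lies in \<open>R\<close> and commutes modulo that term with
  \<open>\<beta> u\<close>. Such factors drop out of a commutator.\<close>

lemma hom_congruent_gamma:
  assumes "group_hom G H \<alpha>" "group_hom G H \<beta>" and R: "R \<lhd> H"
    and cong: "\<And>x. x \<in> carrier G \<Longrightarrow> \<alpha> x \<otimes>\<^bsub>H\<^esub> inv\<^bsub>H\<^esub> \<beta> x \<in> R"
    and x: "x \<in> gamma G (Suc i)"
  shows "\<alpha> x \<otimes>\<^bsub>H\<^esub> inv\<^bsub>H\<^esub> \<beta> x \<in> iter_comm H R (carrier H) i"
  using x
proof (induction i arbitrary: x)
  case 0
  then show ?case using cong by simp
next
  case (Suc i)
  interpret \<alpha>: group_hom G H \<alpha> by fact
  interpret \<beta>: group_hom G H \<beta> by fact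
  let ?N = "iter_comm H R (carrier H) (Suc i)"
  have N: "?N \<lhd> H" by (rule \<alpha>.H.normal_iter_comm[OF R])
  have Ns: "subgroup ?N H" by (rule normal_imp_subgroup[OF N])
  interpret p: group_hom H "H Mod ?N" "\<lambda>x. ?N #>\<^bsub>H\<^esub> x" by (rule \<alpha>.H.group_hom_rcos[OF N])
  let ?a = "\<lambda>x. ?N #>\<^bsub>H\<^esub> \<alpha> x" and ?b = "\<lambda>x. ?N #>\<^bsub>H\<^esub> \<beta> x"
  have ha: "group_hom G (H Mod ?N) ?a" and hb: "group_hom G (H Mod ?N) ?b"
    using hom_compose[OF \<alpha>.homh p.homh] hom_compose[OF \<beta>.homh p.homh]
    by (auto intro!: group_hom.intro group_hom_axioms.intro p.H.is_group simp: o_def simp del: iter_comm.simps)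
  have c: "\<alpha> x \<in> carrier H" "\<beta> x \<in> carrier H" if "x \<in> carrier G" for x using that by auto
  let ?A = "gamma G (Suc i)"
  have Ac: "?A \<subseteq> carrier G" by (rule \<alpha>.G.normal_subset[OF \<alpha>.G.normal_gamma])
  let ?Y = "{commutator G x y | x y. x \<in> ?A \<and> y \<in> carrier G}"
  have gen: "?a y = ?b y" if y: "y \<in> ?Y" for y
  proof -
    obtain u f where uf: "u \<in> ?A" "f \<in> carrier G" "y = commutator G u f" using y by blast
    have u: "u \<in> carrier G" using uf Ac by blast
    let ?n = "\<alpha> u \<otimes>\<^bsub>H\<^esub> inv\<^bsub>H\<^esub> \<beta> u" and ?r = "\<alpha> f \<otimes>\<^bsub>H\<^esub> inv\<^bsub>H\<^esub> \<beta> f"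
    have n: "?n \<in> iter_comm H R (carrier H) i" by (rule Suc.IH[OF uf(1)])
    have r: "?r \<in> R" by (rule cong[OF uf(2)])
    have nc: "?n \<in> carrier H" "?r \<in> carrier H" using c u uf by auto
    have bA: "\<beta> u \<in> gamma H (Suc i)"
      using \<beta>.hom_gamma_subset[of i] uf(1) by blast
    have central: "(?N #>\<^bsub>H\<^esub> ?n) \<otimes>\<^bsub>H Mod ?N\<^esub> (?N #>\<^bsub>H\<^esub> z) = (?N #>\<^bsub>H\<^esub> z) \<otimes>\<^bsub>H Mod ?N\<^esub> (?N #>\<^bsub>H\<^esub> ?n)"
      if "z \<in> carrier H" for z
      using \<alpha>.H.commutator_mem_iff[OF N nc(1) that] \<alpha>.H.commutator_in_comm_subgroup[OF n that] by simp
    \<comment> \<open>\<open>\<beta> u\<close> lies in \<open>gamma H (Suc i)\<close> and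
      \<open>?r\<close> in \<open>R\<close>, so the three subgroup estimate puts their commutator
      into \<open>?N\<close>.\<close>
    have comm: "(?N #>\<^bsub>H\<^esub> \<beta> u) \<otimes>\<^bsub>H Mod ?N\<^esub> (?N #>\<^bsub>H\<^esub> ?r) = (?N #>\<^bsub>H\<^esub> ?r) \<otimes>\<^bsub>H Mod ?N\<^esub> (?N #>\<^bsub>H\<^esub> \<beta> u)"
      using \<alpha>.H.commutator_mem_iff[OF N c(2)[OF u] nc(2)]
        \<alpha>.H.commutator_in_comm_subgroup[OF bA r] \<alpha>.H.comm_subgroup_normal_gamma_subset[OF R, of i] by blast
    have "\<alpha> u = ?n \<otimes>\<^bsub>H\<^esub> \<beta> u" "\<alpha> f = ?r \<otimes>\<^bsub>H\<^esub> \<beta> f"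
      using c u uf(2) by (simp_all add: \<alpha>.H.m_assoc)
    then have *: "?a u = (?N #>\<^bsub>H\<^esub> ?n) \<otimes>\<^bsub>H Mod ?N\<^esub> ?b u" "?a f = (?N #>\<^bsub>H\<^esub> ?r) \<otimes>\<^bsub>H Mod ?N\<^esub> ?b f"
      using p.hom_mult[OF nc(1) c(2)[OF u]] p.hom_mult[OF nc(2) c(2)[OF uf(2)]] by simp_all
    have "?a y = commutator (H Mod ?N) (?a u) (?a f)"
      unfolding uf(3) \<alpha>.hom_commutator[OF u uf(2)] by (rule p.hom_commutator[OF c(1)[OF u] c(1)[OF uf(2)]])
    also have "\<dots> = commutator (H Mod ?N) (?b u) (?b f)"
      unfolding *
    proof (rule p.H.commutator_congruent)
      show "(?N #>\<^bsub>H\<^esub> ?n) \<in> carrier (H Mod ?N)" by (rule p.hom_closed[OF nc(1)])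
      show "(?N #>\<^bsub>H\<^esub> ?r) \<in> carrier (H Mod ?N)" by (rule p.hom_closed[OF nc(2)])
      show "?b u \<in> carrier (H Mod ?N)" "?b f \<in> carrier (H Mod ?N)"
        using p.hom_closed c u uf(2) by blast+
      show "?b u \<otimes>\<^bsub>H Mod ?N\<^esub> (?N #>\<^bsub>H\<^esub> ?r) = (?N #>\<^bsub>H\<^esub> ?r) \<otimes>\<^bsub>H Mod ?N\<^esub> ?b u" by (rule comm)
      fix z assume "z \<in> carrier (H Mod ?N)"
      then obtain z' where "z' \<in> carrier H" "z = ?N #>\<^bsub>H\<^esub> z'" by (auto simp: carrier_FactGroup)
      then show "(?N #>\<^bsub>H\<^esub> ?n) \<otimes>\<^bsub>H Mod ?N\<^esub> z = z \<otimes>\<^bsub>H Mod ?N\<^esub> (?N #>\<^bsub>H\<^esub> ?n)"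
        using central by simp
    qed
    also have "\<dots> = ?b y"
      unfolding uf(3) \<beta>.hom_commutator[OF u uf(2)] by (rule p.hom_commutator[OF c(2)[OF u] c(2)[OF uf(2)], symmetric])
    finally show ?thesis .
  qed
  have Y: "?Y \<subseteq> carrier G" using Ac by (auto simp: subset_iff)
  have xY: "x \<in> generate G ?Y" using Suc.prems by (simp add: comm_subgroup_eq)
  have "?a x = ?b x" by (rule hom_eq_on_generate[OF ha hb Y gen xY])
  moreover have "x \<in> carrier G" using \<alpha>.G.generate_in_carrier[OF Y xY] .
  ultimately show ?case using c \<alpha>.H.rcos_eq_iff[OF Ns] by blast
qed

section \<open>Preimages of the lower central series\<close>

text \<open>Lets the cosets of a kernel be counted by the values of the homomorphism without
  building an isomorphism of quotients.\<close>

lemma card_image_eq_of_same_fibres: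
  assumes "\<And>x y. x \<in> U \<Longrightarrow> y \<in> U \<Longrightarrow> f x = f y \<longleftrightarrow> g x = g y"
  shows "card (f ` U) = card (g ` U)"
proof -
  have e: "f (inv_into U f (f x)) = f x" "inv_into U f (f x) \<in> U" if "x \<in> U" for x
    using that by (simp_all add: f_inv_into_f inv_into_into)
  then have k: "g (inv_into U f (f x)) = g x" if "x \<in> U" for x
    using that assms by blast
  have "bij_betw (\<lambda>z. g (inv_into U f z)) (f ` U) (g ` U)"
    unfolding bij_betw_def
  proof
    show "inj_on (\<lambda>z. g (inv_into U f z)) (f ` U)"
      using k assms by (intro inj_onI) (metis imageE)
    show "(\<lambda>z. g (inv_into U f z)) ` f ` U = g ` U"
      unfolding image_image using k by (intro image_cong) auto
  qed
  then show ?thesis by (rule bij_betw_same_card)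
qed

lemma gamma_2: "gamma G 2 = comm_subgroup G (carrier G) (carrier G)"
  by (simp add: numeral_2_eq_2)

lemma gamma_Suc_Suc_shift: "gamma G (Suc (Suc i)) = iter_comm G (gamma G 2) (carrier G) i"
  unfolding gamma_Suc gamma_2 by (rule iter_comm_Suc_shift)

lemma (in group) group_abelianization: "group (abelianization G)"
  unfolding abelianization_def by (rule normal.factorgroup_is_group[OF normal_gamma])

lemma (in group) subgroup_gamma: "subgroup (gamma G i) G"
  by (rule normal_imp_subgroup[OF normal_gamma])

context group_hom
begin

text \<open>The subgroup \<open>S k\<close> of the overview, for an arbitrary homomorphism
  \<open>h\<close>.\<close>

definition preimage_gamma :: "nat \<Rightarrow> 'a set" where
  "preimage_gamma k = {x \<in> carrier G. h x \<in> gamma H k}"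

lemma normal_preimage:
  assumes N: "N \<lhd> H"
  shows "{x \<in> carrier G. h x \<in> N} \<lhd> G"
proof -
  have Ns: "subgroup N H" by (rule normal_imp_subgroup[OF N])
  have "subgroup {x \<in> carrier G. h x \<in> N} G"
  proof (rule G.subgroupI)
    have "\<one> \<in> {x \<in> carrier G. h x \<in> N}" using subgroup.one_closed[OF Ns] by simp
    then show "{x \<in> carrier G. h x \<in> N} \<noteq> {}" by blast
  qed (use Ns in \<open>auto simp: subgroup.m_inv_closed subgroup.m_closed\<close>)
  then show ?thesis
    using H.normal_conj_closed[OF N] by (auto simp: G.normal_inv_iff)
qed

lemma normal_preimage_gamma: "preimage_gamma k \<lhd> G"
  unfolding preimage_gamma_def by (rule normal_preimage[OF H.normal_gamma])

lemma central_pair_preimage_gamma: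
  assumes "k \<ge> 1"
  shows "G.central_pair (preimage_gamma k) (preimage_gamma (Suc k))"
proof -
  obtain j where j: "k = Suc j" using assms by (cases k) auto
  have "comm_subgroup G (preimage_gamma k) (carrier G) \<subseteq> preimage_gamma (Suc k)"
  proof (rule G.comm_subgroup_subset[OF normal_imp_subgroup[OF normal_preimage_gamma]])
    fix x y assume xy: "x \<in> preimage_gamma k" "y \<in> carrier G"
    then have "commutator H (h x) (h y) \<in> comm_subgroup H (gamma H k) (carrier H)"
      unfolding preimage_gamma_def by (intro H.commutator_in_comm_subgroup) auto
    then show "commutator G x y \<in> preimage_gamma (Suc k)"
      using xy hom_commutator[of x y] by (simp add: preimage_gamma_def j)
  qed
  moreover have "preimage_gamma (Suc k) \<subseteq> preimage_gamma k"
    unfolding preimage_gamma_def using H.gamma_Suc_subset[of k] by blast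
  ultimately show ?thesis
    unfolding G.central_pair_def using normal_preimage_gamma by blast
qed

text \<open>As \<open>h\<close> is onto, an element of \<open>preimage_gamma 2\<close> is a kernel
  element times an element of \<open>gamma G 2\<close>. Kernel elements are handled by the three
  subgroup estimate, since the iterated commutator subgroup on the left lies in
  \<open>gamma G (Suc i)\<close>. Elements of \<open>gamma G 2\<close> vanish because
  \<open>f \<mapsto> [u, f]\<close> is additive with commuting values modulo the target.\<close>

lemma comm_iter_comm_preimage_gamma_subset:
  assumes surj: "h ` carrier G = carrier H" and m: "m \<ge> 1"
  shows "comm_subgroup G (iter_comm G (preimage_gamma m) (carrier G) i) (preimage_gamma 2)
    \<subseteq> iter_comm G (preimage_gamma (Suc m)) (carrier G) (Suc i)"
proof -
  let ?L = "iter_comm G (preimage_gamma m) (carrier G) i"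
  let ?N = "iter_comm G (preimage_gamma (Suc m)) (carrier G) i"
  let ?N' = "iter_comm G (preimage_gamma (Suc m)) (carrier G) (Suc i)"
  let ?R = "kernel G H h"
  have cp: "G.central_pair ?L ?N"
    by (rule G.central_pair_iter_comm[OF central_pair_preimage_gamma[OF m]])
  note D = G.central_pairD[OF cp]
  have N': "?N' \<lhd> G" by (rule G.normal_iter_comm[OF normal_preimage_gamma])
  have N's: "subgroup ?N' G" by (rule normal_imp_subgroup[OF N'])
  define C where "C = {g \<in> carrier G. \<forall>u\<in>?L. commutator G g u \<in> ?N'}"
  have C: "subgroup C G" unfolding C_def by (rule G.subgroup_centralizer_mod[OF N' D(5)])
  \<comment> \<open>The centralizer lemma has the varying entry first, whereas the goal has it
    second.\<close>
  have flip: "commutator G f u \<in> ?N' \<longleftrightarrow> commutator G u f \<in> ?N'" if "u \<in> ?L" "f \<in> carrier G" for u f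
  proof -
    have "u \<in> carrier G" using that D by blast
    then have "commutator G f u = inv commutator G u f" "commutator G u f = inv commutator G f u"
      using that G.inv_commutator by metis+
    then show ?thesis using subgroup.m_inv_closed[OF N's] by metis
  qed
  have Lg: "?L \<subseteq> gamma G (Suc i)"
    unfolding gamma_Suc
    by (rule G.iter_comm_mono[OF G.normal_subset[OF normal_preimage_gamma]])
  have "?R \<subseteq> C"
  proof
    fix r assume r: "r \<in> ?R"
    have "commutator G r u \<in> ?N'" if u: "u \<in> ?L" for u
    proof -
      have "commutator G u r \<in> comm_subgroup G (gamma G (Suc i)) ?R"
        using u Lg r by (intro G.commutator_in_comm_subgroup) auto
      then have "commutator G u r \<in> iter_comm G ?R (carrier G) (Suc i)"
        using G.comm_subgroup_normal_gamma_subset[OF normal_kernel] by blast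
      moreover have "?R \<subseteq> preimage_gamma (Suc m)"
        unfolding kernel_def preimage_gamma_def
        using subgroup.one_closed[OF H.subgroup_gamma, of "Suc m"] by auto
      ultimately have "commutator G u r \<in> ?N'" using G.iter_comm_mono by blast
      then show ?thesis using flip[OF u] r by (simp add: kernel_def)
    qed
    then show "r \<in> C" unfolding C_def using r by (simp add: kernel_def)
  qed
  moreover have "gamma G 2 \<subseteq> C"
    unfolding gamma_2
  proof (rule G.comm_subgroup_subset[OF C])
    fix x y assume xy: "x \<in> carrier G" "y \<in> carrier G"
    have "commutator G (commutator G x y) u \<in> ?N'" if u: "u \<in> ?L" for u
    proof -
      have uc: "u \<in> carrier G" using u D by blast
      have N'e: "comm_subgroup G ?N (carrier G) = ?N'" by simp
      note mr = G.commutator_mult_right[OF cp u, unfolded N'e]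
      let ?a = "commutator G u x" and ?b = "commutator G u y" and ?c = "commutator G u (commutator G x y)"
      have cl: "?a \<in> carrier G" "?b \<in> carrier G" "?c \<in> carrier G" using uc xy by auto
      have aN: "?a \<in> ?N" using D(4) G.commutator_in_comm_subgroup[OF u xy(1)] by blast
      have "commutator G ?a ?b \<in> ?N'"
        unfolding N'e[symmetric] by (rule G.commutator_in_comm_subgroup[OF aN cl(2)])
      then have ab: "?N' #> (?a \<otimes> ?b) = ?N' #> (?b \<otimes> ?a)"
        by (rule G.rcos_swap[OF N' cl(1,2)])
      \<comment> \<open>Expanding \<open>[u, x y]\<close> directly and through
        \<open>x y = y x [x, y]\<close> gives the same product up to the factor \<open>?c\<close>,
        which must therefore be trivial modulo \<open>?N'\<close>.\<close>
      have "?N' #> (?b \<otimes> ?a) = ?N' #> commutator G u (x \<otimes> y)"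
        using ab mr[OF xy] by simp
      also have "\<dots> = ?N' #> (commutator G u (y \<otimes> x) \<otimes> ?c)"
        using mr[of "y \<otimes> x" "commutator G x y"] xy G.mult_eq_commutator[OF xy] by simp
      also have "\<dots> = ?N' #> (?b \<otimes> ?a \<otimes> ?c)"
        using xy uc cl by (intro G.rcos_mult_cong[OF N' _ _ _ _ mr[OF xy(2,1)] refl]) auto
      finally have "(?b \<otimes> ?a \<otimes> ?c) \<otimes> inv (?b \<otimes> ?a) \<in> ?N'"
        using G.rcos_eq_iff[OF N's] cl by (metis G.m_closed)
      then have "inv (?b \<otimes> ?a) \<otimes> ((?b \<otimes> ?a \<otimes> ?c) \<otimes> inv (?b \<otimes> ?a)) \<otimes> (?b \<otimes> ?a) \<in> ?N'"
        using cl by (intro normal.inv_op_closed1[OF N']) auto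
      then have "?c \<in> ?N'" using cl by (simp add: G.group_word_simps)
      then show ?thesis using flip[OF u] xy by simp
    qed
    then show "commutator G x y \<in> C" unfolding C_def using xy by simp
  qed
  moreover have "preimage_gamma 2 \<subseteq> C"
  proof
    fix f assume f: "f \<in> preimage_gamma 2"
    then have fc: "f \<in> carrier G" "h f \<in> gamma H 2" by (auto simp: preimage_gamma_def)
    obtain g where g: "g \<in> gamma G 2" "h f = h g"
      using hom_gamma[OF surj, of 1] fc(2) unfolding Suc_1 by (metis imageE)
    have gc: "g \<in> carrier G" using g(1) subgroup.subset[OF G.subgroup_gamma] by blast
    have "f \<otimes> inv g \<in> ?R" using fc gc g(2) by (simp add: kernel_def)
    then have "f \<otimes> inv g \<otimes> g \<in> C"
      using calculation g(1) by (intro subgroup.m_closed[OF C, of "f \<otimes> inv g" g]) auto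
    then show "f \<in> C" using fc gc by (simp add: G.m_assoc)
  qed
  ultimately have C2: "preimage_gamma 2 \<subseteq> C" by blast
  show ?thesis
  proof (rule G.comm_subgroup_subset[OF N's])
    fix u f assume uf: "u \<in> ?L" "f \<in> preimage_gamma 2"
    then have "f \<in> C" using C2 by blast
    then show "commutator G u f \<in> ?N'" unfolding C_def using flip[OF uf(1)] uf(1) by blast
  qed
qed

text \<open>Passing to abelianizations loses nothing that the bracket can see. The derived subgroup
  of \<open>gamma H m\<close> lies in \<open>gamma H (Suc m)\<close>. The derived subgroup of
  \<open>H Mod gamma H m\<close> is the image of \<open>gamma H 2\<close>, which contains
  \<open>gamma H m\<close> because \<open>m \<ge> 2\<close>, so it pulls back to
  \<open>gamma H 2\<close> itself.\<close>

lemma tensor_cp1_epi: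
  assumes surj: "h ` carrier G = carrier H" and m: "m \<ge> 2"
  shows "\<exists>g. g \<in> epi (tensor_cp1 c (subgroup_generated H (gamma H m)) (H Mod gamma H m))
    (subquotient G (iter_comm G (preimage_gamma m) (carrier G) c)
      (iter_comm G (preimage_gamma (Suc m)) (carrier G) c))"
proof -
  let ?B = "subgroup_generated H (gamma H m)" and ?A = "H Mod gamma H m"
  have cB: "carrier ?B = gamma H m"
    by (rule subgroup.carrier_subgroup_generated_subgroup[OF H.subgroup_gamma])
  have gm: "gamma H m \<subseteq> carrier H" by (rule subgroup.subset[OF H.subgroup_gamma])
  interpret B: group ?B by (rule H.group_subgroup_generated)
  interpret pA: group_hom H ?A "\<lambda>x. gamma H m #>\<^bsub>H\<^esub> x" by (rule H.group_hom_rcos[OF H.normal_gamma])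
  interpret pB: group_hom ?B "?B Mod gamma ?B 2" "\<lambda>x. gamma ?B 2 #>\<^bsub>?B\<^esub> x"
    by (rule B.group_hom_rcos[OF B.normal_gamma])
  interpret qA: group_hom ?A "?A Mod gamma ?A 2" "\<lambda>x. gamma ?A 2 #>\<^bsub>?A\<^esub> x"
    by (rule pA.H.group_hom_rcos[OF pA.H.normal_gamma])
  have surjA: "(\<lambda>x. gamma H m #>\<^bsub>H\<^esub> x) ` carrier H = carrier ?A" by (simp add: carrier_FactGroup)
  interpret iB: group_hom ?B H "\<lambda>x. x"
    using gm cB by (intro group_hom.intro group_hom_axioms.intro B.is_group H.is_group homI) auto
  have m1: "1 \<le> m" using m by simp
  have gB: "gamma ?B 2 \<subseteq> gamma H (Suc m)"
  proof -
    obtain j where j: "m = Suc j" using m by (cases m) auto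
    have "gamma ?B 2 = comm_subgroup H (gamma H m) (gamma H m)"
      using iB.hom_comm_subgroup[of "carrier ?B" "carrier ?B"] cB by (simp add: gamma_2)
    also have "\<dots> \<subseteq> comm_subgroup H (gamma H m) (carrier H)"
      using gm by (intro H.comm_subgroup_mono) auto
    finally show ?thesis by (simp add: j)
  qed
  define \<alpha> where "\<alpha> = (\<lambda>u. gamma ?B 2 #>\<^bsub>?B\<^esub> h u)"
  define \<beta> where "\<beta> = (\<lambda>f. gamma ?A 2 #>\<^bsub>?A\<^esub> (gamma H m #>\<^bsub>H\<^esub> h f))"
  note cp = central_pair_preimage_gamma[OF m1]
  have hB: "h u \<in> carrier ?B" if "u \<in> preimage_gamma m" for u
    using that cB by (simp add: preimage_gamma_def)
  have pc: "u \<in> carrier G" if "u \<in> preimage_gamma k" for u k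
    using that by (simp add: preimage_gamma_def)
  have img: "h ` preimage_gamma m = carrier ?B"
    unfolding cB preimage_gamma_def using gm surj by (auto simp: image_iff)
  have "\<exists>g. g \<in> epi (tensor_power_pair (?B Mod gamma ?B 2) (?A Mod gamma ?A 2) c)
    (subquotient G (iter_comm G (preimage_gamma m) (carrier G) c)
      (iter_comm G (preimage_gamma (Suc m)) (carrier G) c))"
  proof (rule G.tensor_power_pair_epi[OF cp])
    show "group (?B Mod gamma ?B 2)" by (rule pB.H.is_group)
    show "group (?A Mod gamma ?A 2)" by (rule qA.H.is_group)
    show "\<alpha> ` preimage_gamma m = carrier (?B Mod gamma ?B 2)"
      by (simp only: \<alpha>_def carrier_FactGroup img[symmetric] image_image)
    show "\<alpha> (u \<otimes> u') = \<alpha> u \<otimes>\<^bsub>?B Mod gamma ?B 2\<^esub> \<alpha> u'"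
      if "u \<in> preimage_gamma m" "u' \<in> preimage_gamma m" for u u'
      unfolding \<alpha>_def using pB.hom_mult[OF hB[OF that(1)] hB[OF that(2)]] hom_mult[OF pc[OF that(1)] pc[OF that(2)]]
      by simp
    show "preimage_gamma (Suc m) #> u = preimage_gamma (Suc m) #> u'"
      if u: "u \<in> preimage_gamma m" "u' \<in> preimage_gamma m" and e: "\<alpha> u = \<alpha> u'" for u u'
    proof -
      have "h u \<otimes>\<^bsub>?B\<^esub> inv\<^bsub>?B\<^esub> h u' \<in> gamma ?B 2"
        using e unfolding \<alpha>_def using B.rcos_eq_iff[OF B.subgroup_gamma hB[OF u(1)] hB[OF u(2)]] by blast
      then have "h u \<otimes>\<^bsub>H\<^esub> inv\<^bsub>H\<^esub> h u' \<in> gamma H (Suc m)"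
        using gB H.inv_subgroup_generated[OF hB[OF u(2)]] by auto
      then have "u \<otimes> inv u' \<in> preimage_gamma (Suc m)"
        using pc[OF u(1)] pc[OF u(2)] by (simp add: preimage_gamma_def del: gamma.simps)
      then show ?thesis
        using G.rcos_eq_iff[OF normal_imp_subgroup[OF normal_preimage_gamma] pc[OF u(1)] pc[OF u(2)]] by blast
    qed
    show "\<beta> ` carrier G = carrier (?A Mod gamma ?A 2)"
      by (simp only: \<beta>_def carrier_FactGroup surj[symmetric] image_image)
    show "\<beta> (f \<otimes> g) = \<beta> f \<otimes>\<^bsub>?A Mod gamma ?A 2\<^esub> \<beta> g" if "f \<in> carrier G" "g \<in> carrier G" for f g
      unfolding \<beta>_def hom_mult[OF that] pA.hom_mult[OF hom_closed[OF that(1)] hom_closed[OF that(2)]]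
      using that by (intro qA.hom_mult pA.hom_closed hom_closed)
    show "f \<otimes> inv g \<in> preimage_gamma 2"
      if fg: "f \<in> carrier G" "g \<in> carrier G" and e: "\<beta> f = \<beta> g" for f g
    proof -
      let ?p = "\<lambda>x. gamma H m #>\<^bsub>H\<^esub> x"
      have c: "h f \<in> carrier H" "h g \<in> carrier H" using fg by auto
      have "?p (h f) \<otimes>\<^bsub>?A\<^esub> inv\<^bsub>?A\<^esub> ?p (h g) \<in> gamma ?A 2"
        using e unfolding \<beta>_def
        using pA.H.rcos_eq_iff[OF pA.H.subgroup_gamma pA.hom_closed[OF c(1)] pA.hom_closed[OF c(2)]] by blast
      moreover have "?p (h f) \<otimes>\<^bsub>?A\<^esub> inv\<^bsub>?A\<^esub> ?p (h g) = ?p (h f \<otimes>\<^bsub>H\<^esub> inv\<^bsub>H\<^esub> h g)"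
        using pA.hom_mult[OF c(1) H.inv_closed[OF c(2)]] pA.hom_inv[OF c(2)] by simp
      moreover have "gamma ?A 2 = ?p ` gamma H 2"
        using pA.hom_gamma[OF surjA, of 1] unfolding Suc_1 by simp
      ultimately obtain z where z: "z \<in> gamma H 2" "?p (h f \<otimes>\<^bsub>H\<^esub> inv\<^bsub>H\<^esub> h g) = ?p z" by auto
      have "h f \<otimes>\<^bsub>H\<^esub> inv\<^bsub>H\<^esub> h g \<in> gamma H 2"
        by (rule H.rcos_eq_imp_mem[OF H.subgroup_gamma H.subgroup_gamma H.gamma_antimono[OF m] _ z])
          (use c in simp)
      then show ?thesis using fg by (simp add: preimage_gamma_def)
    qed
    show "comm_subgroup G (iter_comm G (preimage_gamma m) (carrier G) i) (preimage_gamma 2)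
        \<subseteq> iter_comm G (preimage_gamma (Suc m)) (carrier G) (Suc i)" for i
      by (rule comm_iter_comm_preimage_gamma_subset[OF surj m1])
  qed
  then show ?thesis unfolding tensor_cp1_def abelianization_def .
qed

lemma order_subquotient_kernel:
  assumes U: "subgroup U G"
  shows "order (subquotient G U (kernel G H h \<inter> U)) = card (h ` U)"
proof -
  have W: "subgroup (kernel G H h \<inter> U) G" by (rule G.subgroups_Inter_pair[OF subgroup_kernel U])
  have "card ((\<lambda>x. (kernel G H h \<inter> U) #> x) ` U) = card (h ` U)"
  proof (rule card_image_eq_of_same_fibres)
    fix x y assume xy: "x \<in> U" "y \<in> U"
    have c: "x \<in> carrier G" "y \<in> carrier G" using xy subgroup.subset[OF U] by auto
    have "(kernel G H h \<inter> U) #> x = (kernel G H h \<inter> U) #> y \<longleftrightarrow> x \<otimes> inv y \<in> kernel G H h \<inter> U"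
      by (rule G.rcos_eq_iff[OF W c])
    also have "\<dots> \<longleftrightarrow> h x \<otimes>\<^bsub>H\<^esub> inv\<^bsub>H\<^esub> h y = \<one>\<^bsub>H\<^esub>"
      using xy c subgroup.m_closed[OF U _ subgroup.m_inv_closed[OF U]] by (simp add: kernel_def)
    also have "\<dots> \<longleftrightarrow> h x = h y"
      using c by (metis H.inv_closed H.inv_equality H.inv_inv H.r_inv hom_closed)
    finally show "(kernel G H h \<inter> U) #> x = (kernel G H h \<inter> U) #> y \<longleftrightarrow> h x = h y" .
  qed
  then show ?thesis by (simp add: order_def G.carrier_subquotient[OF U])
qed

end

section \<open>Comparison of the multipliers\<close>

lemma (in group_hom) finitely_generated_epi:
  assumes "h ` carrier G = carrier H" "finitely_generated G"
  shows "finitely_generated H \<and> min_generators H \<le> min_generators G"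
proof -
  obtain S where S: "S \<subseteq> carrier G" "finite S" "generate G S = carrier G" "card S = min_generators G"
    using min_generators_witness[OF assms(2)] by blast
  obtain T where T: "T \<subseteq> carrier H" "finite T" "generate H T = carrier H" "card T \<le> card S"
    using generators_image[OF assms(1) S(1-3)] by blast
  then show ?thesis
    using min_generators_le[OF T(1-3)] S(4) unfolding finitely_generated_def by auto
qed

text \<open>\<open>gamma G (Suc (Suc c)) = [gamma G 2, G, ..., G]\<close> lies in the modulus
  because \<open>gamma G 2 \<subseteq> R\<close>. So the finitely many left-normed brackets in the
  generators generate the quotient.\<close>

lemma finitely_generated_lower_central_quotient:
  assumes "group G" and X: "Y \<subseteq> carrier G" "finite Y" "generate G Y = carrier G"
    and R: "R \<lhd> G" "gamma G 2 \<subseteq> R" "iter_comm G R (carrier G) c \<subseteq> gamma G (Suc c)"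
  shows "finitely_generated (subquotient G (gamma G (Suc c)) (iter_comm G R (carrier G) c))"
proof -
  interpret group G by fact
  let ?V = "iter_comm G R (carrier G) c" and ?Z = "{iter_bracket G y fs | y fs. y \<in> Y \<and> set fs \<subseteq> Y \<and> length fs = c}"
  have cp: "central_pair (carrier G) (gamma G 2)"
    unfolding central_pair_def using normal_self normal_gamma[of 2] normal_subset[OF normal_gamma[of 2]]
    by (simp add: gamma_2)
  have Y: "generate G (Y \<union> gamma G 2) = carrier G"
  proof
    show "generate G (Y \<union> gamma G 2) \<subseteq> carrier G"
      using X normal_subset[OF normal_gamma] by (intro generate_incl) auto
    have "generate G Y \<subseteq> generate G (Y \<union> gamma G 2)" by (rule mono_generate) blast
    then show "carrier G \<subseteq> generate G (Y \<union> gamma G 2)" using X(3) by simp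
  qed
  have gen: "generate G (?Z \<union> iter_comm G (gamma G 2) (carrier G) c) = gamma G (Suc c)"
    using generate_eq_iter_comm[OF cp X(1) Y X(1,3), of c] unfolding gamma_Suc .
  have ZU: "?Z \<subseteq> gamma G (Suc c)"
    unfolding gen[symmetric] by (auto intro: generate.incl)
  have "generate G (?Z \<union> ?V) = gamma G (Suc c)"
  proof
    show "generate G (?Z \<union> ?V) \<subseteq> gamma G (Suc c)"
      using ZU R(3) by (intro generate_subgroup_incl subgroup_gamma) blast
    have "iter_comm G (gamma G 2) (carrier G) c \<subseteq> ?V" by (rule iter_comm_mono[OF R(2)])
    then show "gamma G (Suc c) \<subseteq> generate G (?Z \<union> ?V)"
      unfolding gen[symmetric] by (intro mono_generate) blast
  qed
  moreover have "finite ?Z"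
  proof (rule finite_subset)
    show "?Z \<subseteq> (\<lambda>(y, fs). iter_bracket G y fs) ` (Y \<times> {fs. set fs \<subseteq> Y \<and> length fs = c})" by auto
    show "finite ((\<lambda>(y, fs). iter_bracket G y fs) ` (Y \<times> {fs. set fs \<subseteq> Y \<and> length fs = c}))"
      using finite_lists_length_eq[OF X(2)] X(2) by blast
  qed
  ultimately show ?thesis
    using subquotient_generators[OF subgroup_gamma normal_iter_comm[OF R(1)] R(3) ZU] by blast
qed

text \<open>The homomorphism induced by \<open>\<psi>\<close> is onto because \<open>\<psi> (\<phi> x)\<close> agrees with \<open>x\<close> on \<open>gamma F (Suc c)\<close>
  modulo \<open>iter_comm F S (carrier F) c\<close>.\<close>
lemma multiplier_epi_of_lifts:
  assumes \<phi>: "group_hom F F' \<phi>" and \<psi>: "group_hom F' F \<psi>"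
    and R: "R \<lhd> F'" "gamma F' (Suc c) \<subseteq> R" and S: "S \<lhd> F" "\<psi> ` R \<subseteq> S"
    and cong: "\<And>x. x \<in> carrier F \<Longrightarrow> \<psi> (\<phi> x) \<otimes>\<^bsub>F\<^esub> inv\<^bsub>F\<^esub> x \<in> S"
  shows "\<exists>h. group_hom (subquotient F' (R \<inter> gamma F' (Suc c)) (iter_comm F' R (carrier F') c))
      (subquotient F (gamma F (Suc c)) (iter_comm F S (carrier F) c)) h \<and>
    h ` carrier (subquotient F' (R \<inter> gamma F' (Suc c)) (iter_comm F' R (carrier F') c)) =
      carrier (subquotient F (gamma F (Suc c)) (iter_comm F S (carrier F) c))"
proof -
  interpret \<phi>: group_hom F F' \<phi> by fact
  interpret \<psi>: group_hom F' F \<psi> by fact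
  have RU: "R \<inter> gamma F' (Suc c) = gamma F' (Suc c)" using R by blast
  let ?U' = "gamma F' (Suc c)" and ?V' = "iter_comm F' R (carrier F') c"
  let ?U = "gamma F (Suc c)" and ?V = "iter_comm F S (carrier F) c"
  let ?Q = "subquotient F ?U ?V"
  have U': "subgroup ?U' F'" and U: "subgroup ?U F"
    by (rule \<phi>.H.subgroup_gamma, rule \<phi>.G.subgroup_gamma)
  have V': "?V' \<lhd> F'" "?V' \<subseteq> ?U'"
    using \<phi>.H.normal_iter_comm[OF R(1)] \<phi>.H.iter_comm_mono[OF \<phi>.H.normal_subset[OF R(1)]]
    unfolding gamma_Suc by blast+
  have V: "?V \<lhd> F" "?V \<subseteq> ?U"
    using \<phi>.G.normal_iter_comm[OF S(1)] \<phi>.G.iter_comm_mono[OF \<phi>.G.normal_subset[OF S(1)]]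
    unfolding gamma_Suc by blast+
  have cU': "carrier (subgroup_generated F' ?U') = ?U'"
    by (rule subgroup.carrier_subgroup_generated_subgroup[OF U'])
  have \<psi>U: "\<psi> x \<in> ?U" if "x \<in> ?U'" for x using \<psi>.hom_gamma_subset[of c] that by blast
  have U'c: "?U' \<subseteq> carrier F'" and Uc: "?U \<subseteq> carrier F"
    by (rule subgroup.subset[OF U'], rule subgroup.subset[OF U])
  let ?f = "\<lambda>x. ?V #>\<^bsub>F\<^esub> \<psi> x"
  have hom: "?f \<in> hom (subgroup_generated F' ?U') ?Q"
  proof (rule homI)
    show "?f x \<in> carrier ?Q" if "x \<in> carrier (subgroup_generated F' ?U')" for x
      using that \<psi>U unfolding cU' \<phi>.G.carrier_subquotient[OF U] by blast
    show "?f (x \<otimes>\<^bsub>subgroup_generated F' ?U'\<^esub> y) = ?f x \<otimes>\<^bsub>?Q\<^esub> ?f y"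
      if "x \<in> carrier (subgroup_generated F' ?U')" "y \<in> carrier (subgroup_generated F' ?U')" for x y
    proof -
      have c: "x \<in> carrier F'" "y \<in> carrier F'" using that U'c unfolding cU' by blast+
      show ?thesis
        using \<psi>.hom_mult[OF c] \<phi>.G.mult_subquotient[OF V(1) \<psi>.hom_closed[OF c(1)] \<psi>.hom_closed[OF c(2)], of ?U]
        by simp
    qed
  qed
  interpret f: group_hom "subgroup_generated F' ?U'" ?Q ?f
    by (intro group_hom.intro group_hom_axioms.intro \<phi>.H.group_subgroup_generated
        \<phi>.G.group_subquotient[OF U V] hom)
  have "?V' \<subseteq> kernel (subgroup_generated F' ?U') ?Q ?f"
  proof
    fix x assume x: "x \<in> ?V'"
    have "\<psi> x \<in> ?V" using \<psi>.hom_iter_comm_subset[OF \<phi>.H.normal_subset[OF R(1)] S(2), of c] x by blast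
    then have "?f x = ?V"
      using \<phi>.G.rcos_eq_self_iff[OF normal_imp_subgroup[OF V(1)]] V(2) Uc by blast
    then show "x \<in> kernel (subgroup_generated F' ?U') ?Q ?f"
      using x V'(2) unfolding kernel_def cU' by auto
  qed
  then obtain h where h: "h \<in> hom (subquotient F' ?U' ?V') ?Q" "\<And>x. x \<in> ?U' \<Longrightarrow> h (?V' #>\<^bsub>F'\<^esub> x) = ?f x"
    using f.FactGroup_universal_kernel[OF \<phi>.H.normal_subgroup_generated[OF U' V']]
    unfolding cU' \<phi>.H.rcos_subgroup_generated by blast
  have "h ` carrier (subquotient F' ?U' ?V') = ?f ` ?U'"
    unfolding \<phi>.H.carrier_subquotient[OF U'] image_image using h(2) by (intro image_cong) auto
  also have "\<dots> = carrier ?Q"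
  proof
    show "?f ` ?U' \<subseteq> carrier ?Q" using hom_carrier[OF hom] unfolding cU' .
    show "carrier ?Q \<subseteq> ?f ` ?U'"
      unfolding \<phi>.G.carrier_subquotient[OF U]
    proof
      fix z assume "z \<in> (\<lambda>x. ?V #>\<^bsub>F\<^esub> x) ` ?U"
      then obtain x where x: "x \<in> ?U" "z = ?V #>\<^bsub>F\<^esub> x" by blast
      have idh: "group_hom F F (\<lambda>x. x)"
        by (intro group_hom.intro group_hom_axioms.intro \<phi>.G.is_group homI) auto
      have comp: "group_hom F F (\<lambda>x. \<psi> (\<phi> x))"
        using hom_compose[OF \<phi>.homh \<psi>.homh]
        by (intro group_hom.intro group_hom_axioms.intro \<phi>.G.is_group) (simp add: o_def)
      have "\<psi> (\<phi> x) \<otimes>\<^bsub>F\<^esub> inv\<^bsub>F\<^esub> x \<in> ?V"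
        by (rule hom_congruent_gamma[OF comp idh S(1) cong x(1)])
      moreover have xc: "x \<in> carrier F" using x(1) Uc by blast
      moreover have "\<psi> (\<phi> x) \<in> carrier F" using xc by simp
      ultimately have "?f (\<phi> x) = z"
        unfolding x(2) using \<phi>.G.rcos_eq_iff[OF normal_imp_subgroup[OF V(1)]] by blast
      moreover have "\<phi> x \<in> ?U'" using \<phi>.hom_gamma_subset[of c] x(1) by blast
      ultimately show "z \<in> ?f ` ?U'" by blast
    qed
  qed
  finally have "h ` carrier (subquotient F' ?U' ?V') = carrier ?Q" .
  moreover have "group_hom (subquotient F' ?U' ?V') ?Q h"
    by (intro group_hom.intro group_hom_axioms.intro \<phi>.H.group_subquotient[OF U' V'] f.H.is_group h(1))
  ultimately show ?thesis unfolding RU by blast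
qed

section \<open>The canonical presentation and the multiplier of \<open>G/G'\<close>\<close>

lemma group_hom_word_eval: "group G \<Longrightarrow> group_hom (free_group (carrier G)) G (word_eval G)"
  using group.group_hom_word_lift[of G "\<lambda>x. x" "carrier G"] by (simp add: word_lift_ident)

lemma word_eval_letter: "group G \<Longrightarrow> x \<in> carrier G \<Longrightarrow> word_eval G [(True, x)] = x"
  by (simp add: group.is_monoid)

lemma word_eval_surj: "group G \<Longrightarrow> word_eval G ` carrier (free_group (carrier G)) = carrier G"
proof
  assume G: "group G"
  interpret E: group_hom "free_group (carrier G)" G "word_eval G" by (rule group_hom_word_eval[OF G])
  show "word_eval G ` carrier (free_group (carrier G)) \<subseteq> carrier G" by auto
  show "carrier G \<subseteq> word_eval G ` carrier (free_group (carrier G))"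
    using word_eval_letter[OF G, symmetric] letter_in_free_group by (intro subsetI image_eqI)
qed

lemma c_nilpotent_multiplier_eq:
  "c_nilpotent_multiplier c G = subquotient (free_group (carrier G))
    (kernel (free_group (carrier G)) G (word_eval G) \<inter> gamma (free_group (carrier G)) (Suc c))
    (iter_comm (free_group (carrier G)) (kernel (free_group (carrier G)) G (word_eval G))
      (carrier (free_group (carrier G))) c)"
  by (simp add: c_nilpotent_multiplier_def Let_def)

text \<open>\<open>S\<close> is the kernel of the composite of \<open>word_eval G\<close> with the
  projection to \<open>G/G'\<close>, so \<open>F\<close> and the free group on \<open>G/G'\<close>
  both present \<open>G/G'\<close>. Sending letters to the letters of their cosets, and back to the
  letters of chosen representatives, gives homomorphisms that lift the identity of
  \<open>G/G'\<close>. Finite generation is recorded for the bound on \<open>d\<close>.\<close>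

lemma abelian_multiplier_epi:
  fixes G (structure)
  assumes G: "group G" "finite (carrier G)" and c: "c \<ge> 1"
  defines "F \<equiv> free_group (carrier G)"
  defines "S \<equiv> {x \<in> carrier F. word_eval G x \<in> gamma G 2}"
  shows "finitely_generated (c_nilpotent_multiplier c (G Mod gamma G 2))"
    and "\<exists>h. group_hom (c_nilpotent_multiplier c (G Mod gamma G 2))
      (subquotient F (gamma F (Suc c)) (iter_comm F S (carrier F) c)) h \<and>
      h ` carrier (c_nilpotent_multiplier c (G Mod gamma G 2)) =
      carrier (subquotient F (gamma F (Suc c)) (iter_comm F S (carrier F) c))"
proof -
  let ?A = "G Mod gamma G 2"
  let ?p = "\<lambda>x. gamma G 2 #> x"
  define F' where "F' = free_group (carrier ?A)"
  define R where "R = kernel F' ?A (word_eval ?A)"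
  interpret G: group G by fact
  interpret p: group_hom G ?A ?p by (rule G.group_hom_rcos[OF G.normal_gamma])
  have psurj: "?p ` carrier G = carrier ?A" by (simp add: carrier_FactGroup)
  interpret E: group_hom F G "word_eval G" unfolding F_def by (rule group_hom_word_eval[OF G(1)])
  interpret E': group_hom F' ?A "word_eval ?A" unfolding F'_def by (rule group_hom_word_eval[OF p.H.is_group])
  have R: "R \<lhd> F'" unfolding R_def by (rule E'.normal_kernel)
  have S: "S \<lhd> F" unfolding S_def by (rule E.normal_preimage[OF G.normal_gamma])
  have mem_S: "x \<in> S \<longleftrightarrow> ?p (word_eval G x) = \<one>\<^bsub>?A\<^esub>" if "x \<in> carrier F" for x
    using that G.rcos_eq_self_iff[OF G.subgroup_gamma E.hom_closed[OF that], of 2] unfolding S_def by simp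
  have "gamma ?A 2 = ?p ` gamma G 2" using p.hom_gamma[OF psurj, of 1] unfolding Suc_1 by simp
  also have "\<dots> \<subseteq> {\<one>\<^bsub>?A\<^esub>}"
    using G.rcos_eq_self_iff[OF G.subgroup_gamma] subgroup.subset[OF G.subgroup_gamma] by auto
  finally have triv: "gamma ?A 2 \<subseteq> {\<one>\<^bsub>?A\<^esub>}" .
  have g2: "gamma F' 2 \<subseteq> R"
  proof
    fix x assume x: "x \<in> gamma F' 2"
    have "word_eval ?A x \<in> gamma ?A 2" using E'.hom_gamma_subset[of 1] x unfolding Suc_1 by blast
    then show "x \<in> R"
      using x triv subgroup.subset[OF E'.G.subgroup_gamma] unfolding R_def kernel_def by blast
  qed
  \<comment> \<open>With \<open>c \<ge> 1\<close> and \<open>G/G'\<close> abelian, all of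
    \<open>gamma F' (Suc c)\<close> consists of relators, so the intersection in the definition of
    the multiplier disappears.\<close>
  have gR: "gamma F' (Suc c) \<subseteq> R"
    using E'.G.gamma_antimono[of 2 "Suc c"] c g2 by auto
  have RU: "R \<inter> gamma F' (Suc c) = gamma F' (Suc c)" using gR by blast
  have VU: "iter_comm F' R (carrier F') c \<subseteq> gamma F' (Suc c)"
    unfolding gamma_Suc by (rule E'.G.iter_comm_mono[OF E'.G.normal_subset[OF R]])
  have M: "c_nilpotent_multiplier c ?A = subquotient F' (R \<inter> gamma F' (Suc c)) (iter_comm F' R (carrier F') c)"
    unfolding c_nilpotent_multiplier_eq R_def F'_def ..
  let ?Y = "(\<lambda>x. [(True, x)]) ` carrier ?A"
  have Y: "?Y \<subseteq> carrier F'" "generate F' ?Y = carrier F'"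
    unfolding F'_def by (intro image_subsetI letter_in_free_group, assumption) (rule generate_letters)
  have "finite ?Y" unfolding carrier_FactGroup using G(2) by (intro finite_imageI)
  then show "finitely_generated (c_nilpotent_multiplier c ?A)"
    unfolding M RU using finitely_generated_lower_central_quotient[OF E'.G.is_group Y(1) _ Y(2) R g2 VU] by blast
  define \<phi> where "\<phi> = word_lift F' (\<lambda>x. [(True, ?p x)])"
  define \<psi> where "\<psi> = word_lift F (\<lambda>y. [(True, inv_into (carrier G) ?p y)])"
  have inv: "inv_into (carrier G) ?p y \<in> carrier G" "?p (inv_into (carrier G) ?p y) = y" if "y \<in> carrier ?A" for y
    using that unfolding psurj[symmetric] by (rule inv_into_into, rule f_inv_into_f)
  have f1: "(\<lambda>x. [(True, ?p x)]) ` carrier G \<subseteq> carrier F'"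
    unfolding F'_def by (intro image_subsetI letter_in_free_group p.hom_closed)
  have f2: "(\<lambda>y. [(True, inv_into (carrier G) ?p y)]) ` carrier ?A \<subseteq> carrier F"
    unfolding F_def by (intro image_subsetI letter_in_free_group inv(1))
  interpret \<phi>: group_hom F F' \<phi>
    unfolding \<phi>_def F_def by (rule E'.G.group_hom_word_lift[OF f1])
  interpret \<psi>: group_hom F' F \<psi>
    unfolding \<psi>_def F'_def by (rule E.G.group_hom_word_lift[OF f2])
  have pE: "group_hom F ?A (\<lambda>x. ?p (word_eval G x))"
    using hom_compose[OF E.homh p.homh]
    by (intro group_hom.intro group_hom_axioms.intro E.G.is_group p.H.is_group) (simp add: o_def)
  \<comment> \<open>Both sides are homomorphisms on a free group, so comparing them on letters is
    enough.\<close>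
  have 1: "word_eval ?A (\<phi> x) = ?p (word_eval G x)" if "x \<in> carrier F" for x
  proof (rule free_group_hom_eq[OF _ pE[unfolded F_def] _ that[unfolded F_def]])
    show "group_hom (free_group (carrier G)) ?A (\<lambda>x. word_eval ?A (\<phi> x))"
      using hom_compose[OF \<phi>.homh E'.homh] unfolding F_def
      by (intro group_hom.intro group_hom_axioms.intro group_free_group p.H.is_group) (simp add: o_def)
    fix g assume g: "g \<in> carrier G"
    have "\<phi> [(True, g)] = [(True, ?p g)]"
      unfolding \<phi>_def by (rule E'.G.word_lift_letter[OF g f1])
    then show "word_eval ?A (\<phi> [(True, g)]) = ?p (word_eval G [(True, g)])"
      unfolding word_eval_letter[OF G(1) g] using word_eval_letter[OF p.H.is_group p.hom_closed[OF g]] by simp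
  qed
  have 2: "?p (word_eval G (\<psi> y)) = word_eval ?A y" if "y \<in> carrier F'" for y
  proof (rule free_group_hom_eq[OF _ E'.group_hom_axioms[unfolded F'_def] _ that[unfolded F'_def]])
    interpret pE: group_hom F ?A "\<lambda>x. ?p (word_eval G x)" by (rule pE)
    show "group_hom (free_group (carrier ?A)) ?A (\<lambda>y. ?p (word_eval G (\<psi> y)))"
      using hom_compose[OF \<psi>.homh pE.homh] unfolding F'_def
      by (intro group_hom.intro group_hom_axioms.intro group_free_group p.H.is_group) (simp add: o_def)
    fix z assume z: "z \<in> carrier ?A"
    have "\<psi> [(True, z)] = [(True, inv_into (carrier G) ?p z)]"
      unfolding \<psi>_def by (rule E.G.word_lift_letter[OF z f2])
    then show "?p (word_eval G (\<psi> [(True, z)])) = word_eval ?A [(True, z)]"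
      unfolding word_eval_letter[OF p.H.is_group z]
      using word_eval_letter[OF G(1) inv(1)[OF z]] inv(2)[OF z] by simp
  qed
  have "\<psi> ` R \<subseteq> S"
  proof
    fix w assume "w \<in> \<psi> ` R"
    then obtain y where y: "y \<in> R" "w = \<psi> y" by blast
    then have yc: "y \<in> carrier F'" "word_eval ?A y = \<one>\<^bsub>?A\<^esub>" unfolding R_def kernel_def by blast+
    show "w \<in> S" unfolding y(2) mem_S[OF \<psi>.hom_closed[OF yc(1)]] 2[OF yc(1)] by (rule yc(2))
  qed
  moreover have "\<psi> (\<phi> x) \<otimes>\<^bsub>F\<^esub> inv\<^bsub>F\<^esub> x \<in> S" if x: "x \<in> carrier F" for x
  proof -
    interpret pE: group_hom F ?A "\<lambda>x. ?p (word_eval G x)" by (rule pE)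
    have c: "\<psi> (\<phi> x) \<in> carrier F" "inv\<^bsub>F\<^esub> x \<in> carrier F" using x by simp_all
    have "?p (word_eval G (\<psi> (\<phi> x))) = ?p (word_eval G x)"
      using 1[OF x] 2[OF \<phi>.hom_closed[OF x]] by simp
    then have "?p (word_eval G (\<psi> (\<phi> x) \<otimes>\<^bsub>F\<^esub> inv\<^bsub>F\<^esub> x)) = \<one>\<^bsub>?A\<^esub>"
      using pE.hom_mult[OF c] pE.hom_inv[OF x] p.H.r_inv[OF pE.hom_closed[OF x]] by simp
    then show ?thesis using mem_S[of "\<psi> (\<phi> x) \<otimes>\<^bsub>F\<^esub> inv\<^bsub>F\<^esub> x"] c E.G.m_closed by blast
  qed
  ultimately show "\<exists>h. group_hom (c_nilpotent_multiplier c ?A)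
      (subquotient F (gamma F (Suc c)) (iter_comm F S (carrier F) c)) h \<and>
      h ` carrier (c_nilpotent_multiplier c ?A) =
      carrier (subquotient F (gamma F (Suc c)) (iter_comm F S (carrier F) c))"
    unfolding M
    by (intro multiplier_epi_of_lifts[OF \<phi>.group_hom_axioms \<psi>.group_hom_axioms R gR S])
qed

section \<open>The chain of subgroups and the three bounds\<close>

theorem theoremB:
  fixes G :: "('a, 'b) monoid_scheme" and c t :: nat
  assumes "group G" and "finite (carrier G)"
    and "c \<ge> 1" and "t \<ge> 1" and "nilpotent_of_class G t"
  defines "T \<equiv> \<lambda>k. tensor_cp1 c (subgroup_generated G (gamma G (k + 1))) (G Mod gamma G (k + 1))"
    and "Gab \<equiv> G Mod gamma G 2"
  shows "(card (gamma G (c + 1)) * order (c_nilpotent_multiplier c G)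
           dvd order (c_nilpotent_multiplier c Gab) * (\<Prod>k\<in>{1..t - 1}. order (T k)))
         \<and> (group_exponent (c_nilpotent_multiplier c G)
           dvd group_exponent (c_nilpotent_multiplier c Gab) * (\<Prod>k\<in>{1..t - 1}. group_exponent (T k)))
         \<and> (min_generators (c_nilpotent_multiplier c G)
           \<le> min_generators (c_nilpotent_multiplier c Gab) + (\<Sum>k\<in>{1..t - 1}. min_generators (T k)))"
proof -
  interpret G: group G by fact
  define F where "F = free_group (carrier G)"
  interpret E: group_hom F G "word_eval G" unfolding F_def by (rule group_hom_word_eval[OF assms(1)])
  have surj: "word_eval G ` carrier F = carrier G" unfolding F_def by (rule word_eval_surj[OF assms(1)])
  \<comment> \<open>Shifted by two: \<open>A i\<close> is the term \<open>A (i + 2)\<close> of the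
    overview, so the chain starts at index 0 and ends at \<open>n = t - 1\<close>.\<close>
  define A where "A i = iter_comm F (E.preimage_gamma (i + 2)) (carrier F) c" for i
  define U where "U = gamma F (Suc c)"
  define R where "R = kernel F G (word_eval G)"
  define n where "n = t - 1"
  have R: "R \<lhd> F" unfolding R_def by (rule E.normal_kernel)
  have U: "subgroup U F" and Un: "U \<lhd> F" unfolding U_def by (rule E.G.subgroup_gamma, rule E.G.normal_gamma)
  have A: "A i \<lhd> F" for i unfolding A_def by (rule E.G.normal_iter_comm[OF E.normal_preimage_gamma])
  have cp: "E.G.central_pair (A i) (A (Suc i))" for i
    unfolding A_def using E.G.central_pair_iter_comm[OF E.central_pair_preimage_gamma[of "i + 2"]] by simp
  have A_sub: "A (Suc i) \<subseteq> A i" for i by (rule E.G.central_pairD(3)[OF cp])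
  have A_comm: "commutator F x y \<in> A (Suc i)" if "x \<in> A i" "y \<in> A i" for i x y
    using E.G.central_pairD(4,5)[OF cp] E.G.commutator_in_comm_subgroup[of x "A i" y "carrier F"] that by blast
  have AU: "A 0 \<subseteq> U"
    unfolding A_def U_def gamma_Suc by (rule E.G.iter_comm_mono[OF E.G.normal_subset[OF E.normal_preimage_gamma]])
  \<comment> \<open>Since \<open>n + 2 = Suc t\<close>, the last preimage is that of the trivial
    subgroup, which is the kernel \<open>R\<close>.\<close>
  have A_n: "A n = iter_comm F R (carrier F) c"
  proof -
    have "gamma G (Suc t) = {\<one>\<^bsub>G\<^esub>}" using assms(5) unfolding nilpotent_of_class_def by blast
    moreover have "n + 2 = Suc t" unfolding n_def using assms(4) by simp
    ultimately show ?thesis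
      unfolding A_def E.preimage_gamma_def R_def kernel_def by simp
  qed
  \<comment> \<open>Such commutators lie in \<open>gamma F (c + 2)\<close>. Moving the extra
    commutator to the front rewrites this as \<open>[gamma F 2, F, ..., F]\<close> with
    \<open>c\<close> copies of \<open>F\<close>, and \<open>gamma F 2\<close> lies in the preimage
    of \<open>gamma G 2\<close>.\<close>
  have U_comm: "commutator F x y \<in> A 0" if "x \<in> U" "y \<in> U" for x y
  proof -
    have "commutator F x y \<in> gamma F (Suc (Suc c))"
      using that E.G.commutator_in_comm_subgroup[of x U y "carrier F"] subgroup.subset[OF U] unfolding U_def by auto
    moreover have "gamma F 2 \<subseteq> E.preimage_gamma 2"
      using E.hom_gamma_subset[of 1] subgroup.subset[OF E.G.subgroup_gamma]
      unfolding E.preimage_gamma_def Suc_1 by blast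
    ultimately show ?thesis
      using E.G.iter_comm_mono[of "gamma F 2" "E.preimage_gamma 2" "carrier F" c]
      unfolding gamma_Suc_Suc_shift A_def add_0 by blast
  qed
  have RU: "subgroup (R \<inter> U) F" "R \<inter> U \<lhd> F" "R \<inter> U \<subseteq> U"
    using R Un by (auto intro: E.G.subgroups_Inter_pair normal_imp_subgroup E.G.normal_subgroup_intersect)
  have A_RU: "A n \<subseteq> R \<inter> U"
  proof
    fix x assume x: "x \<in> A n"
    have "A n \<subseteq> A 0" using A_sub by (rule lift_Suc_antimono_le) simp
    moreover have "iter_comm F R (carrier F) i \<subseteq> R" for i
      by (induction i) (use E.G.comm_subgroup_le_left[OF E.G.normal_iter_comm[OF R] subset_refl] in auto)
    ultimately show "x \<in> R \<inter> U" using AU x unfolding A_n by blast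
  qed
  have M: "c_nilpotent_multiplier c G = subquotient F (R \<inter> U) (A n)"
    unfolding c_nilpotent_multiplier_eq A_n unfolding F_def R_def U_def ..
  have A0: "A 0 = iter_comm F {x \<in> carrier F. word_eval G x \<in> gamma G 2} (carrier F) c"
    unfolding A_def E.preimage_gamma_def add_0 ..
  have fgab: "finitely_generated (c_nilpotent_multiplier c Gab)"
    unfolding Gab_def by (rule abelian_multiplier_epi(1)[OF assms(1-3)])
  obtain q where q: "group_hom (c_nilpotent_multiplier c Gab) (subquotient F U (A 0)) q"
    "q ` carrier (c_nilpotent_multiplier c Gab) = carrier (subquotient F U (A 0))"
    using abelian_multiplier_epi(2)[OF assms(1-3)] unfolding Gab_def U_def A0 F_def by blast
  interpret q: group_hom "c_nilpotent_multiplier c Gab" "subquotient F U (A 0)" q by (rule q(1))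
  have TS: "T (Suc i) = tensor_cp1 c (subgroup_generated G (gamma G (i + 2))) (G Mod gamma G (i + 2))" for i
    unfolding T_def by simp
  have "\<exists>g. g \<in> epi (T (Suc i)) (subquotient F (A i) (A (Suc i)))" for i
    using E.tensor_cp1_epi[OF surj, of "i + 2" c] unfolding TS A_def by simp
  then obtain g where g: "g i \<in> epi (T (Suc i)) (subquotient F (A i) (A (Suc i)))" for i by metis
  have grT: "group (abelianization (subgroup_generated G (gamma G k)))" "group (abelianization (G Mod gamma G k))" for k
    by (rule group.group_abelianization[OF G.group_subgroup_generated],
        rule group.group_abelianization[OF normal.factorgroup_is_group[OF G.normal_gamma]])
  have T_group: "group (T (Suc i))" for i
    using group_tensor_power_pair(1)[OF grT] unfolding TS tensor_cp1_def by (rule comm_group.axioms(2))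
  have T_fg: "finitely_generated (T (Suc i))" for i
  proof -
    have "finite (carrier (subgroup_generated G (gamma G (i + 2))))"
      using assms(2) G.carrier_subgroup_generated_subset by (rule rev_finite_subset)
    then have "finite (carrier (abelianization (subgroup_generated G (gamma G (i + 2)))))"
      unfolding abelianization_def by (simp add: carrier_FactGroup)
    moreover have "finite (carrier (abelianization (G Mod gamma G (i + 2))))"
      using assms(2) unfolding abelianization_def by (simp add: carrier_FactGroup)
    ultimately show ?thesis
      unfolding finitely_generated_def TS tensor_cp1_def
      by (intro finitely_generated_tensor_power_pair grT)
  qed
  have gh: "group_hom (T (Suc i)) (subquotient F (A i) (A (Suc i))) (g i)"
    "g i ` carrier (T (Suc i)) = carrier (subquotient F (A i) (A (Suc i)))" for i
    using g[of i] T_group E.G.group_subquotient[OF normal_imp_subgroup[OF A] A A_sub]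
    unfolding epi_def by (auto intro!: group_hom.intro group_hom_axioms.intro)
  \<comment> \<open>\<open>U / A n\<close> is split at \<open>R \<inter> U\<close>: the upper factor
    has as many elements as \<open>gamma G (c + 1)\<close>, the image of \<open>U\<close>, and the
    lower factor is the multiplier.\<close>
  have "card (gamma G (c + 1)) * order (c_nilpotent_multiplier c G) = order (subquotient F U (A n))"
  proof -
    have "order (subquotient F U (R \<inter> U)) = card (gamma G (c + 1))"
      using E.order_subquotient_kernel[OF U] E.hom_gamma[OF surj, of c] unfolding R_def U_def by simp
    then show ?thesis
      using E.G.order_subquotient[OF U A RU(2) A_RU RU(3)] unfolding M by simp
  qed
  also have "\<dots> = order (subquotient F U (A 0)) * (\<Prod>i<n. order (subquotient F (A i) (A (Suc i))))"
    by (rule E.G.order_subquotient_chain[OF U A A_sub AU])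
  also have "\<dots> dvd order (c_nilpotent_multiplier c Gab) * (\<Prod>i<n. order (T (Suc i)))"
    using q.order_dvd[OF q(2)] group_hom.order_dvd[OF gh] by (intro mult_dvd_mono prod_dvd_prod) auto
  finally have i: "card (gamma G (c + 1)) * order (c_nilpotent_multiplier c G)
      dvd order (c_nilpotent_multiplier c Gab) * (\<Prod>i<n. order (T (Suc i)))" .
  let ?e = "group_exponent (subquotient F U (A 0)) * (\<Prod>i<n. group_exponent (subquotient F (A i) (A (Suc i))))"
  interpret M: group "subquotient F (R \<inter> U) (A n)"
    by (rule E.G.group_subquotient[OF RU(1) A A_RU])
  \<comment> \<open>The multiplier is the subgroup \<open>(R \<inter> U) / A n\<close> of
    \<open>U / A n\<close>, so powers of its elements may be followed down the chain below
    \<open>U\<close>.\<close>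
  have "group_exponent (c_nilpotent_multiplier c G) dvd ?e"
    unfolding M
  proof (rule M.group_exponent_dvd)
    fix z assume "z \<in> carrier (subquotient F (R \<inter> U) (A n))"
    then obtain x where x: "x \<in> R \<inter> U" "z = A n #>\<^bsub>F\<^esub> x"
      unfolding E.G.carrier_subquotient[OF RU(1)] by blast
    show "z [^]\<^bsub>subquotient F (R \<inter> U) (A n)\<^esub> ?e = \<one>\<^bsub>subquotient F (R \<inter> U) (A n)\<^esub>"
      unfolding x(2) E.G.subquotient_pow_eq_one_iff[OF RU(1) A A_RU x(1)]
      using x(1) by (intro E.G.pow_exponent_chain[OF U A A_sub AU]) blast
  qed
  also have "?e dvd group_exponent (c_nilpotent_multiplier c Gab) * (\<Prod>i<n. group_exponent (T (Suc i)))"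
    using q.group_exponent_dvd_epi[OF q(2)] group_hom.group_exponent_dvd_epi[OF gh]
    by (intro mult_dvd_mono prod_dvd_prod) auto
  finally have ii: "group_exponent (c_nilpotent_multiplier c G)
      dvd group_exponent (c_nilpotent_multiplier c Gab) * (\<Prod>i<n. group_exponent (T (Suc i)))" .
  have q_fg: "finitely_generated (subquotient F U (A 0)) \<and>
      min_generators (subquotient F U (A 0)) \<le> min_generators (c_nilpotent_multiplier c Gab)"
    by (rule q.finitely_generated_epi[OF q(2) fgab])
  have g_fg: "finitely_generated (subquotient F (A i) (A (Suc i))) \<and>
      min_generators (subquotient F (A i) (A (Suc i))) \<le> min_generators (T (Suc i))" for i
    by (rule group_hom.finitely_generated_epi[OF gh T_fg])
  have "\<exists>S\<subseteq>R \<inter> U. finite S \<and>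
      card S \<le> min_generators (c_nilpotent_multiplier c Gab) + (\<Sum>i<n. min_generators (T (Suc i))) \<and>
      R \<inter> U \<subseteq> generate F (S \<union> ((R \<inter> U) \<inter> A n))"
    by (rule E.G.subgroup_generators_chain[OF U A A_sub AU RU(1,3) q_fg[THEN conjunct1] q_fg[THEN conjunct2]
          U_comm g_fg[THEN conjunct1] g_fg[THEN conjunct2] A_comm])
  then obtain S where S: "S \<subseteq> R \<inter> U" "finite S"
    "card S \<le> min_generators (c_nilpotent_multiplier c Gab) + (\<Sum>i<n. min_generators (T (Suc i)))"
    "R \<inter> U \<subseteq> generate F (S \<union> ((R \<inter> U) \<inter> A n))" by blast
  \<comment> \<open>The chain lemma gives generators relative to
    \<open>(R \<inter> U) \<inter> A n\<close>, which is \<open>A n\<close> itself.\<close>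
  have "generate F (S \<union> A n) = R \<inter> U"
  proof
    show "generate F (S \<union> A n) \<subseteq> R \<inter> U"
      using S(1) A_RU by (intro E.G.generate_subgroup_incl RU(1)) blast
    show "R \<inter> U \<subseteq> generate F (S \<union> A n)"
      using S(4) A_RU by (simp add: Int_absorb1)
  qed
  then have "min_generators (c_nilpotent_multiplier c G) \<le> card S"
    unfolding M using E.G.subquotient_generators[OF RU(1) A A_RU S(1,2)] by blast
  then have iii: "min_generators (c_nilpotent_multiplier c G)
      \<le> min_generators (c_nilpotent_multiplier c Gab) + (\<Sum>i<n. min_generators (T (Suc i)))"
    using S(3) by simp
  have prod: "(\<Prod>k\<in>{1..t - 1}. f k) = (\<Prod>i<n. f (Suc i))" for f :: "nat \<Rightarrow> nat"
    using prod.atLeast1_atMost_eq[of f n] unfolding n_def by simp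
  have sum: "(\<Sum>k\<in>{1..t - 1}. f k) = (\<Sum>i<n. f (Suc i))" for f :: "nat \<Rightarrow> nat"
    using sum.atLeast1_atMost_eq[of f n] unfolding n_def by simp
  show ?thesis
    unfolding prod sum using i ii iii by blast
qed

end
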